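(* Let $p=3$ and $b>0$, and let $u\in H(T_{\max})$ be a solution of the Kirchhoff problem (K) of the context with $u_0\in H^2(\Omega)\cap H_0^1(\Omega)$, $u_1\in H_0^1(\Omega)$. Suppose that one of the following cases holds: (H1) $a>1/\Lambda$ and $\lambda\in\mathbb{R}$; (H2) $a=1/\Lambda$ and $\lambda<b\lambda_1$; (H3) $0<a<1/\Lambda$, $\lambda<b\lambda_1$, $u_0\in W_3^+$ and $E(0)<d_3$. Then there exists a constant $K_2>0$ such that $$\|u_t(t)\|_2+\|\nabla u(t)\|_2\le K_2\qquad\text{for } t\in[0,T_{\max}).$$ Furthermore, if (H3) holds and in addition $\|\psi_1\|_4^4-a\|\nabla\psi_1\|_2^4>0$, then $$\|u_t(t)\|_2+\|\nabla u(t)\|_2\to0\quad\text{as }\lambda\to b\lambda_1,\qquad\text{for any } t\in[0,T_{\max}).$$ (Here $\Omega,a,b$ are fixed, $\lambda\to b\lambda_1$ from below, and for each such $\lambda$, $u=u^\lambda$ is a solution of (K) with that $\lambda$ whose initial data, possibly depending on $\lambda$, satisfy (H3) for that $\lambda$; the time $t\ge0$ is fixed and less than $T_{\max}=T_{\max}(\lambda)$ for the $\lambda$ considered.)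
   Context: $\Omega\subset\mathbb{R}^3$ is a bounded open set with smooth boundary. $\|\cdot\|_q$ is the $L^q(\Omega)$ norm. Problem (K), with $p=3$: $$u_{tt}-\Big(a\int_\Omega|\nabla u|^2dx+b\Big)\Delta u=\lambda u+|u|^{2}u\ (t>0,\ x\in\Omega),\quad u(0,x)=u_0(x),\ u_t(0,x)=u_1(x)\ (x\in\Omega),\quad u=0\ (t\ge0,\ x\in\partial\Omega).$$ $H(T)=C([0,T);H_0^1(\Omega)\cap H^2(\Omega))\cap C^1([0,T);H_0^1(\Omega))\cap C^2([0,T);L^2(\Omega))$. For $u_0\in H^2(\Omega)\cap H_0^1(\Omega)$, $u_1\in H_0^1(\Omega)$, problem (K) has a unique solution in $H(T)$ for some $T>0$ (known local existence result); $T_{\max}\in(0,\infty]$ is its maximal existence time. $u(t)$ denotes $u(t,\cdot)$. $\lambda_1>0$ is the principal Dirichlet eigenvalue of $-\Delta$ on $\Omega$, with positive eigenfunction $\psi_1$. $\Lambda=\inf\{\|\nabla u\|_2^4:\ u\in H_0^1(\Omega),\ \|u\|_4=1\}>0$. $$J(u)=\frac a4\|\nabla u\|_2^4+\frac b2\|\nabla u\|_2^2-\frac\lambda2\|u\|_2^2-\frac14\|u\|_4^4,\qquad I(u)=a\|\nabla u\|_2^4+b\|\nabla u\|_2^2-\lambda\|u\|_2^2-\|u\|_4^4,$$ $E(0)=\frac12\|u_1\|_2^2+J(u_0)$, $N_3=\{u\in H_0^1(\Omega)\setminus\{0\}: I(u)=0\}$, $N_3^+=\{u\in H_0^1(\Omega):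 I(u)>0\}\cup\{0\}$, $d_3=\inf_{N_3}J$, $W_3^+=\{u\in N_3^+:J(u)<d_3\}$. The quantities $J,I,d_3,W_3^+$ depend on $\lambda$. *)

theory Defs
  imports "HOL-Analysis.Analysis"
begin

section \<open>Smooth functions and smooth boundaries\<close>

primrec Ck_on :: "nat \<Rightarrow> 'a::euclidean_space set \<Rightarrow> ('a \<Rightarrow> real) \<Rightarrow> bool" where
  "Ck_on 0 U f \<longleftrightarrow> continuous_on U f"
| "Ck_on (Suc k) U f \<longleftrightarrow>
     (\<forall>x\<in>U. f differentiable (at x)) \<and>
     (\<forall>i\<in>Basis. Ck_on k U (\<lambda>x. frechet_derivative f (at x) i))"

definition smooth_on :: "'a::euclidean_space set \<Rightarrow> ('a \<Rightarrow> real) \<Rightarrow> bool" where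
  "smooth_on U f \<longleftrightarrow> (\<forall>k. Ck_on k U f)"

text \<open>Near each boundary point the set is the region where a smooth function with
  nonvanishing differential is negative; in particular it lies locally on one side of its boundary.\<close>

definition smooth_boundary :: "'a::euclidean_space set \<Rightarrow> bool" where
  "smooth_boundary \<Omega> \<longleftrightarrow>
     (\<forall>p\<in>frontier \<Omega>. \<exists>U \<rho>. open U \<and> p \<in> U \<and> smooth_on U \<rho> \<and>
        (\<forall>x\<in>U. frechet_derivative \<rho> (at x) \<noteq> (\<lambda>_. 0)) \<and>
        \<Omega> \<inter> U = {x \<in> U. \<rho> x < 0})"


section \<open>Lebesgue and Sobolev spaces on an open set\<close>

text \<open>Elements of the function spaces are representatives defined on the whole ambient space, of
  which only the values on \<open>\<Omega>\<close> matter; equality in a function space is equality a.e. on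
  \<open>\<Omega>\<close>, and the norms below are seminorms on representatives.\<close>

definition Lnorm :: "'a::euclidean_space set \<Rightarrow> real \<Rightarrow> ('a \<Rightarrow> 'b::real_normed_vector) \<Rightarrow> real" where
  "Lnorm \<Omega> q f = (LINT x|lebesgue_on \<Omega>. norm (f x) powr q) powr (1 / q)"

definition ae_eq :: "'a::euclidean_space set \<Rightarrow> ('a \<Rightarrow> real) \<Rightarrow> ('a \<Rightarrow> real) \<Rightarrow> bool" where
  "ae_eq \<Omega> f g \<longleftrightarrow> (AE x in lebesgue_on \<Omega>. f x = g x)"

definition L2 :: "'a::euclidean_space set \<Rightarrow> ('a \<Rightarrow> real) set" where
  "L2 \<Omega> = {f. f \<in> borel_measurable (lebesgue_on \<Omega>) \<and> integrable (lebesgue_on \<Omega>) (\<lambda>x. (f x)\<^sup>2)}"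

definition test_functions :: "'a::euclidean_space set \<Rightarrow> ('a \<Rightarrow> real) set" where
  "test_functions \<Omega> =
     {\<phi>. smooth_on UNIV \<phi> \<and> compact (closure {x. \<phi> x \<noteq> 0}) \<and> closure {x. \<phi> x \<noteq> 0} \<subseteq> \<Omega>}"

definition has_weak_deriv ::
  "'a::euclidean_space set \<Rightarrow> 'a \<Rightarrow> ('a \<Rightarrow> real) \<Rightarrow> ('a \<Rightarrow> real) \<Rightarrow> bool" where
  "has_weak_deriv \<Omega> i f g \<longleftrightarrow> f \<in> L2 \<Omega> \<and> g \<in> L2 \<Omega> \<and>
     (\<forall>\<phi>\<in>test_functions \<Omega>.
        (LINT x|lebesgue_on \<Omega>. f x * frechet_derivative \<phi> (at x) i) =
        - (LINT x|lebesgue_on \<Omega>. g x * \<phi> x))"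

text \<open>The weak derivative is unique up to a null set, so the choice is immaterial.\<close>

definition wderiv :: "'a::euclidean_space set \<Rightarrow> 'a \<Rightarrow> ('a \<Rightarrow> real) \<Rightarrow> 'a \<Rightarrow> real" where
  "wderiv \<Omega> i f = (SOME g. has_weak_deriv \<Omega> i f g)"

definition wgrad :: "'a::euclidean_space set \<Rightarrow> ('a \<Rightarrow> real) \<Rightarrow> 'a \<Rightarrow> 'a" where
  "wgrad \<Omega> f x = (\<Sum>i\<in>Basis. wderiv \<Omega> i f x *\<^sub>R i)"

definition wlaplacian :: "'a::euclidean_space set \<Rightarrow> ('a \<Rightarrow> real) \<Rightarrow> 'a \<Rightarrow> real" where
  "wlaplacian \<Omega> f x = (\<Sum>i\<in>Basis. wderiv \<Omega> i (wderiv \<Omega> i f) x)"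

definition Sob1 :: "'a::euclidean_space set \<Rightarrow> ('a \<Rightarrow> real) set" where
  "Sob1 \<Omega> = {f \<in> L2 \<Omega>. \<forall>i\<in>Basis. \<exists>g. has_weak_deriv \<Omega> i f g}"

definition Sob1_norm :: "'a::euclidean_space set \<Rightarrow> ('a \<Rightarrow> real) \<Rightarrow> real" where
  "Sob1_norm \<Omega> f = sqrt ((Lnorm \<Omega> 2 f)\<^sup>2 + (Lnorm \<Omega> 2 (wgrad \<Omega> f))\<^sup>2)"

text \<open>\<open>H\<^sub>0\<^sup>1(\<Omega>)\<close>: the closure of the test functions in \<open>H\<^sup>1(\<Omega>)\<close>.\<close>

definition Sob1_0 :: "'a::euclidean_space set \<Rightarrow> ('a \<Rightarrow> real) set" where
  "Sob1_0 \<Omega> = {f \<in> Sob1 \<Omega>. \<exists>\<phi>::nat \<Rightarrow> 'a \<Rightarrow> real.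
      (\<forall>n. \<phi> n \<in> test_functions \<Omega>) \<and> (\<lambda>n. Sob1_norm \<Omega> (\<lambda>x. \<phi> n x - f x)) \<longlonglongrightarrow> 0}"

definition Sob2 :: "'a::euclidean_space set \<Rightarrow> ('a \<Rightarrow> real) set" where
  "Sob2 \<Omega> = {f \<in> Sob1 \<Omega>. \<forall>i\<in>Basis. wderiv \<Omega> i f \<in> Sob1 \<Omega>}"

definition Sob2_norm :: "'a::euclidean_space set \<Rightarrow> ('a \<Rightarrow> real) \<Rightarrow> real" where
  "Sob2_norm \<Omega> f = sqrt ((Sob1_norm \<Omega> f)\<^sup>2 +
     (\<Sum>i\<in>Basis. \<Sum>j\<in>Basis. (Lnorm \<Omega> 2 (wderiv \<Omega> j (wderiv \<Omega> i f)))\<^sup>2))"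


section \<open>Functions of time with values in a function space\<close>

definition time_interval :: "ereal \<Rightarrow> real set" where
  "time_interval T = {t. 0 \<le> t \<and> ereal t < T}"

text \<open>\<open>v\<close> is the derivative of \<open>u\<close> at \<open>t\<close> relative to \<open>I\<close> (one-sided at an endpoint of \<open>I\<close>),
  the difference quotients converging in the norm \<open>N\<close>.\<close>

definition has_time_deriv_at ::
  "(('a \<Rightarrow> real) \<Rightarrow> real) \<Rightarrow> real set \<Rightarrow> (real \<Rightarrow> 'a \<Rightarrow> real) \<Rightarrow> real \<Rightarrow> ('a \<Rightarrow> real) \<Rightarrow> bool" where
  "has_time_deriv_at N I u t v \<longleftrightarrow>
     ((\<lambda>s. N (\<lambda>x. (u s x - u t x) / (s - t) - v x)) \<longlongrightarrow> 0) (at t within I)"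

text \<open>\<open>Ck_time k X N I\<close> is \<open>C\<^sup>k(I; X)\<close>, where the space \<open>X\<close> carries the norm \<open>N\<close>.\<close>

primrec Ck_time ::
  "nat \<Rightarrow> ('a \<Rightarrow> real) set \<Rightarrow> (('a \<Rightarrow> real) \<Rightarrow> real) \<Rightarrow> real set \<Rightarrow> (real \<Rightarrow> 'a \<Rightarrow> real) set" where
  "Ck_time 0 X N I = {u. \<forall>t\<in>I. u t \<in> X \<and> ((\<lambda>s. N (\<lambda>x. u s x - u t x)) \<longlongrightarrow> 0) (at t within I)}"
| "Ck_time (Suc k) X N I = {u. (\<forall>t\<in>I. u t \<in> X) \<and>
     (\<exists>v\<in>Ck_time k X N I. \<forall>t\<in>I. has_time_deriv_at N I u t (v t))}"

definition solution_space :: "'a::euclidean_space set \<Rightarrow> ereal \<Rightarrow> (real \<Rightarrow> 'a \<Rightarrow> real) set" where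
  "solution_space \<Omega> T =
     Ck_time 0 (Sob1_0 \<Omega> \<inter> Sob2 \<Omega>) (Sob2_norm \<Omega>) (time_interval T) \<inter>
     Ck_time 1 (Sob1_0 \<Omega>) (Sob1_norm \<Omega>) (time_interval T) \<inter>
     Ck_time 2 (L2 \<Omega>) (Lnorm \<Omega> 2) (time_interval T)"

text \<open>The time derivative in \<open>L\<^sup>2(\<Omega>)\<close>, unique up to a null set. On \<open>solution_space \<Omega> T\<close> it agrees
  a.e. with the derivative in \<open>H\<^sub>0\<^sup>1(\<Omega>)\<close>.\<close>

definition time_deriv ::
  "'a::euclidean_space set \<Rightarrow> ereal \<Rightarrow> (real \<Rightarrow> 'a \<Rightarrow> real) \<Rightarrow> real \<Rightarrow> 'a \<Rightarrow> real" where
  "time_deriv \<Omega> T u t =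
     (SOME v. v \<in> L2 \<Omega> \<and> has_time_deriv_at (Lnorm \<Omega> 2) (time_interval T) u t v)"


section \<open>The Kirchhoff problem\<close>

text \<open>The Dirichlet condition is the membership of \<open>u t\<close> in \<open>H\<^sub>0\<^sup>1(\<Omega>)\<close>, which is part of
  \<open>solution_space\<close>.\<close>

definition kirchhoff_solution ::
  "'a::euclidean_space set \<Rightarrow> real \<Rightarrow> real \<Rightarrow> real \<Rightarrow> ('a \<Rightarrow> real) \<Rightarrow> ('a \<Rightarrow> real) \<Rightarrow>
   ereal \<Rightarrow> (real \<Rightarrow> 'a \<Rightarrow> real) \<Rightarrow> bool" where
  "kirchhoff_solution \<Omega> a b lam u0 u1 T u \<longleftrightarrow>
     u \<in> solution_space \<Omega> T \<and>
     (\<forall>t. 0 < t \<and> ereal t < T \<longrightarrow>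
        (AE x in lebesgue_on \<Omega>.
           time_deriv \<Omega> T (time_deriv \<Omega> T u) t x
             - (a * (LINT y|lebesgue_on \<Omega>. (norm (wgrad \<Omega> (u t) y))\<^sup>2) + b) * wlaplacian \<Omega> (u t) x
           = lam * u t x + \<bar>u t x\<bar>\<^sup>2 * u t x)) \<and>
     ae_eq \<Omega> (u 0) u0 \<and> ae_eq \<Omega> (time_deriv \<Omega> T u 0) u1"

definition T_max ::
  "'a::euclidean_space set \<Rightarrow> real \<Rightarrow> real \<Rightarrow> real \<Rightarrow> ('a \<Rightarrow> real) \<Rightarrow> ('a \<Rightarrow> real) \<Rightarrow> ereal" where
  "T_max \<Omega> a b lam u0 u1 = Sup {T. 0 < T \<and> (\<exists>u. kirchhoff_solution \<Omega> a b lam u0 u1 T u)}"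


section \<open>Eigenvalues, functionals and the potential well\<close>

text \<open>Weak formulation of \<open>-\<Delta>\<psi> = \<mu> \<psi>\<close> in \<open>\<Omega>\<close>, \<open>\<psi> = 0\<close> on the boundary.\<close>

definition dirichlet_eigenfunction ::
  "'a::euclidean_space set \<Rightarrow> real \<Rightarrow> ('a \<Rightarrow> real) \<Rightarrow> bool" where
  "dirichlet_eigenfunction \<Omega> \<mu> \<psi> \<longleftrightarrow> \<psi> \<in> Sob1_0 \<Omega> \<and> \<not> ae_eq \<Omega> \<psi> (\<lambda>_. 0) \<and>
     (\<forall>\<phi>\<in>Sob1_0 \<Omega>. (LINT x|lebesgue_on \<Omega>. wgrad \<Omega> \<psi> x \<bullet> wgrad \<Omega> \<phi> x) =
        \<mu> * (LINT x|lebesgue_on \<Omega>. \<psi> x * \<phi> x))"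

definition principal_eigenvalue :: "'a::euclidean_space set \<Rightarrow> real" where
  "principal_eigenvalue \<Omega> = Inf {\<mu>. \<exists>\<psi>. dirichlet_eigenfunction \<Omega> \<mu> \<psi>}"

definition positive_principal_eigenfunction :: "'a::euclidean_space set \<Rightarrow> ('a \<Rightarrow> real) \<Rightarrow> bool" where
  "positive_principal_eigenfunction \<Omega> \<psi> \<longleftrightarrow>
     dirichlet_eigenfunction \<Omega> (principal_eigenvalue \<Omega>) \<psi> \<and> (AE x in lebesgue_on \<Omega>. 0 < \<psi> x)"

definition Lambda_const :: "'a::euclidean_space set \<Rightarrow> real" where
  "Lambda_const \<Omega> = Inf {(Lnorm \<Omega> 2 (wgrad \<Omega> u)) ^ 4 | u. u \<in> Sob1_0 \<Omega> \<and> Lnorm \<Omega> 4 u = 1}"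

definition J_fun :: "'a::euclidean_space set \<Rightarrow> real \<Rightarrow> real \<Rightarrow> real \<Rightarrow> ('a \<Rightarrow> real) \<Rightarrow> real" where
  "J_fun \<Omega> a b lam u =
     a / 4 * (Lnorm \<Omega> 2 (wgrad \<Omega> u)) ^ 4 + b / 2 * (Lnorm \<Omega> 2 (wgrad \<Omega> u))\<^sup>2
     - lam / 2 * (Lnorm \<Omega> 2 u)\<^sup>2 - 1 / 4 * (Lnorm \<Omega> 4 u) ^ 4"

definition I_fun :: "'a::euclidean_space set \<Rightarrow> real \<Rightarrow> real \<Rightarrow> real \<Rightarrow> ('a \<Rightarrow> real) \<Rightarrow> real" where
  "I_fun \<Omega> a b lam u =
     a * (Lnorm \<Omega> 2 (wgrad \<Omega> u)) ^ 4 + b * (Lnorm \<Omega> 2 (wgrad \<Omega> u))\<^sup>2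
     - lam * (Lnorm \<Omega> 2 u)\<^sup>2 - (Lnorm \<Omega> 4 u) ^ 4"

definition initial_energy ::
  "'a::euclidean_space set \<Rightarrow> real \<Rightarrow> real \<Rightarrow> real \<Rightarrow> ('a \<Rightarrow> real) \<Rightarrow> ('a \<Rightarrow> real) \<Rightarrow> real" where
  "initial_energy \<Omega> a b lam u0 u1 = 1 / 2 * (Lnorm \<Omega> 2 u1)\<^sup>2 + J_fun \<Omega> a b lam u0"

definition N3 :: "'a::euclidean_space set \<Rightarrow> real \<Rightarrow> real \<Rightarrow> real \<Rightarrow> ('a \<Rightarrow> real) set" where
  "N3 \<Omega> a b lam = {u \<in> Sob1_0 \<Omega>. \<not> ae_eq \<Omega> u (\<lambda>_. 0) \<and> I_fun \<Omega> a b lam u = 0}"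

definition N3_plus :: "'a::euclidean_space set \<Rightarrow> real \<Rightarrow> real \<Rightarrow> real \<Rightarrow> ('a \<Rightarrow> real) set" where
  "N3_plus \<Omega> a b lam =
     {u \<in> Sob1_0 \<Omega>. I_fun \<Omega> a b lam u > 0} \<union> {u \<in> Sob1_0 \<Omega>. ae_eq \<Omega> u (\<lambda>_. 0)}"

text \<open>The infimum is meaningful when \<open>N3\<close> is nonempty and \<open>J_fun\<close> is bounded below on it, as is the
  case for nonempty \<open>\<Omega>\<close> if \<open>a * Lambda_const \<Omega> < 1\<close> and \<open>lam < b * principal_eigenvalue \<Omega>\<close>, the
  only parameters for which \<open>d3\<close> is used.\<close>

definition d3 :: "'a::euclidean_space set \<Rightarrow> real \<Rightarrow> real \<Rightarrow> real \<Rightarrow> real" where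
  "d3 \<Omega> a b lam = (INF u\<in>N3 \<Omega> a b lam. J_fun \<Omega> a b lam u)"

definition W3_plus :: "'a::euclidean_space set \<Rightarrow> real \<Rightarrow> real \<Rightarrow> real \<Rightarrow> ('a \<Rightarrow> real) set" where
  "W3_plus \<Omega> a b lam = {u \<in> N3_plus \<Omega> a b lam. J_fun \<Omega> a b lam u < d3 \<Omega> a b lam}"

definition hyp_H1 :: "'a::euclidean_space set \<Rightarrow> real \<Rightarrow> bool" where
  "hyp_H1 \<Omega> a \<longleftrightarrow> a > 1 / Lambda_const \<Omega>"

definition hyp_H2 :: "'a::euclidean_space set \<Rightarrow> real \<Rightarrow> real \<Rightarrow> real \<Rightarrow> bool" where
  "hyp_H2 \<Omega> a b lam \<longleftrightarrow> a = 1 / Lambda_const \<Omega> \<and> lam < b * principal_eigenvalue \<Omega>"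

definition hyp_H3 ::
  "'a::euclidean_space set \<Rightarrow> real \<Rightarrow> real \<Rightarrow> real \<Rightarrow> ('a \<Rightarrow> real) \<Rightarrow> ('a \<Rightarrow> real) \<Rightarrow> bool" where
  "hyp_H3 \<Omega> a b lam u0 u1 \<longleftrightarrow>
     0 < a \<and> a < 1 / Lambda_const \<Omega> \<and> lam < b * principal_eigenvalue \<Omega> \<and>
     u0 \<in> W3_plus \<Omega> a b lam \<and> initial_energy \<Omega> a b lam u0 u1 < d3 \<Omega> a b lam"

text \<open>The data are admissible and \<open>u\<close> is a solution of the problem on \<open>[0, T_max)\<close>.\<close>

definition maximal_solution ::
  "'a::euclidean_space set \<Rightarrow> real \<Rightarrow> real \<Rightarrow> real \<Rightarrow> ('a \<Rightarrow> real) \<Rightarrow> ('a \<Rightarrow> real) \<Rightarrow>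
   (real \<Rightarrow> 'a \<Rightarrow> real) \<Rightarrow> bool" where
  "maximal_solution \<Omega> a b lam u0 u1 u \<longleftrightarrow>
     u0 \<in> Sob2 \<Omega> \<inter> Sob1_0 \<Omega> \<and> u1 \<in> Sob1_0 \<Omega> \<and>
     kirchhoff_solution \<Omega> a b lam u0 u1 (T_max \<Omega> a b lam u0 u1) u"

text \<open>The quantity \<open>\<parallel>u\<^sub>t(t)\<parallel>\<^sub>2 + \<parallel>\<nabla>u(t)\<parallel>\<^sub>2\<close> for \<open>u\<close> defined on \<open>[0, T)\<close>.\<close>

definition sol_size ::
  "'a::euclidean_space set \<Rightarrow> ereal \<Rightarrow> (real \<Rightarrow> 'a \<Rightarrow> real) \<Rightarrow> real \<Rightarrow> real" where
  "sol_size \<Omega> T u t = Lnorm \<Omega> 2 (time_deriv \<Omega> T u t) + Lnorm \<Omega> 2 (wgrad \<Omega> (u t))"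

end

theory Submission
  imports Defs "HOL-Complex_Analysis.Great_Picard"
begin

text \<open>Along a solution the energy \<open>\<parallel>u\<^sub>t\<parallel>\<^sub>2\<^sup>2 / 2 + J(u)\<close> is conserved: integration by parts against
  \<open>u\<^sub>t \<in> H\<^sub>0\<^sup>1(\<Omega>)\<close> turns the equation into the vanishing of its derivative. Under H1 and H2 the
  functional \<open>J\<close> itself is coercive in \<open>\<parallel>\<nabla>u\<parallel>\<^sub>2\<close>, by the definition of \<open>\<Lambda>\<close> and the variational
  characterisation of \<open>\<lambda>\<^sub>1\<close>. Under H3 the solution stays in the potential well, where
  \<open>J \<ge> (b \<parallel>\<nabla>u\<parallel>\<^sub>2\<^sup>2 - \<lambda> \<parallel>u\<parallel>\<^sub>2\<^sup>2) / 4\<close>; the depth of the well, bounded by the maximum of \<open>J\<close> on the ray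
  through \<open>\<psi>\<^sub>1\<close>, is of order \<open>(b \<lambda>\<^sub>1 - \<lambda>)\<^sup>2\<close>, while the coercivity constant is of order
  \<open>b \<lambda>\<^sub>1 - \<lambda>\<close>. The facts used about \<open>H\<^sub>0\<^sup>1(\<Omega>)\<close> are the embedding into \<open>L\<^sup>4\<close> (Ladyzhenskaya) and,
  to identify \<open>\<lambda>\<^sub>1\<close>, defined as the least eigenvalue, with the minimum of the Rayleigh quotient,
  the compactness of the embedding into \<open>L\<^sup>2\<close>.\<close>

section \<open>Smooth functions\<close>

text \<open>Elements of the spaces are representatives, and both \<open>wderiv\<close> and
  \<open>time_deriv\<close> are arbitrary choices, so each quantity has to be shown to depend only
  on a.e. classes; uniqueness of the choices rests on the fundamental lemma. Since
  \<open>Sob1_0\<close> is the closure of the test functions, the Poincare and L^4 inequalities are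
  proved for a test function, extended by zero to the whole space where translations and Tonelli are
  available, and then passed to the limit. The quartic term of J is a squared L^2 norm of u^2: the
  L^4 bound puts products of functions of H_0^1 into L^2, so u^2 is differentiable in time with
  values in L^2 and the energy can be differentiated without regularising the solution. In case H3
  the squared norm of u_t is at most 2 d3 and that of the gradient at most 4 d3 divided by the
  coercivity constant; a quadratic depth over a linear constant leaves a bound of first order in b
  lambda_1 - lambda, which is why both tend to 0.\<close>

abbreviation partial_deriv :: "'a::euclidean_space \<Rightarrow> ('a \<Rightarrow> real) \<Rightarrow> 'a \<Rightarrow> real" where
  "partial_deriv i f x \<equiv> frechet_derivative f (at x) i"

text \<open>The product rule leaves one factor undifferentiated; the induction for products
  therefore has to lower the smoothness class of that factor by one.\<close>

lemma Ck_on_SucD: "Ck_on (Suc k) UNIV f \<Longrightarrow> Ck_on k UNIV f"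
proof (induction k arbitrary: f)
  case 0
  then show ?case
    by (auto intro!: differentiable_imp_continuous_on simp: differentiable_on_def
        intro: differentiable_at_withinI)
qed auto

lemma Ck_on_add:
  "Ck_on k UNIV f \<Longrightarrow> Ck_on k UNIV g \<Longrightarrow> Ck_on k UNIV (\<lambda>x. f x + g x)"
proof (induction k arbitrary: f g)
  case (Suc k)
  have "frechet_derivative (\<lambda>x. f x + g x) (at x) =
     (\<lambda>h. frechet_derivative f (at x) h + frechet_derivative g (at x) h)" for x
    using Suc.prems by (intro frechet_derivative_at[symmetric] has_derivative_add)
      (auto simp flip: frechet_derivative_works)
  then show ?case using Suc by auto
qed (auto intro: continuous_intros)

lemma Ck_on_mult:
  "Ck_on k UNIV f \<Longrightarrow> Ck_on k UNIV g \<Longrightarrow> Ck_on k UNIV (\<lambda>x. f x * g x)"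
proof (induction k arbitrary: f g)
  case (Suc k)
  have "frechet_derivative (\<lambda>x. f x * g x) (at x) =
     (\<lambda>h. f x * frechet_derivative g (at x) h + frechet_derivative f (at x) h * g x)" for x
    using Suc.prems by (intro frechet_derivative_at[symmetric] has_derivative_mult)
      (auto simp flip: frechet_derivative_works)
  then show ?case using Suc Ck_on_SucD[OF Suc.prems(1)] Ck_on_SucD[OF Suc.prems(2)]
    by (auto intro!: Ck_on_add)
qed (auto intro: continuous_intros)

lemma Ck_on_const: "Ck_on k UNIV (\<lambda>x. c)"
  by (induction k arbitrary: c) auto

lemma Ck_on_bounded_linear:
  assumes "bounded_linear f" shows "Ck_on k UNIV f"
proof (cases k)
  case 0
  then show ?thesis using assms by (simp add: linear_continuous_on)
next
  case (Suc j)
  have "frechet_derivative f (at x) = f" for x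
    using assms by (metis bounded_linear_imp_has_derivative frechet_derivative_at)
  with Suc show ?thesis
    using assms by (simp add: Ck_on_const bounded_linear_imp_differentiable)
qed

lemma Ck_on_real_polynomial_function:
  "real_polynomial_function f \<Longrightarrow> Ck_on k UNIV f"
  by (induction rule: real_polynomial_function.induct)
    (auto intro: Ck_on_add Ck_on_mult Ck_on_const Ck_on_bounded_linear)

lemma smooth_on_mult: "smooth_on UNIV f \<Longrightarrow> smooth_on UNIV g \<Longrightarrow> smooth_on UNIV (\<lambda>x. f x * g x)"
  by (simp add: smooth_on_def Ck_on_mult)

lemma smooth_on_add: "smooth_on UNIV f \<Longrightarrow> smooth_on UNIV g \<Longrightarrow> smooth_on UNIV (\<lambda>x. f x + g x)"
  by (simp add: smooth_on_def Ck_on_add)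

lemma smooth_on_const: "smooth_on UNIV (\<lambda>x. c)"
  by (simp add: smooth_on_def Ck_on_const)

lemma smooth_on_real_polynomial_function: "real_polynomial_function f \<Longrightarrow> smooth_on UNIV f"
  by (simp add: smooth_on_def Ck_on_real_polynomial_function)

lemma smooth_on_differentiable: "smooth_on UNIV f \<Longrightarrow> f differentiable (at x)"
  unfolding smooth_on_def by (metis Ck_on.simps(2) UNIV_I)

lemma smooth_on_continuous: "smooth_on UNIV f \<Longrightarrow> continuous_on UNIV f"
  unfolding smooth_on_def by (metis Ck_on.simps(1))

lemma smooth_on_partial_deriv: "smooth_on UNIV f \<Longrightarrow> i \<in> Basis \<Longrightarrow> smooth_on UNIV (partial_deriv i f)"
  unfolding smooth_on_def by (metis Ck_on.simps(2))

lemma smooth_on_has_derivative: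
  "smooth_on UNIV f \<Longrightarrow> (f has_derivative frechet_derivative f (at x)) (at x)"
  using smooth_on_differentiable frechet_derivative_works by blast

text \<open>The classical function \<open>exp (-1/s)\<close>, divided by powers of \<open>s\<close> so that the family is closed
  under differentiation.\<close>

definition flat_exp :: "nat \<Rightarrow> real \<Rightarrow> real" where
  "flat_exp m s = (if 0 < s then exp (- 1 / s) / s ^ m else 0)"

lemma power_le_fact_exp:
  fixes x :: real assumes "0 \<le> x" shows "x ^ n \<le> fact n * exp x"
proof -
  have "(\<Sum>k\<in>{n}. x ^ k /\<^sub>R fact k) \<le> (\<Sum>k. x ^ k /\<^sub>R fact k)"
    using assms by (intro sum_le_suminf summable_exp_generic) auto
  then show ?thesis by (simp add: exp_def field_simps)
qed

text \<open>The term of order m + 2 of the exponential series at 1/s leaves two factors s after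
  division by \<open>s ^ m\<close>. A quadratic bound is what makes the derivative at the origin
  exist and vanish.\<close>

lemma abs_flat_exp_le: "\<bar>flat_exp m s\<bar> \<le> fact (m + 2) * s\<^sup>2"
proof (cases "0 < s")
  case True
  have "(1 / s) ^ (m + 2) \<le> fact (m + 2) * exp (1 / s)"
    using True by (intro power_le_fact_exp) auto
  then have "exp (- (1 / s)) \<le> fact (m + 2) * s ^ (m + 2)"
    using True by (simp add: exp_minus power_one_over field_simps)
  then have "exp (- (1 / s)) / s ^ m \<le> fact (m + 2) * s\<^sup>2"
    using True by (simp add: divide_le_eq power_add power2_eq_square mult_ac)
  then show ?thesis using True by (simp add: flat_exp_def)
qed (simp add: flat_exp_def)

lemma flat_exp_has_real_derivative:
  "(flat_exp m has_real_derivative flat_exp (m + 2) s - m * flat_exp (m + 1) s) (at s)"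
proof (cases s "0::real" rule: linorder_cases)
  case less
  have "((\<lambda>s. 0) has_real_derivative 0) (at s)" by simp
  then have "(flat_exp m has_real_derivative 0) (at s)"
    by (rule has_field_derivative_transform_within_open[where S="{..<0}"])
      (use less in \<open>auto simp: flat_exp_def\<close>)
  with less show ?thesis by (simp add: flat_exp_def)
next
  case equal
  have "((\<lambda>h. (flat_exp m (0 + h) - flat_exp m 0) / h) \<longlongrightarrow> 0) (at 0)"
  proof (rule Lim_null_comparison)
    show "\<forall>\<^sub>F h in at 0. norm ((flat_exp m (0 + h) - flat_exp m 0) / h) \<le> fact (m + 2) * \<bar>h\<bar>"
    proof (rule eventually_mono[OF eventually_at_ball'[of 1 _ UNIV]])
      fix h :: real assume "h \<in> ball 0 1 \<and> h \<noteq> 0 \<and> h \<in> UNIV"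
      then have h: "h \<noteq> 0" by simp
      have "\<bar>flat_exp m h\<bar> / \<bar>h\<bar> \<le> fact (m + 2) * h\<^sup>2 / \<bar>h\<bar>"
        using abs_flat_exp_le by (intro divide_right_mono) auto
      also have "\<dots> = fact (m + 2) * \<bar>h\<bar>"
        using h by (simp add: power2_eq_square abs_if)
      finally show "norm ((flat_exp m (0 + h) - flat_exp m 0) / h) \<le> fact (m + 2) * \<bar>h\<bar>"
        by (simp add: flat_exp_def abs_divide)
    qed simp
    show "((\<lambda>h::real. fact (m + 2) * \<bar>h\<bar>) \<longlongrightarrow> 0) (at 0)"
      by (auto intro!: tendsto_eq_intros)
  qed
  then show ?thesis using equal by (simp add: DERIV_def flat_exp_def)
next
  case greater
  have "((\<lambda>s. exp (- 1 / s) / s ^ m) has_real_derivative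
      flat_exp (m + 2) s - m * flat_exp (m + 1) s) (at s)"
    using greater
    by (auto intro!: derivative_eq_intros simp: flat_exp_def field_simps power2_eq_square)
       (cases m; simp add: field_simps power2_eq_square)
  then show ?thesis
    by (rule has_field_derivative_transform_within_open[where S="{0<..}"])
      (use greater in \<open>auto simp: flat_exp_def\<close>)
qed

text \<open>Each derivative is a smooth partial derivative of \<open>p\<close> times members of the
  same family with larger index; hence the induction on \<open>k\<close> with \<open>m\<close>
  arbitrary.\<close>

lemma Ck_on_flat_exp:
  assumes "real_polynomial_function p"
  shows "Ck_on k UNIV (\<lambda>x. flat_exp m (p x))"
proof (induction k arbitrary: m)
  case 0
  have "continuous_on UNIV (flat_exp m)"
    by (meson DERIV_continuous_on DERIV_subset flat_exp_has_real_derivative top_greatest)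
  moreover have "continuous_on UNIV p"
    using Ck_on_real_polynomial_function[OF assms, of 0] by simp
  ultimately show ?case
    using continuous_on_compose2[of UNIV "flat_exp m" UNIV p] by auto
next
  case (Suc k)
  have p: "smooth_on UNIV p" by (rule smooth_on_real_polynomial_function[OF assms])
  have der: "((\<lambda>x. flat_exp m (p x)) has_derivative
     (\<lambda>h. frechet_derivative p (at x) h * (flat_exp (m + 2) (p x) - m * flat_exp (m + 1) (p x)))) (at x)" for x
    using has_derivative_compose[OF smooth_on_has_derivative[OF p],
        OF flat_exp_has_real_derivative[unfolded has_field_derivative_def]] by (simp add: mult_ac)
  have "Ck_on k UNIV (\<lambda>x. partial_deriv i p x *
      (flat_exp (m + 2) (p x) + (- real m) * flat_exp (m + 1) (p x)))" if "i \<in> Basis" for i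
    using smooth_on_partial_deriv[OF p that]
    by (intro Ck_on_mult Ck_on_add Ck_on_const Suc) (auto simp: smooth_on_def)
  then show ?case
    using der by (auto simp: differentiable_def frechet_derivative_at[OF der, symmetric])
qed


section \<open>Test functions\<close>

lemma test_functionsD:
  assumes "\<phi> \<in> test_functions \<Omega>"
  shows "smooth_on UNIV \<phi>" and "x \<notin> \<Omega> \<Longrightarrow> \<phi> x = 0"
    and "x \<notin> \<Omega> \<Longrightarrow> i \<in> Basis \<Longrightarrow> partial_deriv i \<phi> x = 0"
    and "bounded {x. \<phi> x \<noteq> 0}"
proof -
  show s: "smooth_on UNIV \<phi>" and "bounded {x. \<phi> x \<noteq> 0}"
    using assms by (auto simp: test_functions_def intro: bounded_subset[OF compact_imp_bounded closure_subset])
  show "x \<notin> \<Omega> \<Longrightarrow> \<phi> x = 0"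
    using assms closure_subset[of "{x. \<phi> x \<noteq> 0}"] by (auto simp: test_functions_def)
  assume "x \<notin> \<Omega>"
  then have x: "x \<in> - closure {x. \<phi> x \<noteq> 0}" using assms by (auto simp: test_functions_def)
  have "(\<phi> has_derivative (\<lambda>h. 0)) (at x)"
    by (rule has_derivative_transform_within_open[where f="\<lambda>_. 0" and s="- closure {x. \<phi> x \<noteq> 0}"])
      (use x closure_subset[of "{x. \<phi> x \<noteq> 0}"] in auto)
  from fun_cong[OF frechet_derivative_at[OF this], of i] show "partial_deriv i \<phi> x = 0"
    by simp
qed

lemma test_functions_smooth_mult:
  assumes "\<phi> \<in> test_functions \<Omega>" "smooth_on UNIV f"
  shows "(\<lambda>x. f x * \<phi> x) \<in> test_functions \<Omega>"
proof -
  have sub: "closure {x. f x * \<phi> x \<noteq> 0} \<subseteq> closure {x. \<phi> x \<noteq> 0}" by (intro closure_mono) auto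
  moreover have "compact (closure {x. f x * \<phi> x \<noteq> 0})"
    using assms(1) compact_Int_closed[of "closure {x. \<phi> x \<noteq> 0}" "closure {x. f x * \<phi> x \<noteq> 0}"] sub
    by (simp add: test_functions_def Int_absorb1)
  ultimately show ?thesis
    using assms by (auto simp: test_functions_def intro: smooth_on_mult)
qed

lemma test_functions_scale:
  "\<phi> \<in> test_functions \<Omega> \<Longrightarrow> (\<lambda>x. c * \<phi> x) \<in> test_functions \<Omega>"
  by (rule test_functions_smooth_mult[OF _ smooth_on_const])

lemma test_functions_add:
  assumes "\<phi> \<in> test_functions \<Omega>" "\<psi> \<in> test_functions \<Omega>"
  shows "(\<lambda>x. \<phi> x + \<psi> x) \<in> test_functions \<Omega>"
proof -
  have sub: "closure {x. \<phi> x + \<psi> x \<noteq> 0} \<subseteq> closure {x. \<phi> x \<noteq> 0} \<union> closure {x. \<psi> x \<noteq> 0}"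
    unfolding closure_Un[symmetric] by (intro closure_mono) auto
  have "compact (closure {x. \<phi> x \<noteq> 0} \<union> closure {x. \<psi> x \<noteq> 0})"
    using assms by (intro compact_Un) (auto simp: test_functions_def)
  from compact_Int_closed[OF this, of "closure {x. \<phi> x + \<psi> x \<noteq> 0}"] sub
  have "compact (closure {x. \<phi> x + \<psi> x \<noteq> 0})" by (simp add: Int_absorb1)
  with sub show ?thesis
    using assms by (auto simp: test_functions_def intro: smooth_on_add)
qed

lemma test_functions_bump:
  fixes \<Omega> :: "'a::euclidean_space set"
  assumes "cball p r \<subseteq> \<Omega>" "0 < r"
  obtains \<phi> where "\<phi> \<in> test_functions \<Omega>" "\<And>x. x \<in> ball p r \<Longrightarrow> 0 < \<phi> x"
proof
  \<comment> \<open>The squared distance is written in coordinates so that \<open>q\<close> is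
    visibly a polynomial; it is positive exactly on the open ball, and \<open>flat_exp 0\<close>
    turns this into a smooth cutoff.\<close>
  define q where "q x = r\<^sup>2 - (\<Sum>b\<in>Basis. ((x - p) \<bullet> b)\<^sup>2)" for x
  have q: "real_polynomial_function q"
    unfolding q_def
  proof (intro real_polynomial_function_diff real_polynomial_function_sum)
    fix i :: 'a
    have "real_polynomial_function (\<lambda>x. x \<bullet> i)"
      by (rule real_polynomial_function.intros(1)) (rule bounded_linear_inner_left)
    then show "real_polynomial_function (\<lambda>x. ((x - p) \<bullet> i)\<^sup>2)"
      by (auto simp: inner_diff_left intro!: real_polynomial_function_power)
  qed auto
  have qe: "q x = r\<^sup>2 - (dist p x)\<^sup>2" for x
    unfolding q_def dist_norm norm_minus_commute[of p] power2_norm_eq_inner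
    by (subst euclidean_inner) (simp add: power2_eq_square)
  have pos: "0 < q x \<longleftrightarrow> x \<in> ball p r" for x
    unfolding qe mem_ball
    using assms(2) by (auto intro: power_strict_mono dest: power_less_imp_less_base)
  have eq: "{x. flat_exp 0 (q x) \<noteq> 0} = ball p r"
    by (auto simp: flat_exp_def pos)
  show "(\<lambda>x. flat_exp 0 (q x)) \<in> test_functions \<Omega>"
    using assms q by (simp add: test_functions_def eq smooth_on_def Ck_on_flat_exp)
  show "0 < flat_exp 0 (q x)" if "x \<in> ball p r" for x
    using pos[of x] that by (simp add: flat_exp_def)
qed


section \<open>Integrals of test functions\<close>

text \<open>The norms live on \<open>lebesgue_on\<close>, while translation invariance and Tonelli
  are applied to \<open>lborel\<close>; extension by zero passes between the two.\<close>

lemma integral_lebesgue_on_eq_lborel: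
  fixes f :: "'a::euclidean_space \<Rightarrow> real"
  assumes "f \<in> borel_measurable borel" "\<Omega> \<in> sets lebesgue" "\<And>x. x \<notin> \<Omega> \<Longrightarrow> f x = 0"
  shows "(LINT x|lebesgue_on \<Omega>. f x) = (LINT x|lborel. f x)"
    and "integrable (lebesgue_on \<Omega>) f \<longleftrightarrow> integrable lborel f"
proof -
  have eq: "(\<lambda>x. indicator \<Omega> x * f x) = f"
    using assms(3) by (auto simp: indicator_def fun_eq_iff)
  show "(LINT x|lebesgue_on \<Omega>. f x) = (LINT x|lborel. f x)"
    using assms by (subst integral_restrict_space) (auto simp: eq integral_completion)
  show "integrable (lebesgue_on \<Omega>) f \<longleftrightarrow> integrable lborel f"
    using assms by (subst integrable_restrict_space) (auto simp: eq integrable_completion)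
qed

lemma borel_measurable_lebesgue_on_continuous:
  "continuous_on UNIV f \<Longrightarrow> f \<in> borel_measurable (lebesgue_on \<Omega>)"
  by (intro measurable_restrict_space1 measurable_completion) (simp add: borel_measurable_continuous_onI)

lemma continuous_bounded_support_integrable:
  fixes f :: "'a::euclidean_space \<Rightarrow> real"
  assumes "continuous_on UNIV f" "bounded {x. f x \<noteq> 0}"
  shows "integrable lborel f"
proof -
  obtain a where a: "{x. f x \<noteq> 0} \<subseteq> cbox (- a) a"
    using bounded_subset_cbox_symmetric[OF assms(2)] by blast
  have "integrable lborel (\<lambda>x. indicator (cbox (- a) a) x *\<^sub>R f x)"
    using assms(1) by (intro borel_integrable_compact) (auto intro: continuous_on_subset)
  moreover have "(\<lambda>x. indicator (cbox (- a) a) x *\<^sub>R f x) = f"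
    using a by (auto simp: indicator_def fun_eq_iff)
  ultimately show ?thesis by simp
qed

lemma lborel_translate:
  fixes c :: "'a::euclidean_space" and f :: "'a \<Rightarrow> real"
  assumes [measurable]: "f \<in> borel_measurable borel"
  shows "(LINT x|lborel. f (c + x)) = (LINT x|lborel. f x)"
    and "integrable lborel (\<lambda>x. f (c + x)) \<longleftrightarrow> integrable lborel f"
proof -
  show "(LINT x|lborel. f (c + x)) = (LINT x|lborel. f x)"
    by (subst (2) lborel_distr_plus[of c, symmetric]) (simp add: integral_distr)
  show "integrable lborel (\<lambda>x. f (c + x)) \<longleftrightarrow> integrable lborel f"
    by (subst (2) lborel_distr_plus[of c, symmetric]) (simp add: integrable_distr_eq)
qed

lemma nn_integral_lborel_translate:
  fixes c :: "'a::euclidean_space"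
  assumes [measurable]: "f \<in> borel_measurable borel"
  shows "(\<integral>\<^sup>+x. f (c + x) \<partial>lborel) = (\<integral>\<^sup>+x. f x \<partial>lborel)"
  by (subst (2) lborel_distr_plus[of c, symmetric]) (simp add: nn_integral_distr)

lemma test_functions_partial_deriv:
  assumes "\<phi> \<in> test_functions \<Omega>" "i \<in> Basis"
  shows "partial_deriv i \<phi> \<in> test_functions \<Omega>"
proof -
  let ?K = "closure {x. \<phi> x \<noteq> 0}"
  have K: "compact ?K" "?K \<subseteq> \<Omega>" "smooth_on UNIV \<phi>"
    using assms by (auto simp: test_functions_def)
  \<comment> \<open>A test function is also one for its own closed support, so its derivative
    vanishes off that support and not merely off \<open>\<Omega>\<close>.\<close>
  then have "\<phi> \<in> test_functions ?K" by (simp add: test_functions_def)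
  from test_functionsD(3)[OF this _ assms(2)]
  have sub: "closure {x. partial_deriv i \<phi> x \<noteq> 0} \<subseteq> ?K"
    by (intro closure_minimal) auto
  from compact_Int_closed[OF K(1), of "closure {x. partial_deriv i \<phi> x \<noteq> 0}"] sub
  have "compact (closure {x. partial_deriv i \<phi> x \<noteq> 0})" by (simp add: Int_absorb1)
  with sub K show ?thesis
    using assms(2) by (auto simp: test_functions_def intro: smooth_on_partial_deriv)
qed

lemma test_functions_continuous: "\<phi> \<in> test_functions \<Omega> \<Longrightarrow> continuous_on A \<phi>"
  by (meson continuous_on_subset smooth_on_continuous subset_UNIV test_functionsD(1))

lemma test_functions_borel: "\<phi> \<in> test_functions \<Omega> \<Longrightarrow> \<phi> \<in> borel_measurable borel"
  by (simp add: borel_measurable_continuous_onI test_functions_continuous)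

lemma test_functions_mult_integrable:
  assumes "\<phi> \<in> test_functions \<Omega>" "continuous_on UNIV f"
  shows "integrable lborel (\<lambda>x. f x * \<phi> x)"
proof (rule continuous_bounded_support_integrable)
  show "continuous_on UNIV (\<lambda>x. f x * \<phi> x)"
    by (intro continuous_on_mult assms test_functions_continuous[OF assms(1)])
  show "bounded {x. f x * \<phi> x \<noteq> 0}"
    by (rule bounded_subset[OF test_functionsD(4)[OF assms(1)]]) auto
qed

lemma test_functions_integrable:
  "\<phi> \<in> test_functions \<Omega> \<Longrightarrow> integrable lborel \<phi>"
  using test_functions_mult_integrable[of \<phi> \<Omega> "\<lambda>_. 1"] by simp

lemma test_functions_bounded:
  assumes "\<phi> \<in> test_functions \<Omega>"
  obtains B where "0 < B" "\<And>x. \<bar>\<phi> x\<bar> \<le> B"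
proof -
  have "compact (\<phi> ` closure {x. \<phi> x \<noteq> 0})"
    using assms by (intro compact_continuous_image test_functions_continuous)
      (auto simp: test_functions_def)
  then obtain B where B: "0 < B" "\<forall>y\<in>\<phi> ` closure {x. \<phi> x \<noteq> 0}. norm y \<le> B"
    by (meson bounded_pos compact_imp_bounded)
  have "\<bar>\<phi> x\<bar> \<le> B" for x
    using B closure_subset[of "{x. \<phi> x \<noteq> 0}"] by (cases "\<phi> x = 0") auto
  with B(1) that show ?thesis by blast
qed

lemma test_functions_L2:
  fixes \<Omega> :: "'a::euclidean_space set"
  assumes "\<phi> \<in> test_functions \<Omega>" "\<Omega> \<in> sets lebesgue"
  shows "\<phi> \<in> L2 \<Omega>"
proof -
  have c: "continuous_on UNIV \<phi>" by (rule test_functions_continuous[OF assms(1)])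
  have "integrable lborel (\<lambda>x. (\<phi> x)\<^sup>2)"
    using test_functions_mult_integrable[OF assms(1) c] by (simp add: power2_eq_square)
  then have "integrable (lebesgue_on \<Omega>) (\<lambda>x. (\<phi> x)\<^sup>2)"
    using assms c by (subst integral_lebesgue_on_eq_lborel(2))
      (auto intro!: borel_measurable_continuous_onI continuous_intros simp: test_functionsD(2))
  with c show ?thesis by (simp add: L2_def borel_measurable_lebesgue_on_continuous)
qed

lemma smooth_on_line_derivative:
  assumes "smooth_on UNIV f"
  shows "((\<lambda>t. f (x + t *\<^sub>R z)) has_real_derivative
     frechet_derivative f (at (x + t *\<^sub>R z)) z) (at t)"
proof -
  have "((\<lambda>t. x + t *\<^sub>R z) has_derivative (\<lambda>h. h *\<^sub>R z)) (at t)"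
    by (auto intro!: derivative_eq_intros)
  from has_derivative_compose[OF this smooth_on_has_derivative[OF assms]]
  have "((\<lambda>t. f (x + t *\<^sub>R z)) has_derivative
      (\<lambda>h. frechet_derivative f (at (x + t *\<^sub>R z)) (h *\<^sub>R z))) (at t)" .
  moreover have "frechet_derivative f (at y) (h *\<^sub>R z) = h * frechet_derivative f (at y) z" for h y
    using linear_cmul[OF linear_frechet_derivative[OF smooth_on_differentiable[OF assms]]] by simp
  ultimately show ?thesis by (simp add: has_field_derivative_def mult.commute[of _ "frechet_derivative _ _ _"])
qed

text \<open>Difference quotients have integral 0 by translation invariance, and they converge
  dominatedly to the derivative. This is the source of all integration by parts below.\<close>

lemma integral_partial_deriv_test_function:
  fixes \<phi> :: "'a::euclidean_space \<Rightarrow> real"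
  assumes \<phi>: "\<phi> \<in> test_functions \<Omega>" and i: "i \<in> Basis"
  shows "(LINT x|lborel. partial_deriv i \<phi> x) = 0"
proof -
  have s: "smooth_on UNIV \<phi>" by (rule test_functionsD(1)[OF \<phi>])
  note [measurable] = test_functions_borel[OF \<phi>]
    test_functions_borel[OF test_functions_partial_deriv[OF \<phi> i]]
  obtain B where B: "0 < B" "\<And>x. \<bar>partial_deriv i \<phi> x\<bar> \<le> B"
    using test_functions_bounded[OF test_functions_partial_deriv[OF \<phi> i]] by blast
  obtain R where R: "\<And>x. \<phi> x \<noteq> 0 \<Longrightarrow> norm x \<le> R"
    using test_functionsD(4)[OF \<phi>] by (auto simp: bounded_iff)
  define h :: "nat \<Rightarrow> real" where "h n = inverse (real (Suc n))" for n
  have h: "0 < h n" "h n \<le> 1" for n by (auto simp: h_def field_simps)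
  define q where "q n x = (\<phi> (h n *\<^sub>R i + x) - \<phi> x) / h n" for n x
  have "(\<lambda>n. LINT x|lborel. q n x) \<longlonglongrightarrow> (LINT x|lborel. partial_deriv i \<phi> x)"
  \<comment> \<open>Steps \<open>h n\<close> of length at most 1 enlarge the support by at most 1,
    and the mean value theorem bounds the quotients by the supremum of the derivative.\<close>
  proof (rule integral_dominated_convergence[where w="\<lambda>x. B * indicator (cball 0 (R + 1)) x"])
    show "integrable lborel (\<lambda>x::'a. B * indicator (cball 0 (R + 1)) x)"
      using emeasure_lborel_cball_finite[of "0::'a" "R + 1"] by simp
    have "(\<lambda>n. q n x) \<longlonglongrightarrow> partial_deriv i \<phi> x" for x
    proof -
      have "((\<lambda>t. (\<phi> (x + (0 + t) *\<^sub>R i) - \<phi> (x + 0 *\<^sub>R i)) / t) \<longlongrightarrow> partial_deriv i \<phi> x) (at 0)"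
        using smooth_on_line_derivative[OF s, of x i 0] unfolding DERIV_def by simp
      moreover have "filterlim h (at 0) sequentially"
        using LIMSEQ_inverse_real_of_nat h(1) unfolding filterlim_at h_def
        by (auto intro!: always_eventually)
      ultimately have "((\<lambda>n. (\<phi> (x + (0 + h n) *\<^sub>R i) - \<phi> (x + 0 *\<^sub>R i)) / h n)
          \<longlongrightarrow> partial_deriv i \<phi> x) sequentially"
        by (rule filterlim_compose)
      then show ?thesis by (simp add: q_def add.commute)
    qed
    then show "AE x in lborel. (\<lambda>n. q n x) \<longlonglongrightarrow> partial_deriv i \<phi> x" by simp
    have "\<bar>q n x\<bar> \<le> B * indicator (cball 0 (R + 1)) x" for n x
    proof (cases "norm x \<le> R + 1")
      case True
      obtain t where "\<phi> (x + h n *\<^sub>R i) - \<phi> (x + 0 *\<^sub>R i) = (h n - 0) * partial_deriv i \<phi> (x + t *\<^sub>R i)"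
        using MVT2[OF h(1)[of n], of "\<lambda>t. \<phi> (x + t *\<^sub>R i)" "\<lambda>t. partial_deriv i \<phi> (x + t *\<^sub>R i)"]
          smooth_on_line_derivative[OF s] by blast
      then have "q n x = partial_deriv i \<phi> (x + t *\<^sub>R i)"
        using h(1)[of n] by (simp add: q_def add.commute)
      then show ?thesis using B(2) True by simp
    next
      case False
      have "norm x \<le> norm (h n *\<^sub>R i + x) + norm (h n *\<^sub>R i)"
        using norm_triangle_ineq4[of "h n *\<^sub>R i + x" "h n *\<^sub>R i"] by simp
      also have "norm (h n *\<^sub>R i) \<le> 1" using h[of n] i by simp
      finally have "\<phi> (h n *\<^sub>R i + x) = 0" using R[of "h n *\<^sub>R i + x"] False by force
      moreover have "\<phi> x = 0" using R[of x] False by force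
      ultimately show ?thesis using B(1) by (simp add: q_def)
    qed
    then show "AE x in lborel. norm (q n x) \<le> B * indicator (cball 0 (R + 1)) x" for n by simp
  qed (auto simp: q_def)
  moreover have "(LINT x|lborel. q n x) = 0" for n
    using test_functions_integrable[OF \<phi>]
    by (simp add: q_def lborel_translate)
  ultimately show ?thesis
    by (simp add: LIMSEQ_const_iff)
qed

lemma partial_deriv_mult:
  assumes "smooth_on UNIV f" "smooth_on UNIV g"
  shows "partial_deriv i (\<lambda>x. f x * g x) x = f x * partial_deriv i g x + partial_deriv i f x * g x"
proof -
  have "((\<lambda>x. f x * g x) has_derivative
      (\<lambda>h. f x * frechet_derivative g (at x) h + frechet_derivative f (at x) h * g x)) (at x)"
    using assms by (intro has_derivative_mult smooth_on_has_derivative)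
  from frechet_derivative_at[OF this, symmetric] show ?thesis by simp
qed

lemma integration_by_parts_test_functions:
  fixes \<phi> :: "'a::euclidean_space \<Rightarrow> real"
  assumes \<phi>: "\<phi> \<in> test_functions \<Omega>" and f: "smooth_on UNIV f" and i: "i \<in> Basis"
  shows "(LINT x|lborel. f x * partial_deriv i \<phi> x) = - (LINT x|lborel. partial_deriv i f x * \<phi> x)"
proof -
  have "0 = (LINT x|lborel. partial_deriv i (\<lambda>x. f x * \<phi> x) x)"
    using integral_partial_deriv_test_function[OF test_functions_smooth_mult[OF \<phi> f] i] by simp
  also have "\<dots> = (LINT x|lborel. f x * partial_deriv i \<phi> x + partial_deriv i f x * \<phi> x)"
    using f test_functionsD(1)[OF \<phi>] by (simp add: partial_deriv_mult)
  also have "\<dots> = (LINT x|lborel. f x * partial_deriv i \<phi> x) + (LINT x|lborel. partial_deriv i f x * \<phi> x)"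
    using \<phi> f i by (intro Bochner_Integration.integral_add test_functions_mult_integrable
        test_functions_partial_deriv smooth_on_continuous smooth_on_partial_deriv)
  finally show ?thesis by simp
qed

lemma test_functions_has_weak_deriv:
  fixes \<Omega> :: "'a::euclidean_space set"
  assumes \<phi>: "\<phi> \<in> test_functions \<Omega>" and i: "i \<in> Basis" and \<Omega>: "\<Omega> \<in> sets lebesgue"
  shows "has_weak_deriv \<Omega> i \<phi> (partial_deriv i \<phi>)"
  unfolding has_weak_deriv_def
proof (intro conjI ballI)
  show "\<phi> \<in> L2 \<Omega>" "partial_deriv i \<phi> \<in> L2 \<Omega>"
    using assms by (auto intro: test_functions_L2 test_functions_partial_deriv)
  fix \<psi> assume \<psi>: "\<psi> \<in> test_functions \<Omega>"
  note [measurable] = test_functions_borel[OF \<phi>] test_functions_borel[OF \<psi>]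
    test_functions_borel[OF test_functions_partial_deriv[OF \<phi> i]]
    test_functions_borel[OF test_functions_partial_deriv[OF \<psi> i]]
  have "(LINT x|lebesgue_on \<Omega>. \<phi> x * partial_deriv i \<psi> x) = (LINT x|lborel. \<phi> x * partial_deriv i \<psi> x)"
    using \<Omega> test_functionsD(2)[OF \<phi>] by (intro integral_lebesgue_on_eq_lborel(1)) auto
  also have "\<dots> = - (LINT x|lborel. partial_deriv i \<phi> x * \<psi> x)"
    by (rule integration_by_parts_test_functions[OF \<psi> test_functionsD(1)[OF \<phi>] i])
  also have "(LINT x|lborel. partial_deriv i \<phi> x * \<psi> x) = (LINT x|lebesgue_on \<Omega>. partial_deriv i \<phi> x * \<psi> x)"
    using \<Omega> test_functionsD(2)[OF \<psi>] by (intro integral_lebesgue_on_eq_lborel(1)[symmetric]) auto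
  finally show "(LINT x|lebesgue_on \<Omega>. \<phi> x * partial_deriv i \<psi> x) =
      - (LINT x|lebesgue_on \<Omega>. partial_deriv i \<phi> x * \<psi> x)" .
qed

section \<open>Pointwise gradients and the translation estimate\<close>

definition classical_grad :: "('a::euclidean_space \<Rightarrow> real) \<Rightarrow> 'a \<Rightarrow> 'a" where
  "classical_grad f x = (\<Sum>i\<in>Basis. partial_deriv i f x *\<^sub>R i)"

lemma frechet_derivative_eq_inner_grad:
  assumes "smooth_on UNIV f"
  shows "frechet_derivative f (at x) z = classical_grad f x \<bullet> z"
proof -
  interpret linear "frechet_derivative f (at x)"
    by (rule linear_frechet_derivative[OF smooth_on_differentiable[OF assms]])
  have "frechet_derivative f (at x) z = frechet_derivative f (at x) (\<Sum>i\<in>Basis. (z \<bullet> i) *\<^sub>R i)"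
    by (simp add: euclidean_representation)
  also have "\<dots> = classical_grad f x \<bullet> z"
    by (simp add: sum scale classical_grad_def inner_sum_right inner_commute mult.commute)
  finally show ?thesis .
qed

lemma norm_classical_grad: "(norm (classical_grad f x))\<^sup>2 = (\<Sum>i\<in>Basis. (partial_deriv i f x)\<^sup>2)"
  unfolding power2_norm_eq_inner classical_grad_def
  by (subst euclidean_inner) (simp add: power2_eq_square inner_sum_left_Basis)

lemma classical_grad_continuous:
  "smooth_on UNIV f \<Longrightarrow> continuous_on A (classical_grad f)"
  unfolding classical_grad_def
  by (intro continuous_intros continuous_on_subset[OF smooth_on_continuous[OF smooth_on_partial_deriv]]) auto

text \<open>The fundamental theorem of calculus with an extended nonnegative right-hand side, which
  can enter Cauchy-Schwarz and Tonelli without integrability side conditions.\<close>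

lemma FTC_nn_integral_bound:
  fixes F :: "real \<Rightarrow> real"
  assumes "\<And>s. (F has_real_derivative f s) (at s)" "continuous_on UNIV f" "a \<le> b"
  shows "ennreal \<bar>F b - F a\<bar> \<le> (\<integral>\<^sup>+s. ennreal \<bar>f s\<bar> * indicator {a..b} s \<partial>lborel)"
proof -
  have "has_bochner_integral lborel (\<lambda>s. f s * indicator {a..b} s) (F b - F a)"
    using assms by (intro has_bochner_integral_FTC_Icc_real)
      (auto simp: continuous_on_eq_continuous_at)
  then have "integrable lborel (\<lambda>s. f s * indicator {a..b} s)"
    and eq: "(LINT s|lborel. f s * indicator {a..b} s) = F b - F a"
    by (auto simp: has_bochner_integral_iff)
  from integral_norm_bound_ennreal[OF this(1)] show ?thesis
    unfolding eq by (simp add: abs_mult ennreal_mult' ennreal_indicator abs_indicator)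
qed

text \<open>Cauchy-Schwarz along the segment from \<open>x\<close> to \<open>x + z\<close>, then Tonelli.\<close>

lemma translation_estimate:
  fixes \<phi> :: "'a::euclidean_space \<Rightarrow> real"
  assumes s: "smooth_on UNIV \<phi>"
  shows "(\<integral>\<^sup>+x. ennreal ((\<phi> (z + x) - \<phi> x)\<^sup>2) \<partial>lborel) \<le>
    ennreal ((norm z)\<^sup>2) * (\<integral>\<^sup>+x. ennreal ((norm (classical_grad \<phi> x))\<^sup>2) \<partial>lborel)"
proof -
  let ?G = "\<lambda>x. ennreal ((norm (classical_grad \<phi> x))\<^sup>2)"
  have c [continuous_intros]: "continuous_on A (classical_grad \<phi>)" for A
    by (rule classical_grad_continuous[OF s])
  have [measurable]: "classical_grad \<phi> \<in> borel_measurable borel"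
    by (intro borel_measurable_continuous_onI continuous_intros)
  have cs: "\<bar>classical_grad \<phi> y \<bullet> z\<bar> \<le> norm z * norm (classical_grad \<phi> y)" for y
    using Cauchy_Schwarz_ineq2[of "classical_grad \<phi> y" z] by (simp add: mult.commute)
  have pw: "ennreal ((\<phi> (z + x) - \<phi> x)\<^sup>2) \<le>
      ennreal ((norm z)\<^sup>2) * (\<integral>\<^sup>+t. ?G (t *\<^sub>R z + x) * indicator {0..1} t \<partial>lborel)" for x
  proof -
    have "ennreal \<bar>\<phi> (x + 1 *\<^sub>R z) - \<phi> (x + 0 *\<^sub>R z)\<bar> \<le>
        (\<integral>\<^sup>+t. ennreal \<bar>classical_grad \<phi> (x + t *\<^sub>R z) \<bullet> z\<bar> * indicator {0..1} t \<partial>lborel)"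
      using smooth_on_line_derivative[OF s]
      by (intro FTC_nn_integral_bound)
        (auto simp: frechet_derivative_eq_inner_grad[OF s] intro!: continuous_intros
          continuous_on_compose2[OF c[of UNIV]])
    \<comment> \<open>The indicator is idempotent; it is doubled so that one copy can serve as the
      second factor of Cauchy-Schwarz, where its square integral is 1.\<close>
    also have "\<dots> \<le> (\<integral>\<^sup>+t. (ennreal (norm z) * ennreal (norm (classical_grad \<phi> (t *\<^sub>R z + x))) * indicator {0..1} t)
          * indicator {0..1} t \<partial>lborel)"
      by (intro nn_integral_mono)
        (auto simp: indicator_def add.commute cs simp flip: ennreal_mult')
    finally have "ennreal ((\<phi> (z + x) - \<phi> x)\<^sup>2) \<le>
      (\<integral>\<^sup>+t. (ennreal (norm z) * ennreal (norm (classical_grad \<phi> (t *\<^sub>R z + x))) * indicator {0..1} t)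
          * indicator {0..1} t \<partial>lborel)\<^sup>2"
      using power_mono[of "ennreal \<bar>\<phi> (z + x) - \<phi> x\<bar>" _ 2] by (simp add: add.commute ennreal_power)
    also have "\<dots> \<le> (\<integral>\<^sup>+t. (ennreal (norm z) * ennreal (norm (classical_grad \<phi> (t *\<^sub>R z + x))) * indicator {0..1} t)\<^sup>2 \<partial>lborel)
        * (\<integral>\<^sup>+t. (indicator {0..1::real} t)\<^sup>2 \<partial>lborel)"
      by (rule Cauchy_Schwarz_nn_integral[where g="indicator {0..1}"]) auto
    also have "(\<integral>\<^sup>+t. (indicator {0..1::real} t)\<^sup>2 \<partial>lborel) = (\<integral>\<^sup>+t. indicator {0..1::real} t \<partial>lborel)"
      by (intro nn_integral_cong) (auto simp: indicator_def)
    also have "\<dots> = 1" by simp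
    also have "(\<integral>\<^sup>+t. (ennreal (norm z) * ennreal (norm (classical_grad \<phi> (t *\<^sub>R z + x))) * indicator {0..1} t)\<^sup>2 \<partial>lborel)
       = (\<integral>\<^sup>+t. ennreal ((norm z)\<^sup>2) * (?G (t *\<^sub>R z + x) * indicator {0..1} t) \<partial>lborel)"
      by (intro nn_integral_cong) (auto simp: indicator_def power_mult_distrib ennreal_power)
    also have "\<dots> = ennreal ((norm z)\<^sup>2) * (\<integral>\<^sup>+t. ?G (t *\<^sub>R z + x) * indicator {0..1} t \<partial>lborel)"
      by (intro nn_integral_cmult) auto
    finally show ?thesis by simp
  qed
  have "(\<integral>\<^sup>+x. ennreal ((\<phi> (z + x) - \<phi> x)\<^sup>2) \<partial>lborel) \<le>
      (\<integral>\<^sup>+x. ennreal ((norm z)\<^sup>2) * (\<integral>\<^sup>+t. ?G (t *\<^sub>R z + x) * indicator {0..1} t \<partial>lborel) \<partial>lborel)"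
    by (intro nn_integral_mono pw)
  also have "\<dots> = ennreal ((norm z)\<^sup>2) * (\<integral>\<^sup>+x. (\<integral>\<^sup>+t. ?G (t *\<^sub>R z + x) * indicator {0..1} t \<partial>lborel) \<partial>lborel)"
    by (intro nn_integral_cmult) auto
  also have "(\<integral>\<^sup>+x. (\<integral>\<^sup>+t. ?G (t *\<^sub>R z + x) * indicator {0..1} t \<partial>lborel) \<partial>lborel)
     = (\<integral>\<^sup>+t. (\<integral>\<^sup>+x. ?G (t *\<^sub>R z + x) * indicator {0..1} t \<partial>lborel) \<partial>lborel)"
    by (rule lborel_pair.Fubini') measurable
  also have "\<dots> = (\<integral>\<^sup>+t. (\<integral>\<^sup>+x. ?G x \<partial>lborel) * indicator {0..1::real} t \<partial>lborel)"
  proof (intro nn_integral_cong)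
    fix t :: real
    have "(\<integral>\<^sup>+x. ?G (t *\<^sub>R z + x) * indicator {0..1} t \<partial>lborel) = (\<integral>\<^sup>+x. ?G (t *\<^sub>R z + x) \<partial>lborel) * indicator {0..1} t"
      by (intro nn_integral_multc) auto
    then show "(\<integral>\<^sup>+x. ?G (t *\<^sub>R z + x) * indicator {0..1} t \<partial>lborel) = (\<integral>\<^sup>+x. ?G x \<partial>lborel) * indicator {0..1} t"
      by (simp add: nn_integral_lborel_translate[of ?G])
  qed
  also have "\<dots> = (\<integral>\<^sup>+x. ?G x \<partial>lborel)"
    by (simp add: nn_integral_cmult)
  finally show ?thesis .
qed


section \<open>Semi-inner products on spaces of functions\<close>

text \<open>Serves the L^2 product, the Dirichlet form and their sum. The form is only semidefinite
  because its arguments are representatives; linear combinations in one axiom cover sums,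
  differences and multiples.\<close>

locale semi_inner =
  fixes V :: "('b \<Rightarrow> real) set" and B :: "('b \<Rightarrow> real) \<Rightarrow> ('b \<Rightarrow> real) \<Rightarrow> real"
  assumes lincomb: "f \<in> V \<Longrightarrow> g \<in> V \<Longrightarrow> (\<lambda>x. c * f x + d * g x) \<in> V"
    and lin: "f \<in> V \<Longrightarrow> g \<in> V \<Longrightarrow> h \<in> V \<Longrightarrow> B (\<lambda>x. c * f x + d * g x) h = c * B f h + d * B g h"
    and sym: "B f g = B g f"
    and nonneg: "0 \<le> B f f"
begin

definition snorm :: "('b \<Rightarrow> real) \<Rightarrow> real" where "snorm f = sqrt (B f f)"

lemma snorm_nonneg: "0 \<le> snorm f" and snorm_sq: "(snorm f)\<^sup>2 = B f f"
  by (auto simp: snorm_def nonneg)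

lemma expand:
  assumes "f \<in> V" "g \<in> V"
  shows "B (\<lambda>x. c * f x + d * g x) (\<lambda>x. c * f x + d * g x) =
    c\<^sup>2 * B f f + 2 * c * d * B f g + d\<^sup>2 * B g g"
proof -
  let ?h = "\<lambda>x. c * f x + d * g x"
  have "B ?h ?h = c * B ?h f + d * B ?h g"
    using lin[OF assms lincomb[OF assms, of c d], of c d]
    by (simp add: sym[of f ?h] sym[of g ?h])
  then show ?thesis
    using assms by (simp add: lin sym[of g f] power2_eq_square algebra_simps)
qed

lemma cauchy_schwarz:
  assumes "f \<in> V" "g \<in> V"
  shows "\<bar>B f g\<bar> \<le> snorm f * snorm g"
proof -
  have 1: "0 \<le> B g g * (B g g * B f f - (B f g)\<^sup>2)"
    using nonneg[of "\<lambda>x. B g g * f x + (- B f g) * g x"]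
    unfolding expand[OF assms] by (simp add: power2_eq_square algebra_simps)
  have 2: "0 \<le> B f f * (B g g * B f f - (B f g)\<^sup>2)"
    using nonneg[of "\<lambda>x. (- B f g) * f x + B f f * g x"]
    unfolding expand[OF assms] by (simp add: power2_eq_square algebra_simps)
  have 3: "0 \<le> B f f - 2 * (B f g)\<^sup>2 + (B f g)\<^sup>2 * B g g"
    using nonneg[of "\<lambda>x. 1 * f x + (- B f g) * g x"] assms
    unfolding expand[OF assms] by (simp add: power2_eq_square)
  have "(B f g)\<^sup>2 \<le> B f f * B g g"
  proof (cases "0 < B g g \<or> 0 < B f f")
    case True
    then have "0 \<le> B g g * B f f - (B f g)\<^sup>2"
      using 1 2 unfolding zero_le_mult_iff by linarith
    then show ?thesis by (simp add: mult.commute)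
  next
    case False
    then have "B f f = 0" "B g g = 0" using nonneg[of f] nonneg[of g] by auto
    with 3 show ?thesis by simp
  qed
  also have "\<dots> = (snorm f * snorm g)\<^sup>2" by (simp add: snorm_sq power_mult_distrib)
  finally show ?thesis
    by (rule abs_le_square_iff[THEN iffD2, THEN order_trans]) (simp add: snorm_nonneg)
qed

lemma snorm_lincomb_le:
  assumes "f \<in> V" "g \<in> V"
  shows "snorm (\<lambda>x. c * f x + d * g x) \<le> \<bar>c\<bar> * snorm f + \<bar>d\<bar> * snorm g"
proof (rule power2_le_imp_le)
  have "c * d * B f g \<le> \<bar>c * d * B f g\<bar>" by (rule abs_ge_self)
  also have "\<dots> = \<bar>c * d\<bar> * \<bar>B f g\<bar>" by (rule abs_mult)
  also have "\<dots> \<le> \<bar>c * d\<bar> * (snorm f * snorm g)"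
    by (intro mult_left_mono cauchy_schwarz assms) auto
  finally show "(snorm (\<lambda>x. c * f x + d * g x))\<^sup>2 \<le> (\<bar>c\<bar> * snorm f + \<bar>d\<bar> * snorm g)\<^sup>2"
    unfolding snorm_sq expand[OF assms] power2_sum power_mult_distrib
    by (simp add: snorm_sq abs_mult mult_ac)
  show "0 \<le> \<bar>c\<bar> * snorm f + \<bar>d\<bar> * snorm g" by (simp add: snorm_nonneg)
qed

lemma add_mem: "f \<in> V \<Longrightarrow> g \<in> V \<Longrightarrow> (\<lambda>x. f x + g x) \<in> V"
  using lincomb[of f g 1 1] by simp

lemma diff_mem: "f \<in> V \<Longrightarrow> g \<in> V \<Longrightarrow> (\<lambda>x. f x - g x) \<in> V"
  using lincomb[of f g 1 "-1"] by simp

lemma scale_mem: "f \<in> V \<Longrightarrow> (\<lambda>x. c * f x) \<in> V"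
  using lincomb[of f f c 0] by simp

lemma diff_quotient_mem: "f \<in> V \<Longrightarrow> g \<in> V \<Longrightarrow> (\<lambda>x. (f x - g x) / c) \<in> V"
  using scale_mem[OF diff_mem, of f g "1 / c"] by simp

lemma snorm_scale: "f \<in> V \<Longrightarrow> snorm (\<lambda>x. c * f x) = \<bar>c\<bar> * snorm f"
  using expand[of f f c 0] by (simp add: snorm_def real_sqrt_mult)

lemma B_scale: "f \<in> V \<Longrightarrow> B (\<lambda>x. c * f x) (\<lambda>x. c * f x) = c\<^sup>2 * B f f"
  using expand[of f f c 0] by simp

lemma B_scale_right: "f \<in> V \<Longrightarrow> h \<in> V \<Longrightarrow> B h (\<lambda>x. c * f x) = c * B h f"
  using lin[of f f h c 0] by (simp add: sym)

lemma B_add_right: "f \<in> V \<Longrightarrow> g \<in> V \<Longrightarrow> h \<in> V \<Longrightarrow> B h (\<lambda>x. f x + g x) = B h f + B h g"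
  using lin[of f g h 1 1] by (simp add: sym)

lemma B_diff_right: "f \<in> V \<Longrightarrow> g \<in> V \<Longrightarrow> h \<in> V \<Longrightarrow> B h (\<lambda>x. f x - g x) = B h f - B h g"
  using lin[of f g h 1 "-1"] by (simp add: sym)

lemma snorm_add_le: "f \<in> V \<Longrightarrow> g \<in> V \<Longrightarrow> snorm (\<lambda>x. f x + g x) \<le> snorm f + snorm g"
  using snorm_lincomb_le[of f g 1 1] by simp

lemma snorm_diff_le: "f \<in> V \<Longrightarrow> g \<in> V \<Longrightarrow> snorm (\<lambda>x. f x - g x) \<le> snorm f + snorm g"
  using snorm_lincomb_le[of f g 1 "-1"] by simp

lemma snorm_triangle:
  assumes "f \<in> V" "g \<in> V" "h \<in> V"
  shows "snorm (\<lambda>x. f x - h x) \<le> snorm (\<lambda>x. f x - g x) + snorm (\<lambda>x. g x - h x)"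
  using snorm_add_le[OF diff_mem[OF assms(1,2)] diff_mem[OF assms(2,3)]] by simp

lemma snorm_minus_commute:
  assumes "f \<in> V" "g \<in> V"
  shows "snorm (\<lambda>x. f x - g x) = snorm (\<lambda>x. g x - f x)"
  using snorm_scale[OF diff_mem[OF assms], of "-1"] by simp

lemma snorm_diff_abs_le:
  assumes "f \<in> V" "g \<in> V"
  shows "\<bar>snorm f - snorm g\<bar> \<le> snorm (\<lambda>x. f x - g x)"
  using snorm_add_le[OF diff_mem[OF assms] assms(2)] snorm_add_le[OF diff_mem[OF assms(2,1)] assms(1)]
    snorm_minus_commute[OF assms] by simp

lemma tendsto_snorm:
  assumes "((\<lambda>s. snorm (\<lambda>x. u s x - w x)) \<longlongrightarrow> 0) F" "\<forall>\<^sub>F s in F. u s \<in> V" "w \<in> V"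
  shows "((\<lambda>s. snorm (u s)) \<longlongrightarrow> snorm w) F"
proof -
  have "((\<lambda>s. snorm (u s) - snorm w) \<longlongrightarrow> 0) F"
    by (rule Lim_null_comparison[OF eventually_mono[OF assms(2)] assms(1)])
      (use snorm_diff_abs_le[OF _ assms(3)] in auto)
  then show ?thesis by (simp add: LIM_zero_iff)
qed

lemma tendsto_B_right:
  assumes "((\<lambda>s. snorm (\<lambda>x. u s x - w x)) \<longlongrightarrow> 0) F" "\<forall>\<^sub>F s in F. u s \<in> V" "w \<in> V" "f \<in> V"
  shows "((\<lambda>s. B f (u s)) \<longlongrightarrow> B f w) F"
proof -
  have "((\<lambda>s. B f (u s) - B f w) \<longlongrightarrow> 0) F"
  proof (rule Lim_null_comparison)
    show "\<forall>\<^sub>F s in F. norm (B f (u s) - B f w) \<le> snorm f * snorm (\<lambda>x. u s x - w x)"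
    proof (rule eventually_mono[OF assms(2)])
      fix s assume s: "u s \<in> V"
      show "norm (B f (u s) - B f w) \<le> snorm f * snorm (\<lambda>x. u s x - w x)"
        using cauchy_schwarz[OF assms(4) diff_mem[OF s assms(3)]]
        unfolding B_diff_right[OF s assms(3,4)] by simp
    qed
    show "((\<lambda>s. snorm f * snorm (\<lambda>x. u s x - w x)) \<longlongrightarrow> 0) F"
      using tendsto_mult[OF tendsto_const assms(1)] by simp
  qed
  then show ?thesis by (simp add: LIM_zero_iff)
qed

text \<open>With \<open>u s = u t + (s - t) (v + r s)\<close> and \<open>r s\<close> tending to 0,
  the expanded quadratic form leaves the error \<open>2 B (u t) (r s)\<close> plus a term of order
  \<open>s - t\<close>.\<close>

lemma has_real_derivative_B:
  assumes u: "\<And>s. s \<in> I \<Longrightarrow> u s \<in> V" and v: "v \<in> V" and t: "t \<in> I"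
    and lim: "((\<lambda>s. snorm (\<lambda>x. (u s x - u t x) / (s - t) - v x)) \<longlongrightarrow> 0) (at t within I)"
  shows "((\<lambda>s. B (u s) (u s)) has_real_derivative 2 * B (u t) v) (at t within I)"
proof -
  define r where "r s = (\<lambda>x. (u s x - u t x) / (s - t) - v x)" for s
  have lim: "((\<lambda>s. snorm (r s)) \<longlongrightarrow> 0) (at t within I)" using lim by (simp add: r_def)
  have "((\<lambda>s. (B (u s) (u s) - B (u t) (u t)) / (s - t) - 2 * B (u t) v) \<longlongrightarrow> 0) (at t within I)"
  proof (rule Lim_null_comparison)
    show "\<forall>\<^sub>F s in at t within I. norm ((B (u s) (u s) - B (u t) (u t)) / (s - t) - 2 * B (u t) v)
        \<le> 2 * snorm (u t) * snorm (r s) + \<bar>s - t\<bar> * (snorm v + snorm (r s))\<^sup>2"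
      unfolding eventually_at_filter
    proof (intro always_eventually allI impI)
      fix s assume s: "s \<noteq> t" "s \<in> I"
      have r: "r s \<in> V"
        unfolding r_def using u s t v by (intro diff_mem diff_quotient_mem)
      define q where "q = (\<lambda>x. v x + r s x)"
      have q: "q \<in> V" unfolding q_def using v r by (rule add_mem)
      have "u s = (\<lambda>x. 1 * u t x + (s - t) * q x)"
        using s by (auto simp: q_def r_def)
      then have "B (u s) (u s) = B (u t) (u t) + 2 * (s - t) * B (u t) q + (s - t)\<^sup>2 * B q q"
        using expand[OF u[OF t] q, of 1 "s - t"] by simp
      then have "B (u s) (u s) - B (u t) (u t) = (s - t) * (2 * B (u t) q + (s - t) * B q q)"
        by (simp add: power2_eq_square algebra_simps)
      moreover have "B (u t) q = B (u t) v + B (u t) (r s)"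
        unfolding q_def using u t v r by (intro B_add_right) auto
      ultimately have "(B (u s) (u s) - B (u t) (u t)) / (s - t) - 2 * B (u t) v
          = 2 * B (u t) (r s) + (s - t) * B q q"
        using s by simp
      also have "\<bar>\<dots>\<bar> \<le> 2 * \<bar>B (u t) (r s)\<bar> + \<bar>s - t\<bar> * B q q"
        using abs_triangle_ineq[of "2 * B (u t) (r s)" "(s - t) * B q q"] nonneg[of q]
        by (simp add: abs_mult)
      also have "\<dots> \<le> 2 * (snorm (u t) * snorm (r s)) + \<bar>s - t\<bar> * (snorm v + snorm (r s))\<^sup>2"
      proof (intro add_mono mult_left_mono)
        show "\<bar>B (u t) (r s)\<bar> \<le> snorm (u t) * snorm (r s)"
          using u t r by (intro cauchy_schwarz) auto
        show "B q q \<le> (snorm v + snorm (r s))\<^sup>2"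
          unfolding snorm_sq[symmetric] q_def
          using snorm_add_le[OF v r] by (intro power_mono snorm_nonneg)
      qed auto
      finally show "norm ((B (u s) (u s) - B (u t) (u t)) / (s - t) - 2 * B (u t) v)
        \<le> 2 * snorm (u t) * snorm (r s) + \<bar>s - t\<bar> * (snorm v + snorm (r s))\<^sup>2" by simp
    qed
    have "((\<lambda>s. 2 * snorm (u t) * snorm (r s) + \<bar>s - t\<bar> * (snorm v + snorm (r s))\<^sup>2)
        \<longlongrightarrow> 2 * snorm (u t) * 0 + \<bar>t - t\<bar> * (snorm v + 0)\<^sup>2) (at t within I)"
      by (intro tendsto_intros lim)
    then show "((\<lambda>s. 2 * snorm (u t) * snorm (r s) + \<bar>s - t\<bar> * (snorm v + snorm (r s))\<^sup>2) \<longlongrightarrow> 0)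
        (at t within I)" by simp
  qed
  then show ?thesis by (simp add: has_field_derivative_iff LIM_zero_iff)
qed

lemma limit_unique:
  assumes "((\<lambda>s. snorm (\<lambda>x. u s x - v x)) \<longlongrightarrow> 0) F" "((\<lambda>s. snorm (\<lambda>x. u s x - w x)) \<longlongrightarrow> 0) F"
    "\<forall>\<^sub>F s in F. u s \<in> V" "v \<in> V" "w \<in> V" "F \<noteq> bot"
  shows "snorm (\<lambda>x. v x - w x) = 0"
proof -
  have "((\<lambda>s. snorm (\<lambda>x. u s x - v x) + snorm (\<lambda>x. u s x - w x)) \<longlongrightarrow> 0) F"
    using tendsto_add[OF assms(1,2)] by simp
  moreover have "\<forall>\<^sub>F s in F. snorm (\<lambda>x. v x - w x) \<le> snorm (\<lambda>x. u s x - v x) + snorm (\<lambda>x. u s x - w x)"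
    using assms(3)
    by eventually_elim (use snorm_triangle[OF assms(4) _ assms(5)] snorm_minus_commute[OF assms(4)] in auto)
  ultimately have "snorm (\<lambda>x. v x - w x) \<le> 0"
    by (rule tendsto_lowerbound[OF _ _ assms(6)])
  then show ?thesis using snorm_nonneg by (simp add: order_antisym)
qed

end


section \<open>The fundamental lemma of the calculus of variations\<close>

definition L2_ip :: "'a::euclidean_space set \<Rightarrow> ('a \<Rightarrow> real) \<Rightarrow> ('a \<Rightarrow> real) \<Rightarrow> real" where
  "L2_ip \<Omega> f g = (LINT x|lebesgue_on \<Omega>. f x * g x)"

lemma L2_measurable: "f \<in> L2 \<Omega> \<Longrightarrow> f \<in> borel_measurable (lebesgue_on \<Omega>)"
  by (simp add: L2_def)

lemma L2_mult_integrable: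
  assumes "f \<in> L2 \<Omega>" "g \<in> L2 \<Omega>"
  shows "integrable (lebesgue_on \<Omega>) (\<lambda>x. f x * g x)"
proof (rule Bochner_Integration.integrable_bound)
  show "integrable (lebesgue_on \<Omega>) (\<lambda>x. (f x)\<^sup>2 + (g x)\<^sup>2)"
    using assms by (simp add: L2_def)
  show "(\<lambda>x. f x * g x) \<in> borel_measurable (lebesgue_on \<Omega>)"
    by (intro borel_measurable_times L2_measurable assms)
  have "\<bar>a * b\<bar> \<le> a\<^sup>2 + b\<^sup>2" for a b :: real
    using sum_squares_bound[of "\<bar>a\<bar>" "\<bar>b\<bar>"] mult_nonneg_nonneg[of "\<bar>a\<bar>" "\<bar>b\<bar>"]
    unfolding abs_mult power2_abs by linarith
  then show "AE x in lebesgue_on \<Omega>. norm (f x * g x) \<le> norm ((f x)\<^sup>2 + (g x)\<^sup>2)"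
    by simp
qed

lemma L2_lincomb:
  assumes "f \<in> L2 \<Omega>" "g \<in> L2 \<Omega>"
  shows "(\<lambda>x. c * f x + d * g x) \<in> L2 \<Omega>"
proof -
  have "integrable (lebesgue_on \<Omega>) (\<lambda>x. c\<^sup>2 * (f x)\<^sup>2 + 2 * c * d * (f x * g x) + d\<^sup>2 * (g x)\<^sup>2)"
    using assms L2_mult_integrable[OF assms] by (simp add: L2_def)
  moreover have "(\<lambda>x. c\<^sup>2 * (f x)\<^sup>2 + 2 * c * d * (f x * g x) + d\<^sup>2 * (g x)\<^sup>2) = (\<lambda>x. (c * f x + d * g x)\<^sup>2)"
    by (simp add: power2_eq_square algebra_simps fun_eq_iff)
  moreover have "(\<lambda>x. c * f x + d * g x) \<in> borel_measurable (lebesgue_on \<Omega>)"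
    by (intro borel_measurable_add borel_measurable_times borel_measurable_const L2_measurable assms)
  ultimately show ?thesis by (simp add: L2_def)
qed

lemma L2_semi_inner: "semi_inner (L2 \<Omega>) (L2_ip \<Omega>)"
proof
  show "L2_ip \<Omega> (\<lambda>x. c * f x + d * g x) h = c * L2_ip \<Omega> f h + d * L2_ip \<Omega> g h"
    if "f \<in> L2 \<Omega>" "g \<in> L2 \<Omega>" "h \<in> L2 \<Omega>" for f g h c d
    using L2_mult_integrable[OF that(1,3)] L2_mult_integrable[OF that(2,3)]
    by (simp add: L2_ip_def distrib_right mult.assoc)
qed (auto simp: L2_lincomb L2_ip_def mult.commute)

interpretation L2: semi_inner "L2 \<Omega>" "L2_ip \<Omega>" for \<Omega> :: "'a::euclidean_space set"
  by (rule L2_semi_inner)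

lemma Lnorm_2_eq: "Lnorm \<Omega> 2 f = sqrt (LINT x|lebesgue_on \<Omega>. (norm (f x))\<^sup>2)"
  by (simp add: Lnorm_def powr_half_sqrt)

lemma Lnorm_2_eq_snorm: "Lnorm \<Omega> 2 f = L2.snorm \<Omega> f"
  by (simp add: Lnorm_2_eq L2.snorm_def L2_ip_def power2_eq_square)

lemma snorm_eq_0_imp_ae_eq:
  assumes "f \<in> L2 \<Omega>" "g \<in> L2 \<Omega>" "L2.snorm \<Omega> (\<lambda>x. f x - g x) = 0"
  shows "ae_eq \<Omega> f g"
proof -
  have "(\<lambda>x. f x - g x) \<in> L2 \<Omega>" by (rule L2.diff_mem[OF assms(1,2)])
  moreover have "(LINT x|lebesgue_on \<Omega>. (f x - g x)\<^sup>2) = 0"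
    using assms(3) by (simp add: L2.snorm_def L2_ip_def power2_eq_square)
  ultimately have "AE x in lebesgue_on \<Omega>. (f x - g x)\<^sup>2 = 0"
    by (subst (asm) integral_nonneg_eq_0_iff_AE) (auto simp: L2_def)
  then show ?thesis by (simp add: ae_eq_def)
qed

text \<open>For a polynomial \<open>p\<close> the product of \<open>p\<close> and
  \<open>\<eta>\<close> is a test function, so \<open>g\<close> times \<open>\<eta>\<close> is
  orthogonal to polynomials; Stone-Weierstrass on the support gives continuous functions, and
  continuous approximations of the sign of \<open>g x * \<eta> x\<close> give a vanishing integral
  of its absolute value.\<close>

lemma fundamental_lemma_local:
  fixes \<Omega> :: "'a::euclidean_space set"
  assumes \<Omega>: "\<Omega> \<in> sets lebesgue" and g: "g \<in> L2 \<Omega>" and \<eta>: "\<eta> \<in> test_functions \<Omega>"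
    and orth: "\<And>\<phi>. \<phi> \<in> test_functions \<Omega> \<Longrightarrow> (LINT x|lebesgue_on \<Omega>. g x * \<phi> x) = 0"
  shows "AE x in lebesgue_on \<Omega>. g x * \<eta> x = 0"
proof -
  let ?M = "lebesgue_on \<Omega>"
  have [measurable]: "g \<in> borel_measurable ?M" using g by (simp add: L2_def)
  have [measurable]: "\<eta> \<in> borel_measurable ?M"
    using test_functions_L2[OF \<eta> \<Omega>] by (simp add: L2_def)
  have int: "integrable ?M (\<lambda>x. g x * \<eta> x)"
    by (rule L2_mult_integrable[OF g test_functions_L2[OF \<eta> \<Omega>]])
  have cont: "(LINT x|?M. g x * \<eta> x * k x) = 0" if k: "continuous_on UNIV k" "\<And>x. \<bar>k x\<bar> \<le> 1" for k
  proof -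
    have [measurable]: "k \<in> borel_measurable ?M"
      by (rule borel_measurable_lebesgue_on_continuous[OF k(1)])
    have intk: "integrable ?M (\<lambda>x. g x * \<eta> x * k x)"
      by (rule Bochner_Integration.integrable_bound[OF int])
        (use k(2) in \<open>auto simp: abs_mult mult_left_le\<close>)
    have "\<bar>LINT x|?M. g x * \<eta> x * k x\<bar> \<le> e * (LINT x|?M. \<bar>g x * \<eta> x\<bar>)" if "0 < e" for e
    proof -
      have "compact (closure {x. \<eta> x \<noteq> 0})" using \<eta> by (simp add: test_functions_def)
      from Stone_Weierstrass_real_polynomial_function[OF this continuous_on_subset[OF k(1) subset_UNIV] \<open>0 < e\<close>]
      obtain p where p: "real_polynomial_function p"
        "\<And>x. x \<in> closure {x. \<eta> x \<noteq> 0} \<Longrightarrow> \<bar>k x - p x\<bar> < e"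
        by blast
      have p\<eta>: "(\<lambda>x. p x * \<eta> x) \<in> test_functions \<Omega>"
        by (intro test_functions_smooth_mult[OF \<eta>] smooth_on_real_polynomial_function p)
      have intp: "integrable ?M (\<lambda>x. g x * (p x * \<eta> x))"
        by (rule L2_mult_integrable[OF g test_functions_L2[OF p\<eta> \<Omega>]])
      have "(LINT x|?M. g x * \<eta> x * k x) = (LINT x|?M. g x * \<eta> x * k x - g x * (p x * \<eta> x))"
        using intk intp orth[OF p\<eta>] by simp
      also have "\<bar>\<dots>\<bar> \<le> (LINT x|?M. e * \<bar>g x * \<eta> x\<bar>)"
      proof (rule order_trans[OF integral_abs_bound])
        show "(LINT x|?M. \<bar>g x * \<eta> x * k x - g x * (p x * \<eta> x)\<bar>) \<le> (LINT x|?M. e * \<bar>g x * \<eta> x\<bar>)"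
        proof (rule integral_mono)
          fix x
          have "\<eta> x \<noteq> 0 \<Longrightarrow> \<bar>k x - p x\<bar> \<le> e"
            using p(2)[of x] closure_subset[of "{x. \<eta> x \<noteq> 0}"] by fastforce
          then have "\<bar>g x * \<eta> x\<bar> * \<bar>k x - p x\<bar> \<le> \<bar>g x * \<eta> x\<bar> * e"
            by (cases "\<eta> x = 0") (auto intro!: mult_left_mono)
          then show "\<bar>g x * \<eta> x * k x - g x * (p x * \<eta> x)\<bar> \<le> e * \<bar>g x * \<eta> x\<bar>"
            by (simp add: algebra_simps flip: abs_mult)
        qed (use int intk intp in auto)
      qed
      also have "\<dots> = e * (LINT x|?M. \<bar>g x * \<eta> x\<bar>)" by simp
      finally show ?thesis .
    qed
    note bound = this
    have "((\<lambda>e. e * (LINT x|?M. \<bar>g x * \<eta> x\<bar>)) \<longlongrightarrow> 0 * (LINT x|?M. \<bar>g x * \<eta> x\<bar>)) (at_right 0)"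
      by (intro tendsto_intros)
    then have "\<bar>LINT x|?M. g x * \<eta> x * k x\<bar> \<le> 0 * (LINT x|?M. \<bar>g x * \<eta> x\<bar>)"
      by (rule tendsto_lowerbound)
        (auto intro: bound eventually_mono[OF eventually_at_right_less])
    then show ?thesis by simp
  qed
  define H where "H x = (if x \<in> \<Omega> then sgn (g x * \<eta> x) else 0)" for x
  have "(\<lambda>x. sgn (g x * \<eta> x)) \<in> borel_measurable ?M" by measurable
  then have "H \<in> borel_measurable lebesgue"
    unfolding H_def using \<Omega> by (subst borel_measurable_if) 
  then have "H measurable_on UNIV"
    by (rule lebesgue_measurable_imp_measurable_on_real) simp
  then obtain N \<kappa> where N: "negligible N" "\<And>n. continuous_on UNIV (\<kappa> n)"
    "\<And>x. x \<notin> N \<Longrightarrow> (\<lambda>n::nat. \<kappa> n x) \<longlonglongrightarrow> H x"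
    by (auto simp: measurable_on_def)
  \<comment> \<open>Clipping to [-1, 1] does not change the limit, a sign, and yields the dominating
    function for the convergence.\<close>
  define k where "k n x = max (- 1) (min 1 (\<kappa> n x))" for n x
  have k: "continuous_on UNIV (k n)" "\<bar>k n x\<bar> \<le> 1" for n x
    using N(2) by (auto simp: k_def intro!: continuous_intros)
  have [measurable]: "k n \<in> borel_measurable ?M" for n
    by (rule borel_measurable_lebesgue_on_continuous[OF k(1)])
  have "(\<lambda>n. LINT x|?M. g x * \<eta> x * k n x) \<longlonglongrightarrow> (LINT x|?M. \<bar>g x * \<eta> x\<bar>)"
  proof (rule integral_dominated_convergence[where w="\<lambda>x. \<bar>g x * \<eta> x\<bar>"])
    have "AE x in lebesgue. x \<notin> N"
      using N(1) by (simp add: negligible_iff_null_sets AE_not_in)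
    then have "AE x in ?M. x \<notin> N \<and> x \<in> \<Omega>"
      using \<Omega> by (subst AE_restrict_space_iff) auto
    then show "AE x in ?M. (\<lambda>n. g x * \<eta> x * k n x) \<longlonglongrightarrow> \<bar>g x * \<eta> x\<bar>"
    proof eventually_elim
      case (elim x)
      have "(\<lambda>n. k n x) \<longlonglongrightarrow> max (- 1) (min 1 (H x))"
        unfolding k_def using N(3) elim by (intro tendsto_intros) auto
      moreover have "max (- 1) (min 1 (H x)) = sgn (g x * \<eta> x)"
        using elim by (auto simp: H_def sgn_if)
      ultimately show ?case
        using tendsto_mult[OF tendsto_const, of "\<lambda>n. k n x" "sgn (g x * \<eta> x)" sequentially "g x * \<eta> x"]
        by (simp add: abs_sgn)
    qed
    show "AE x in ?M. norm (g x * \<eta> x * k n x) \<le> \<bar>g x * \<eta> x\<bar>" for n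
      using k(2) by (auto simp: abs_mult mult_left_le)
  qed (use int in auto)
  then have "(LINT x|?M. \<bar>g x * \<eta> x\<bar>) = 0"
    using cont[OF k] by (simp add: LIMSEQ_const_iff)
  then show ?thesis
    using int by (subst (asm) integral_nonneg_eq_0_iff_AE) auto
qed

text \<open>Every point has a ball inside \<open>\<Omega>\<close> carrying a positive bump. By
  Lindelof countably many such balls suffice, so the exceptional null sets of the local version can
  be united.\<close>

lemma fundamental_lemma:
  fixes \<Omega> :: "'a::euclidean_space set"
  assumes \<Omega>: "open \<Omega>" and g: "g \<in> L2 \<Omega>"
    and orth: "\<And>\<phi>. \<phi> \<in> test_functions \<Omega> \<Longrightarrow> (LINT x|lebesgue_on \<Omega>. g x * \<phi> x) = 0"
  shows "AE x in lebesgue_on \<Omega>. g x = 0"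
proof -
  have meas: "\<Omega> \<in> sets lebesgue" using \<Omega> by auto
  define \<F> where "\<F> = {ball p r | p r. cball p r \<subseteq> \<Omega> \<and> 0 < r}"
  obtain \<G> where \<G>: "\<G> \<subseteq> \<F>" "countable \<G>" "\<Union>\<G> = \<Union>\<F>"
    using Lindelof[of \<F>] by (auto simp: \<F>_def)
  have "AE x in lebesgue_on \<Omega>. x \<in> U \<longrightarrow> g x = 0" if "U \<in> \<G>" for U
  proof -
    obtain p r where U: "U = ball p r" "cball p r \<subseteq> \<Omega>" "0 < r"
      using \<G>(1) \<open>U \<in> \<G>\<close> unfolding \<F>_def by blast
    obtain \<phi> where \<phi>: "\<phi> \<in> test_functions \<Omega>" "\<And>x. x \<in> ball p r \<Longrightarrow> 0 < \<phi> x"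
      using test_functions_bump[OF U(2,3)] by blast
    have "AE x in lebesgue_on \<Omega>. g x * \<phi> x = 0"
      by (rule fundamental_lemma_local[OF meas g \<phi>(1) orth])
    then show ?thesis
      by eventually_elim (use \<phi>(2) U(1) in force)
  qed
  then have "AE x in lebesgue_on \<Omega>. \<forall>U\<in>\<G>. x \<in> U \<longrightarrow> g x = 0"
    by (subst AE_ball_countable[OF \<G>(2)]) blast
  moreover have "AE x in lebesgue_on \<Omega>. x \<in> \<Omega>"
    using AE_space[of "lebesgue_on \<Omega>"] by simp
  ultimately show ?thesis
  proof eventually_elim
    case (elim x)
    obtain r where "0 < r" "cball x r \<subseteq> \<Omega>"
      using \<Omega> elim(2) open_contains_cball by blast
    then have "x \<in> \<Union>\<F>" by (auto simp: \<F>_def intro!: exI[of _ "ball x r"])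
    then show ?case using elim(1) \<G>(3) by blast
  qed
qed


section \<open>Weak derivatives\<close>

lemma L2_ip_cong_AE:
  assumes "f \<in> L2 \<Omega>" "f' \<in> L2 \<Omega>" "g \<in> L2 \<Omega>" "g' \<in> L2 \<Omega>" "ae_eq \<Omega> f f'" "ae_eq \<Omega> g g'"
  shows "L2_ip \<Omega> f g = L2_ip \<Omega> f' g'"
  unfolding L2_ip_def
proof (rule integral_cong_AE)
  show "AE x in lebesgue_on \<Omega>. f x * g x = f' x * g' x"
    using assms(5,6) unfolding ae_eq_def by eventually_elim simp
qed (intro borel_measurable_times L2_measurable assms)+

lemma L2_snorm_cong_AE:
  "f \<in> L2 \<Omega> \<Longrightarrow> f' \<in> L2 \<Omega> \<Longrightarrow> ae_eq \<Omega> f f' \<Longrightarrow> L2.snorm \<Omega> f = L2.snorm \<Omega> f'"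
  using L2_ip_cong_AE[of f \<Omega> f' f f'] by (simp add: L2.snorm_def)

lemma ae_eq_refl: "ae_eq \<Omega> f f"
  by (simp add: ae_eq_def)

lemma ae_eq_sym: "ae_eq \<Omega> f g \<Longrightarrow> ae_eq \<Omega> g f"
  unfolding ae_eq_def by (auto elim: eventually_mono)

lemma ae_eq_lincomb:
  "ae_eq \<Omega> f f' \<Longrightarrow> ae_eq \<Omega> g g' \<Longrightarrow> ae_eq \<Omega> (\<lambda>x. c * f x + d * g x) (\<lambda>x. c * f' x + d * g' x)"
  unfolding ae_eq_def by (rule AE_mp) (auto elim: eventually_mono)

lemma has_weak_deriv_lincomb:
  assumes "has_weak_deriv \<Omega> i f f'" "has_weak_deriv \<Omega> i g g'" "i \<in> Basis" "\<Omega> \<in> sets lebesgue"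
  shows "has_weak_deriv \<Omega> i (\<lambda>x. c * f x + d * g x) (\<lambda>x. c * f' x + d * g' x)"
  unfolding has_weak_deriv_def L2_ip_def[symmetric]
proof (intro conjI ballI)
  have L: "f \<in> L2 \<Omega>" "f' \<in> L2 \<Omega>" "g \<in> L2 \<Omega>" "g' \<in> L2 \<Omega>"
    using assms by (auto simp: has_weak_deriv_def)
  then show "(\<lambda>x. c * f x + d * g x) \<in> L2 \<Omega>" "(\<lambda>x. c * f' x + d * g' x) \<in> L2 \<Omega>"
    by (auto intro: L2.lincomb)
  fix \<phi> assume \<phi>: "\<phi> \<in> test_functions \<Omega>"
  have "\<phi> \<in> L2 \<Omega>" "partial_deriv i \<phi> \<in> L2 \<Omega>"
    using \<phi> assms by (auto intro: test_functions_L2 test_functions_partial_deriv)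
  moreover have "L2_ip \<Omega> f (partial_deriv i \<phi>) = - L2_ip \<Omega> f' \<phi>"
    "L2_ip \<Omega> g (partial_deriv i \<phi>) = - L2_ip \<Omega> g' \<phi>"
    using assms(1,2) \<phi> by (auto simp: has_weak_deriv_def L2_ip_def)
  ultimately show "L2_ip \<Omega> (\<lambda>x. c * f x + d * g x) (partial_deriv i \<phi>) = - L2_ip \<Omega> (\<lambda>x. c * f' x + d * g' x) \<phi>"
    using L by (simp add: L2.lin)
qed

text \<open>Allowing two a.e. equal functions gives more than uniqueness of the choice: weak
  derivatives depend only on the class.\<close>

lemma has_weak_deriv_unique:
  assumes \<Omega>: "open \<Omega>" and f: "has_weak_deriv \<Omega> i f g" "has_weak_deriv \<Omega> i f' g'" "ae_eq \<Omega> f f'"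
    and i: "i \<in> Basis"
  shows "ae_eq \<Omega> g g'"
proof -
  have meas: "\<Omega> \<in> sets lebesgue" using \<Omega> by auto
  have L: "f \<in> L2 \<Omega>" "f' \<in> L2 \<Omega>" "g \<in> L2 \<Omega>" "g' \<in> L2 \<Omega>"
    using f by (auto simp: has_weak_deriv_def)
  have "AE x in lebesgue_on \<Omega>. g x - g' x = 0"
  proof (rule fundamental_lemma[OF \<Omega> L2.diff_mem[OF L(3,4)]])
    fix \<phi> assume \<phi>: "\<phi> \<in> test_functions \<Omega>"
    have T: "\<phi> \<in> L2 \<Omega>" "partial_deriv i \<phi> \<in> L2 \<Omega>"
      using \<phi> i meas by (auto intro: test_functions_L2 test_functions_partial_deriv)
    have "L2_ip \<Omega> (\<lambda>x. g x - g' x) \<phi> = L2_ip \<Omega> g \<phi> - L2_ip \<Omega> g' \<phi>"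
      using L2.B_diff_right[OF L(3,4) T(1)] by (simp add: L2.sym)
    also have "\<dots> = L2_ip \<Omega> f' (partial_deriv i \<phi>) - L2_ip \<Omega> f (partial_deriv i \<phi>)"
      using f(1,2) \<phi> by (simp add: has_weak_deriv_def L2_ip_def)
    also have "\<dots> = 0"
      using L2_ip_cong_AE[OF L(1,2) T(2,2) f(3) ae_eq_refl] by simp
    finally show "(LINT x|lebesgue_on \<Omega>. (g x - g' x) * \<phi> x) = 0" by (simp add: L2_ip_def)
  qed
  then show ?thesis by (simp add: ae_eq_def)
qed

definition grad_ip :: "'a::euclidean_space set \<Rightarrow> ('a \<Rightarrow> real) \<Rightarrow> ('a \<Rightarrow> real) \<Rightarrow> real" where
  "grad_ip \<Omega> f g = (LINT x|lebesgue_on \<Omega>. wgrad \<Omega> f x \<bullet> wgrad \<Omega> g x)"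

definition H1_ip :: "'a::euclidean_space set \<Rightarrow> ('a \<Rightarrow> real) \<Rightarrow> ('a \<Rightarrow> real) \<Rightarrow> real" where
  "H1_ip \<Omega> f g = L2_ip \<Omega> f g + grad_ip \<Omega> f g"

lemma wderiv: "f \<in> Sob1 \<Omega> \<Longrightarrow> i \<in> Basis \<Longrightarrow> has_weak_deriv \<Omega> i f (wderiv \<Omega> i f)"
  using someI_ex[of "has_weak_deriv \<Omega> i f"] by (auto simp: wderiv_def Sob1_def)

lemma wderiv_L2: "f \<in> Sob1 \<Omega> \<Longrightarrow> i \<in> Basis \<Longrightarrow> wderiv \<Omega> i f \<in> L2 \<Omega>"
  using wderiv[of f \<Omega> i] by (simp add: has_weak_deriv_def)

lemma Sob1_L2: "f \<in> Sob1 \<Omega> \<Longrightarrow> f \<in> L2 \<Omega>"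
  by (simp add: Sob1_def)

lemma Sob1_0_Sob1: "f \<in> Sob1_0 \<Omega> \<Longrightarrow> f \<in> Sob1 \<Omega>"
  by (simp add: Sob1_0_def)

lemma wgrad_inner: "wgrad \<Omega> f x \<bullet> wgrad \<Omega> g x = (\<Sum>i\<in>Basis. wderiv \<Omega> i f x * wderiv \<Omega> i g x)"
  unfolding wgrad_def by (subst euclidean_inner) simp

lemma grad_ip_eq:
  assumes "f \<in> Sob1 \<Omega>" "g \<in> Sob1 \<Omega>"
  shows "grad_ip \<Omega> f g = (\<Sum>i\<in>Basis. L2_ip \<Omega> (wderiv \<Omega> i f) (wderiv \<Omega> i g))"
  unfolding grad_ip_def wgrad_inner L2_ip_def
  using assms by (intro Bochner_Integration.integral_sum L2_mult_integrable wderiv_L2)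

lemma Lnorm_2_wgrad: "Lnorm \<Omega> 2 (wgrad \<Omega> f) = sqrt (grad_ip \<Omega> f f)"
  by (simp add: Lnorm_2_eq grad_ip_def power2_norm_eq_inner)

section \<open>The spaces H^1 and H_0^1 on a fixed open set\<close>

locale open_set =
  fixes \<Omega> :: "'a::euclidean_space set"
  assumes open_dom: "open \<Omega>"
begin

lemma dom_measurable: "\<Omega> \<in> sets lebesgue"
  using open_dom by auto

lemma wderiv_unique: "has_weak_deriv \<Omega> i f g \<Longrightarrow> i \<in> Basis \<Longrightarrow> f \<in> Sob1 \<Omega> \<Longrightarrow> ae_eq \<Omega> (wderiv \<Omega> i f) g"
  by (metis has_weak_deriv_unique[OF open_dom] wderiv ae_eq_refl)

lemma Sob1_lincomb:
  assumes "f \<in> Sob1 \<Omega>" "g \<in> Sob1 \<Omega>"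
  shows "(\<lambda>x. c * f x + d * g x) \<in> Sob1 \<Omega>"
  using has_weak_deriv_lincomb[OF wderiv[OF assms(1)] wderiv[OF assms(2)] _ dom_measurable]
    L2.lincomb[of f \<Omega> g] assms by (auto simp: Sob1_def)

lemma wderiv_lincomb:
  assumes "f \<in> Sob1 \<Omega>" "g \<in> Sob1 \<Omega>" "i \<in> Basis"
  shows "ae_eq \<Omega> (wderiv \<Omega> i (\<lambda>x. c * f x + d * g x)) (\<lambda>x. c * wderiv \<Omega> i f x + d * wderiv \<Omega> i g x)"
  using assms by (intro wderiv_unique has_weak_deriv_lincomb wderiv Sob1_lincomb dom_measurable)

sublocale grad: semi_inner "Sob1 \<Omega>" "grad_ip \<Omega>"
proof
  show "grad_ip \<Omega> (\<lambda>x. c * f x + d * g x) h = c * grad_ip \<Omega> f h + d * grad_ip \<Omega> g h"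
    if fgh: "f \<in> Sob1 \<Omega>" "g \<in> Sob1 \<Omega>" "h \<in> Sob1 \<Omega>" for f g h c d
  proof -
    have "L2_ip \<Omega> (wderiv \<Omega> i (\<lambda>x. c * f x + d * g x)) (wderiv \<Omega> i h)
        = c * L2_ip \<Omega> (wderiv \<Omega> i f) (wderiv \<Omega> i h) + d * L2_ip \<Omega> (wderiv \<Omega> i g) (wderiv \<Omega> i h)"
      if i: "i \<in> Basis" for i
    proof -
      have "L2_ip \<Omega> (wderiv \<Omega> i (\<lambda>x. c * f x + d * g x)) (wderiv \<Omega> i h)
        = L2_ip \<Omega> (\<lambda>x. c * wderiv \<Omega> i f x + d * wderiv \<Omega> i g x) (wderiv \<Omega> i h)"
        using fgh i by (intro L2_ip_cong_AE wderiv_lincomb ae_eq_refl wderiv_L2 Sob1_lincomb L2.lincomb)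
      then show ?thesis using fgh i by (simp add: L2.lin wderiv_L2)
    qed
    then show ?thesis
      using fgh by (simp add: grad_ip_eq Sob1_lincomb sum.distrib sum_distrib_left)
  qed
qed (auto simp: Sob1_lincomb grad_ip_def inner_commute)

sublocale H1: semi_inner "Sob1 \<Omega>" "H1_ip \<Omega>"
proof
  show "H1_ip \<Omega> (\<lambda>x. c * f x + d * g x) h = c * H1_ip \<Omega> f h + d * H1_ip \<Omega> g h"
    if "f \<in> Sob1 \<Omega>" "g \<in> Sob1 \<Omega>" "h \<in> Sob1 \<Omega>" for f g h c d
    using that by (simp add: H1_ip_def grad.lin L2.lin Sob1_L2 algebra_simps)
  show "H1_ip \<Omega> f g = H1_ip \<Omega> g f" for f g
    unfolding H1_ip_def by (simp only: grad.sym[of f g] L2.sym[of \<Omega> f g])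
  show "0 \<le> H1_ip \<Omega> f f" for f
    by (simp add: H1_ip_def grad.nonneg L2.nonneg)
qed (rule Sob1_lincomb)

lemma Lnorm_grad: "Lnorm \<Omega> 2 (wgrad \<Omega> f) = grad.snorm f"
  by (simp add: Lnorm_2_wgrad grad.snorm_def)

lemma Sob1_norm_eq: "Sob1_norm \<Omega> f = H1.snorm f"
  by (simp add: Sob1_norm_def H1.snorm_def H1_ip_def Lnorm_grad Lnorm_2_eq_snorm L2.snorm_sq grad.snorm_sq)

lemma L2_le_H1: "L2.snorm \<Omega> f \<le> H1.snorm f" and grad_le_H1: "grad.snorm f \<le> H1.snorm f"
  by (simp_all add: L2.snorm_def grad.snorm_def H1.snorm_def H1_ip_def grad.nonneg L2.nonneg)

lemma H1_le: "H1.snorm f \<le> L2.snorm \<Omega> f + grad.snorm f"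
  by (simp add: L2.snorm_def grad.snorm_def H1.snorm_def H1_ip_def grad.nonneg L2.nonneg sqrt_add_le_add_sqrt)

lemma tendsto_H1_iff:
  "((\<lambda>s. H1.snorm (u s)) \<longlongrightarrow> 0) F \<longleftrightarrow>
    ((\<lambda>s. L2.snorm \<Omega> (u s)) \<longlongrightarrow> 0) F \<and> ((\<lambda>s. grad.snorm (u s)) \<longlongrightarrow> 0) F"
proof
  assume H: "((\<lambda>s. H1.snorm (u s)) \<longlongrightarrow> 0) F"
  show "((\<lambda>s. L2.snorm \<Omega> (u s)) \<longlongrightarrow> 0) F \<and> ((\<lambda>s. grad.snorm (u s)) \<longlongrightarrow> 0) F"
    by (intro conjI; rule Lim_null_comparison[OF _ H])
      (simp_all add: L2.snorm_nonneg grad.snorm_nonneg L2_le_H1 grad_le_H1)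
next
  assume *: "((\<lambda>s. L2.snorm \<Omega> (u s)) \<longlongrightarrow> 0) F \<and> ((\<lambda>s. grad.snorm (u s)) \<longlongrightarrow> 0) F"
  then have "((\<lambda>s. L2.snorm \<Omega> (u s) + grad.snorm (u s)) \<longlongrightarrow> 0 + 0) F"
    by (intro tendsto_add) auto
  then show "((\<lambda>s. H1.snorm (u s)) \<longlongrightarrow> 0) F"
    by (intro Lim_null_comparison[of "\<lambda>s. H1.snorm (u s)" "\<lambda>s. L2.snorm \<Omega> (u s) + grad.snorm (u s)"])
      (simp_all add: H1.snorm_nonneg H1_le)
qed

lemma grad_snorm_cong_AE:
  assumes "f \<in> Sob1 \<Omega>" "g \<in> Sob1 \<Omega>" "ae_eq \<Omega> f g"
  shows "grad.snorm f = grad.snorm g"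
proof -
  have "ae_eq \<Omega> (wderiv \<Omega> i f) (wderiv \<Omega> i g)" if "i \<in> Basis" for i
    using has_weak_deriv_unique[OF open_dom wderiv wderiv assms(3)] assms(1,2) that by blast
  then have "grad_ip \<Omega> f f = grad_ip \<Omega> g g"
    using assms by (simp add: grad_ip_eq) (intro sum.cong L2_ip_cong_AE wderiv_L2; simp)
  then show ?thesis by (simp add: grad.snorm_def)
qed

lemma test_functions_Sob1: "\<phi> \<in> test_functions \<Omega> \<Longrightarrow> \<phi> \<in> Sob1 \<Omega>"
  using test_functions_has_weak_deriv[OF _ _ dom_measurable] test_functions_L2[OF _ dom_measurable]
  by (auto simp: Sob1_def)

lemma test_functions_L2_snorm:
  assumes "\<phi> \<in> test_functions \<Omega>"
  shows "(L2.snorm \<Omega> \<phi>)\<^sup>2 = (LINT x|lborel. (\<phi> x)\<^sup>2)"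
proof -
  have "(LINT x|lebesgue_on \<Omega>. (\<phi> x)\<^sup>2) = (LINT x|lborel. (\<phi> x)\<^sup>2)"
    using test_functions_borel[OF assms] test_functionsD(2)[OF assms] dom_measurable
    by (intro integral_lebesgue_on_eq_lborel(1)) auto
  then show ?thesis unfolding L2.snorm_sq by (simp add: L2_ip_def power2_eq_square)
qed

lemma test_functions_grad_snorm:
  assumes \<phi>: "\<phi> \<in> test_functions \<Omega>"
  shows "(grad.snorm \<phi>)\<^sup>2 = (LINT x|lborel. (norm (classical_grad \<phi> x))\<^sup>2)"
    and "integrable lborel (\<lambda>x. (norm (classical_grad \<phi> x))\<^sup>2)"
proof -
  have sq: "integrable lborel (\<lambda>x. (partial_deriv i \<phi> x)\<^sup>2)" if "i \<in> Basis" for i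
    using test_functions_mult_integrable[OF test_functions_partial_deriv[OF \<phi> that]
        test_functions_continuous[OF test_functions_partial_deriv[OF \<phi> that]]]
    by (simp add: power2_eq_square)
  have "(grad.snorm \<phi>)\<^sup>2 = (\<Sum>i\<in>Basis. L2_ip \<Omega> (wderiv \<Omega> i \<phi>) (wderiv \<Omega> i \<phi>))"
    using \<phi> by (simp add: grad.snorm_sq grad_ip_eq test_functions_Sob1)
  also have "\<dots> = (\<Sum>i\<in>Basis. L2_ip \<Omega> (partial_deriv i \<phi>) (partial_deriv i \<phi>))"
    using \<phi> dom_measurable
    by (intro sum.cong refl L2_ip_cong_AE wderiv_unique test_functions_has_weak_deriv wderiv_L2
        test_functions_Sob1 test_functions_L2 test_functions_partial_deriv)
  also have "\<dots> = (\<Sum>i\<in>Basis. LINT x|lborel. (partial_deriv i \<phi> x)\<^sup>2)"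
    using test_functions_L2_snorm[OF test_functions_partial_deriv[OF \<phi>]]
    by (simp add: L2.snorm_sq)
  also have "\<dots> = (LINT x|lborel. (norm (classical_grad \<phi> x))\<^sup>2)"
    unfolding norm_classical_grad by (intro Bochner_Integration.integral_sum[symmetric] sq)
  finally show "(grad.snorm \<phi>)\<^sup>2 = (LINT x|lborel. (norm (classical_grad \<phi> x))\<^sup>2)" .
  show "integrable lborel (\<lambda>x. (norm (classical_grad \<phi> x))\<^sup>2)"
    unfolding norm_classical_grad by (intro Bochner_Integration.integrable_sum sq)
qed

text \<open>The density argument in the form used below: an inequality between norms of test
  functions passes to H_0^1 along the last two limits.\<close>

lemma Sob1_0_approx:
  assumes "f \<in> Sob1_0 \<Omega>"
  obtains \<phi> :: "nat \<Rightarrow> 'a \<Rightarrow> real" where "\<And>n. \<phi> n \<in> test_functions \<Omega>"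
    "(\<lambda>n. L2.snorm \<Omega> (\<lambda>x. \<phi> n x - f x)) \<longlonglongrightarrow> 0" "(\<lambda>n. grad.snorm (\<lambda>x. \<phi> n x - f x)) \<longlonglongrightarrow> 0"
    "(\<lambda>n. L2.snorm \<Omega> (\<phi> n)) \<longlonglongrightarrow> L2.snorm \<Omega> f" "(\<lambda>n. grad.snorm (\<phi> n)) \<longlonglongrightarrow> grad.snorm f"
proof -
  obtain \<phi> :: "nat \<Rightarrow> 'a \<Rightarrow> real" where \<phi>: "\<And>n. \<phi> n \<in> test_functions \<Omega>"
    and "(\<lambda>n. H1.snorm (\<lambda>x. \<phi> n x - f x)) \<longlonglongrightarrow> 0"
    using assms unfolding Sob1_0_def Sob1_norm_eq by blast
  then have lim: "(\<lambda>n. L2.snorm \<Omega> (\<lambda>x. \<phi> n x - f x)) \<longlonglongrightarrow> 0"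
    "(\<lambda>n. grad.snorm (\<lambda>x. \<phi> n x - f x)) \<longlonglongrightarrow> 0"
    by (simp_all add: tendsto_H1_iff)
  have S: "f \<in> Sob1 \<Omega>" "f \<in> L2 \<Omega>" using assms by (auto intro: Sob1_0_Sob1 Sob1_L2)
  have "(\<lambda>n. L2.snorm \<Omega> (\<phi> n)) \<longlonglongrightarrow> L2.snorm \<Omega> f"
    by (rule L2.tendsto_snorm[OF lim(1) _ S(2)])
      (auto intro!: always_eventually test_functions_L2 \<phi> dom_measurable)
  moreover have "(\<lambda>n. grad.snorm (\<phi> n)) \<longlonglongrightarrow> grad.snorm f"
    by (rule grad.tendsto_snorm[OF lim(2) _ S(1)])
      (auto intro!: always_eventually test_functions_Sob1 \<phi>)
  ultimately show ?thesis using \<phi> lim that by blast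
qed

lemma Sob1_0_lincomb:
  assumes f: "f \<in> Sob1_0 \<Omega>" and g: "g \<in> Sob1_0 \<Omega>"
  shows "(\<lambda>x. c * f x + d * g x) \<in> Sob1_0 \<Omega>"
proof -
  obtain \<phi> :: "nat \<Rightarrow> 'a \<Rightarrow> real" where \<phi>: "\<And>n. \<phi> n \<in> test_functions \<Omega>"
    "(\<lambda>n. H1.snorm (\<lambda>x. \<phi> n x - f x)) \<longlonglongrightarrow> 0"
    using f unfolding Sob1_0_def Sob1_norm_eq by blast
  obtain \<psi> :: "nat \<Rightarrow> 'a \<Rightarrow> real" where \<psi>: "\<And>n. \<psi> n \<in> test_functions \<Omega>"
    "(\<lambda>n. H1.snorm (\<lambda>x. \<psi> n x - g x)) \<longlonglongrightarrow> 0"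
    using g unfolding Sob1_0_def Sob1_norm_eq by blast
  have S: "f \<in> Sob1 \<Omega>" "g \<in> Sob1 \<Omega>" "\<And>n. \<phi> n \<in> Sob1 \<Omega>" "\<And>n. \<psi> n \<in> Sob1 \<Omega>"
    using assms \<phi>(1) \<psi>(1) by (auto intro: Sob1_0_Sob1 test_functions_Sob1)
  let ?h = "\<lambda>n x. c * \<phi> n x + d * \<psi> n x"
  have "(\<lambda>n. H1.snorm (\<lambda>x. ?h n x - (c * f x + d * g x))) \<longlonglongrightarrow> 0"
  proof (rule Lim_null_comparison)
    have eq: "(\<lambda>x. ?h n x - (c * f x + d * g x)) = (\<lambda>x. c * (\<phi> n x - f x) + d * (\<psi> n x - g x))" for n
      by (auto simp: algebra_simps)
    show "\<forall>\<^sub>F n in sequentially. norm (H1.snorm (\<lambda>x. ?h n x - (c * f x + d * g x)))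
        \<le> \<bar>c\<bar> * H1.snorm (\<lambda>x. \<phi> n x - f x) + \<bar>d\<bar> * H1.snorm (\<lambda>x. \<psi> n x - g x)"
      unfolding eq using H1.snorm_lincomb_le[OF H1.diff_mem[OF S(3,1)] H1.diff_mem[OF S(4,2)]]
      by (simp add: H1.snorm_nonneg)
    have "(\<lambda>n. \<bar>c\<bar> * H1.snorm (\<lambda>x. \<phi> n x - f x) + \<bar>d\<bar> * H1.snorm (\<lambda>x. \<psi> n x - g x))
        \<longlonglongrightarrow> \<bar>c\<bar> * 0 + \<bar>d\<bar> * 0"
      by (intro tendsto_intros \<phi> \<psi>)
    then show "(\<lambda>n. \<bar>c\<bar> * H1.snorm (\<lambda>x. \<phi> n x - f x) + \<bar>d\<bar> * H1.snorm (\<lambda>x. \<psi> n x - g x)) \<longlonglongrightarrow> 0"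
      by simp
  qed
  moreover have "?h n \<in> test_functions \<Omega>" for n
    by (intro test_functions_add test_functions_scale \<phi> \<psi>)
  ultimately show ?thesis
    using Sob1_lincomb[OF S(1,2)] unfolding Sob1_0_def Sob1_norm_eq
    by (intro CollectI conjI exI[of _ ?h] allI)
qed

lemma Sob1_0_diff: "f \<in> Sob1_0 \<Omega> \<Longrightarrow> g \<in> Sob1_0 \<Omega> \<Longrightarrow> (\<lambda>x. f x - g x) \<in> Sob1_0 \<Omega>"
  using Sob1_0_lincomb[of f g 1 "-1"] by simp

lemma Sob1_0_scale: "f \<in> Sob1_0 \<Omega> \<Longrightarrow> (\<lambda>x. c * f x) \<in> Sob1_0 \<Omega>"
  using Sob1_0_lincomb[of f f c 0] by simp

text \<open>The chosen derivative of a difference is only a.e. the difference of the chosen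
  derivatives; this lets convergence of gradients be read off component by component.\<close>

lemma grad_snorm_diff:
  assumes f: "f \<in> Sob1 \<Omega>" and g: "g \<in> Sob1 \<Omega>"
  shows "grad.snorm (\<lambda>x. f x - g x) = L2_set (\<lambda>i. L2.snorm \<Omega> (\<lambda>x. wderiv \<Omega> i f x - wderiv \<Omega> i g x)) Basis"
proof -
  let ?d = "\<lambda>x. f x - g x"
  have d: "?d \<in> Sob1 \<Omega>" by (rule grad.diff_mem[OF f g])
  have "L2.snorm \<Omega> (wderiv \<Omega> i ?d) = L2.snorm \<Omega> (\<lambda>x. wderiv \<Omega> i f x - wderiv \<Omega> i g x)"
    if "i \<in> Basis" for i
    using wderiv_lincomb[OF f g that, of 1 "-1"]
    by (intro L2_snorm_cong_AE L2.diff_mem wderiv_L2 f g d that) simp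
  then have "(\<Sum>i\<in>Basis. (L2.snorm \<Omega> (wderiv \<Omega> i ?d))\<^sup>2)
      = (\<Sum>i\<in>Basis. (L2.snorm \<Omega> (\<lambda>x. wderiv \<Omega> i f x - wderiv \<Omega> i g x))\<^sup>2)"
    by (intro sum.cong) auto
  then show ?thesis
    unfolding L2_set_def grad.snorm_def grad_ip_eq[OF d d] by (simp only: L2.snorm_sq)
qed

text \<open>Weak derivatives are defined by smooth test functions; both sides are continuous in
  \<open>v\<close> for the H^1 norm, so density extends the identity to H_0^1.\<close>

lemma weak_deriv_Sob1_0:
  assumes f: "has_weak_deriv \<Omega> i f g" and i: "i \<in> Basis" and v: "v \<in> Sob1_0 \<Omega>"
  shows "L2_ip \<Omega> f (wderiv \<Omega> i v) = - L2_ip \<Omega> g v"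
proof -
  have fg: "f \<in> L2 \<Omega>" "g \<in> L2 \<Omega>" using f by (auto simp: has_weak_deriv_def)
  have vS: "v \<in> Sob1 \<Omega>" "v \<in> L2 \<Omega>" using v by (auto intro: Sob1_0_Sob1 Sob1_L2)
  obtain \<phi> :: "nat \<Rightarrow> 'a \<Rightarrow> real" where \<phi>: "\<And>n. \<phi> n \<in> test_functions \<Omega>"
    "(\<lambda>n. L2.snorm \<Omega> (\<lambda>x. \<phi> n x - v x)) \<longlonglongrightarrow> 0" "(\<lambda>n. grad.snorm (\<lambda>x. \<phi> n x - v x)) \<longlonglongrightarrow> 0"
    by (rule Sob1_0_approx[OF v]) blast
  have \<phi>S: "\<phi> n \<in> Sob1 \<Omega>" "\<phi> n \<in> L2 \<Omega>" for n
    by (auto intro: test_functions_Sob1 Sob1_L2 \<phi>)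
  have "norm (L2.snorm \<Omega> (\<lambda>x. wderiv \<Omega> i (\<phi> n) x - wderiv \<Omega> i v x)) \<le> grad.snorm (\<lambda>x. \<phi> n x - v x)" for n
    unfolding grad_snorm_diff[OF \<phi>S(1) vS(1)] real_norm_def abs_of_nonneg[OF L2.snorm_nonneg]
    using i by (intro member_le_L2_set[where f="\<lambda>i. L2.snorm \<Omega> (\<lambda>x. wderiv \<Omega> i (\<phi> n) x - wderiv \<Omega> i v x)"]) auto
  then have "(\<lambda>n. L2.snorm \<Omega> (\<lambda>x. wderiv \<Omega> i (\<phi> n) x - wderiv \<Omega> i v x)) \<longlonglongrightarrow> 0"
    by (intro Lim_null_comparison[OF _ \<phi>(3)] always_eventually allI)
  then have "(\<lambda>n. L2_ip \<Omega> f (wderiv \<Omega> i (\<phi> n))) \<longlonglongrightarrow> L2_ip \<Omega> f (wderiv \<Omega> i v)"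
    by (rule L2.tendsto_B_right) (auto intro!: always_eventually wderiv_L2 \<phi>S vS i fg)
  moreover have "(\<lambda>n. - L2_ip \<Omega> g (\<phi> n)) \<longlonglongrightarrow> - L2_ip \<Omega> g v"
    by (intro tendsto_minus L2.tendsto_B_right[OF \<phi>(2)]) (auto intro!: always_eventually \<phi>S vS fg)
  moreover have "L2_ip \<Omega> f (wderiv \<Omega> i (\<phi> n)) = - L2_ip \<Omega> g (\<phi> n)" for n
  proof -
    have "L2_ip \<Omega> f (wderiv \<Omega> i (\<phi> n)) = L2_ip \<Omega> f (partial_deriv i (\<phi> n))"
      using \<phi>(1) i fg dom_measurable
      by (intro L2_ip_cong_AE[OF fg(1) fg(1) _ _ ae_eq_refl] wderiv_unique wderiv_L2 \<phi>S
          test_functions_has_weak_deriv test_functions_L2 test_functions_partial_deriv) auto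
    then show ?thesis using f \<phi>(1) by (simp add: has_weak_deriv_def L2_ip_def)
  qed
  ultimately show ?thesis using LIMSEQ_unique by simp
qed

text \<open>Green's formula, from the preceding lemma applied to each first derivative of
  \<open>u\<close>. The boundary term is absent because \<open>v\<close> is a limit of compactly
  supported functions.\<close>

lemma grad_ip_laplacian:
  assumes u: "u \<in> Sob2 \<Omega>" and v: "v \<in> Sob1_0 \<Omega>"
  shows "grad_ip \<Omega> u v = - L2_ip \<Omega> (wlaplacian \<Omega> u) v" and "wlaplacian \<Omega> u \<in> L2 \<Omega>"
proof -
  have uS: "u \<in> Sob1 \<Omega>" "\<And>i. i \<in> Basis \<Longrightarrow> wderiv \<Omega> i u \<in> Sob1 \<Omega>"
    using u by (auto simp: Sob2_def)
  have dd: "wderiv \<Omega> i (wderiv \<Omega> i u) \<in> L2 \<Omega>" if "i \<in> Basis" for i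
    using wderiv_L2[OF uS(2)] that by blast
  have vL: "v \<in> L2 \<Omega>" using v by (auto intro: Sob1_0_Sob1 Sob1_L2)
  have "grad_ip \<Omega> u v = (\<Sum>i\<in>Basis. L2_ip \<Omega> (wderiv \<Omega> i u) (wderiv \<Omega> i v))"
    by (rule grad_ip_eq[OF uS(1) Sob1_0_Sob1[OF v]])
  also have "\<dots> = (\<Sum>i\<in>Basis. - L2_ip \<Omega> (wderiv \<Omega> i (wderiv \<Omega> i u)) v)"
    using v uS(2) by (intro sum.cong refl weak_deriv_Sob1_0 wderiv)
  also have "\<dots> = - L2_ip \<Omega> (wlaplacian \<Omega> u) v"
    unfolding L2_ip_def wlaplacian_def sum_distrib_right sum_negf
    using L2_mult_integrable[OF dd vL] by (subst Bochner_Integration.integral_sum) auto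
  finally show "grad_ip \<Omega> u v = - L2_ip \<Omega> (wlaplacian \<Omega> u) v" .
  have "(\<lambda>x. \<Sum>i\<in>A. wderiv \<Omega> i (wderiv \<Omega> i u) x) \<in> L2 \<Omega>" if "finite A" "A \<subseteq> Basis" for A
    using that
  proof (induction A rule: finite_induct)
    case empty
    then show ?case using L2.scale_mem[OF vL, of 0] by simp
  next
    case (insert i A)
    then show ?case using L2.add_mem[OF dd[of i]] by simp
  qed
  from this[of Basis] show "wlaplacian \<Omega> u \<in> L2 \<Omega>"
    by (simp add: wlaplacian_def[abs_def])
qed

end


section \<open>Completeness\<close>

lemma nn_integral_Fatou_bound:
  fixes F :: "nat \<Rightarrow> 'a \<Rightarrow> real"
  assumes [measurable]: "\<And>n. F n \<in> borel_measurable M"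
    and lim: "AE x in M. (\<lambda>n. F n x) \<longlonglongrightarrow> f x"
    and bound: "\<forall>\<^sub>F n in sequentially. (\<integral>\<^sup>+x. ennreal (F n x) \<partial>M) \<le> c"
  shows "(\<integral>\<^sup>+x. ennreal (f x) \<partial>M) \<le> c"
proof -
  have "(\<integral>\<^sup>+x. ennreal (f x) \<partial>M) = (\<integral>\<^sup>+x. liminf (\<lambda>n. ennreal (F n x)) \<partial>M)"
  proof (rule nn_integral_cong_AE, use lim in eventually_elim)
    case (elim x)
    then have "(\<lambda>n. ennreal (F n x)) \<longlonglongrightarrow> ennreal (f x)" by (intro tendsto_ennrealI)
    then show ?case by (intro lim_imp_Liminf[symmetric]) auto
  qed
  also have "\<dots> \<le> liminf (\<lambda>n. \<integral>\<^sup>+x. ennreal (F n x) \<partial>M)"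
    by (rule nn_integral_liminf) auto
  also have "\<dots> \<le> c" using bound by (intro Liminf_le) auto
  finally show ?thesis .
qed

lemma nn_integral_L2:
  "f \<in> L2 \<Omega> \<Longrightarrow> (\<integral>\<^sup>+x. ennreal ((f x)\<^sup>2) \<partial>lebesgue_on \<Omega>) = ennreal ((L2.snorm \<Omega> f)\<^sup>2)"
  unfolding L2.snorm_sq by (subst nn_integral_eq_integral) (auto simp: L2_def L2_ip_def power2_eq_square)

lemma L2_from_nn_integral:
  assumes [measurable]: "f \<in> borel_measurable (lebesgue_on \<Omega>)"
    and le: "(\<integral>\<^sup>+x. ennreal ((f x)\<^sup>2) \<partial>lebesgue_on \<Omega>) \<le> ennreal (c\<^sup>2)" and c: "0 \<le> c"
  shows "f \<in> L2 \<Omega>" and "L2.snorm \<Omega> f \<le> c"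
proof -
  have "integrable (lebesgue_on \<Omega>) (\<lambda>x. (f x)\<^sup>2)"
    by (rule integrableI_bounded) (use le in \<open>auto intro: le_less_trans\<close>)
  then show f: "f \<in> L2 \<Omega>" by (simp add: L2_def)
  have "(L2.snorm \<Omega> f)\<^sup>2 \<le> c\<^sup>2"
    using le unfolding nn_integral_L2[OF f] by (simp add: ennreal_le_iff)
  then show "L2.snorm \<Omega> f \<le> c" using c by (rule power2_le_imp_le)
qed

lemma L2_const:
  assumes "bounded \<Omega>" "\<Omega> \<in> sets lebesgue"
  shows "(\<lambda>x. c) \<in> L2 \<Omega>"
proof -
  have "finite_measure (lebesgue_on \<Omega>)"
    using assms by (intro finite_measure_lebesgue_on bounded_set_imp_lmeasurable)
  then show ?thesis by (auto simp: L2_def intro: finite_measure.integrable_const)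
qed

lemma L1_le_L2:
  assumes f: "f \<in> L2 \<Omega>" and one: "(\<lambda>x. 1) \<in> L2 \<Omega>"
  shows "integrable (lebesgue_on \<Omega>) f"
    and "(LINT x|lebesgue_on \<Omega>. \<bar>f x\<bar>) \<le> L2.snorm \<Omega> f * L2.snorm \<Omega> (\<lambda>x. 1)"
proof -
  show int: "integrable (lebesgue_on \<Omega>) f"
    using L2_mult_integrable[OF f one] by simp
  have a: "(\<lambda>x. \<bar>f x\<bar>) \<in> L2 \<Omega>" using f by (auto simp: L2_def)
  have "L2.snorm \<Omega> (\<lambda>x. \<bar>f x\<bar>) = L2.snorm \<Omega> f"
    by (simp add: L2.snorm_def L2_ip_def)
  then show "(LINT x|lebesgue_on \<Omega>. \<bar>f x\<bar>) \<le> L2.snorm \<Omega> f * L2.snorm \<Omega> (\<lambda>x. 1)"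
    using L2.cauchy_schwarz[OF a one] by (simp add: L2_ip_def)
qed

text \<open>Since constants lie in L^2, the sequence is Cauchy in L^1 and has an a.e. convergent
  subsequence. Fatou along that subsequence, with the other index fixed, turns the pointwise limit
  into an L^2 limit of the whole sequence.\<close>

lemma L2_complete:
  fixes f :: "nat \<Rightarrow> 'a::euclidean_space \<Rightarrow> real"
  assumes f: "\<And>n. f n \<in> L2 \<Omega>" and one: "(\<lambda>x. 1) \<in> L2 \<Omega>"
    and C: "\<And>e. 0 < e \<Longrightarrow> \<exists>N. \<forall>m\<ge>N. \<forall>n\<ge>N. L2.snorm \<Omega> (\<lambda>x. f m x - f n x) < e"
  obtains g where "g \<in> L2 \<Omega>" "(\<lambda>n. L2.snorm \<Omega> (\<lambda>x. f n x - g x)) \<longlonglongrightarrow> 0"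
proof -
  let ?M = "lebesgue_on \<Omega>"
  have [measurable]: "f n \<in> borel_measurable ?M" for n by (rule L2_measurable[OF f])
  \<comment> \<open>The added 1 makes the divisor positive even when \<open>\<Omega>\<close> is a
    null set.\<close>
  define K where "K = L2.snorm \<Omega> (\<lambda>x. 1) + 1"
  have K: "0 < K" using L2.snorm_nonneg[of \<Omega> "\<lambda>x. 1"] by (simp add: K_def)
  have "\<exists>N. \<forall>i\<ge>N. \<forall>j\<ge>N. (LINT x|?M. norm (f i x - f j x)) < e" if "0 < e" for e
  proof -
    obtain N where N: "\<And>m n. m \<ge> N \<Longrightarrow> n \<ge> N \<Longrightarrow> L2.snorm \<Omega> (\<lambda>x. f m x - f n x) < e / K"
      using C[of "e / K"] \<open>0 < e\<close> K by auto
    have "(LINT x|?M. norm (f i x - f j x)) < e" if "i \<ge> N" "j \<ge> N" for i j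
    proof -
      have "(LINT x|?M. \<bar>f i x - f j x\<bar>) \<le> L2.snorm \<Omega> (\<lambda>x. f i x - f j x) * L2.snorm \<Omega> (\<lambda>x. 1)"
        by (rule L1_le_L2(2)[OF L2.diff_mem[OF f f] one])
      also have "\<dots> \<le> L2.snorm \<Omega> (\<lambda>x. f i x - f j x) * K"
        by (intro mult_left_mono L2.snorm_nonneg) (simp add: K_def)
      also have "\<dots> < e" using N[OF that] K by (simp add: pos_less_divide_eq)
      finally show ?thesis by simp
    qed
    then show ?thesis by blast
  qed
  then obtain r where r: "strict_mono r" and Cau: "AE x in ?M. Cauchy (\<lambda>i. f (r i) x)"
    using cauchy_L1_AE_cauchy_subseq[of ?M f] L1_le_L2(1)[OF f one] by blast
  define g where "g x = lim (\<lambda>i. f (r i) x)" for x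
  have [measurable]: "g \<in> borel_measurable ?M" unfolding g_def by measurable
  have lim: "AE x in ?M. (\<lambda>i. f (r i) x) \<longlonglongrightarrow> g x"
    using Cau unfolding g_def
    by eventually_elim (simp add: Cauchy_convergent_iff convergent_LIMSEQ_iff)
  have close: "(\<lambda>x. f n x - g x) \<in> L2 \<Omega>" "L2.snorm \<Omega> (\<lambda>x. f n x - g x) \<le> e"
    if e: "0 < e" and N: "\<forall>m\<ge>N. \<forall>n\<ge>N. L2.snorm \<Omega> (\<lambda>x. f m x - f n x) < e" "n \<ge> N" for e n N
  proof -
    have "(\<integral>\<^sup>+x. ennreal ((f n x - g x)\<^sup>2) \<partial>?M) \<le> ennreal (e\<^sup>2)"
    proof (rule nn_integral_Fatou_bound)
      show "AE x in ?M. (\<lambda>i. (f n x - f (r i) x)\<^sup>2) \<longlonglongrightarrow> (f n x - g x)\<^sup>2"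
        using lim by eventually_elim (intro tendsto_intros)
      show "\<forall>\<^sub>F i in sequentially. (\<integral>\<^sup>+x. ennreal ((f n x - f (r i) x)\<^sup>2) \<partial>?M) \<le> ennreal (e\<^sup>2)"
      proof (rule eventually_sequentiallyI[of N])
        fix i assume "N \<le> i"
        then have "N \<le> r i" using seq_suble[OF r, of i] by simp
        then have "L2.snorm \<Omega> (\<lambda>x. f n x - f (r i) x) \<le> e" using N by (simp add: less_imp_le)
        then show "(\<integral>\<^sup>+x. ennreal ((f n x - f (r i) x)\<^sup>2) \<partial>?M) \<le> ennreal (e\<^sup>2)"
          unfolding nn_integral_L2[OF L2.diff_mem[OF f f]]
          by (intro ennreal_leI power_mono L2.snorm_nonneg)
      qed
    qed auto
    then show "(\<lambda>x. f n x - g x) \<in> L2 \<Omega>" "L2.snorm \<Omega> (\<lambda>x. f n x - g x) \<le> e"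
      using L2_from_nn_integral[of "\<lambda>x. f n x - g x"] e by auto
  qed
  obtain N where "\<forall>m\<ge>N. \<forall>n\<ge>N. L2.snorm \<Omega> (\<lambda>x. f m x - f n x) < 1" using C[of 1] by auto
  from L2.diff_mem[OF f[of N] close(1)[OF zero_less_one this order_refl]] have "g \<in> L2 \<Omega>" by simp
  moreover have "(\<lambda>n. L2.snorm \<Omega> (\<lambda>x. f n x - g x)) \<longlonglongrightarrow> 0"
  proof (rule LIMSEQ_I)
    fix e :: real assume "0 < e"
    then obtain N where N: "\<forall>m\<ge>N. \<forall>n\<ge>N. L2.snorm \<Omega> (\<lambda>x. f m x - f n x) < e / 2"
      using C[of "e / 2"] by auto
    have "norm (L2.snorm \<Omega> (\<lambda>x. f n x - g x) - 0) < e" if "n \<ge> N" for n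
      using close(2)[OF _ N that] \<open>0 < e\<close> by (simp add: L2.snorm_nonneg)
    then show "\<exists>N. \<forall>n\<ge>N. norm (L2.snorm \<Omega> (\<lambda>x. f n x - g x) - 0) < e" by blast
  qed
  ultimately show ?thesis using that by blast
qed

locale bounded_open_set = open_set +
  assumes bounded_dom: "bounded \<Omega>"
begin

lemma one_L2: "(\<lambda>x. 1) \<in> L2 \<Omega>"
  by (rule L2_const[OF bounded_dom dom_measurable])

text \<open>The functions and each of their weak derivatives converge in L^2, and the defining
  identity passes to the limit, so the limits of the derivatives are the derivatives of the limit.
  Starting from test functions puts the limit in the closure at once.\<close>

lemma Sob1_0_complete:
  fixes \<phi> :: "nat \<Rightarrow> 'a \<Rightarrow> real"
  assumes \<phi>: "\<And>n. \<phi> n \<in> test_functions \<Omega>"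
    and C: "\<And>e. 0 < e \<Longrightarrow> \<exists>N. \<forall>m\<ge>N. \<forall>n\<ge>N. L2.snorm \<Omega> (\<lambda>x. \<phi> m x - \<phi> n x) < e"
    and Cg: "\<And>e. 0 < e \<Longrightarrow> \<exists>N. \<forall>m\<ge>N. \<forall>n\<ge>N. grad.snorm (\<lambda>x. \<phi> m x - \<phi> n x) < e"
  obtains f where "f \<in> Sob1_0 \<Omega>" "(\<lambda>n. L2.snorm \<Omega> (\<lambda>x. \<phi> n x - f x)) \<longlonglongrightarrow> 0"
    "(\<lambda>n. grad.snorm (\<lambda>x. \<phi> n x - f x)) \<longlonglongrightarrow> 0"
proof -
  have \<phi>S: "\<phi> n \<in> Sob1 \<Omega>" "\<phi> n \<in> L2 \<Omega>" for n
    by (auto intro: test_functions_Sob1 Sob1_L2 \<phi>)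
  obtain f where f: "f \<in> L2 \<Omega>" "(\<lambda>n. L2.snorm \<Omega> (\<lambda>x. \<phi> n x - f x)) \<longlonglongrightarrow> 0"
    by (rule L2_complete[OF \<phi>S(2) one_L2 C])
  have "\<exists>g. g \<in> L2 \<Omega> \<and> (\<lambda>n. L2.snorm \<Omega> (\<lambda>x. wderiv \<Omega> i (\<phi> n) x - g x)) \<longlonglongrightarrow> 0"
    if i: "i \<in> Basis" for i
  proof -
    have le: "L2.snorm \<Omega> (\<lambda>x. wderiv \<Omega> i (\<phi> m) x - wderiv \<Omega> i (\<phi> n) x) \<le> grad.snorm (\<lambda>x. \<phi> m x - \<phi> n x)" for m n
      unfolding grad_snorm_diff[OF \<phi>S(1) \<phi>S(1)]
      using i by (intro member_le_L2_set[where f="\<lambda>i. L2.snorm \<Omega> (\<lambda>x. wderiv \<Omega> i (\<phi> m) x - wderiv \<Omega> i (\<phi> n) x)"]) auto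
    obtain g where "g \<in> L2 \<Omega>" "(\<lambda>n. L2.snorm \<Omega> (\<lambda>x. wderiv \<Omega> i (\<phi> n) x - g x)) \<longlonglongrightarrow> 0"
    proof (rule L2_complete[OF wderiv_L2[OF \<phi>S(1) i] one_L2])
      show "\<exists>N. \<forall>m\<ge>N. \<forall>n\<ge>N. L2.snorm \<Omega> (\<lambda>x. wderiv \<Omega> i (\<phi> m) x - wderiv \<Omega> i (\<phi> n) x) < e" if "0 < e" for e
        using Cg[OF that] le le_less_trans by meson
    qed
    then show ?thesis by blast
  qed
  then obtain g where g: "\<And>i. i \<in> Basis \<Longrightarrow> g i \<in> L2 \<Omega>"
    "\<And>i. i \<in> Basis \<Longrightarrow> (\<lambda>n. L2.snorm \<Omega> (\<lambda>x. wderiv \<Omega> i (\<phi> n) x - g i x)) \<longlonglongrightarrow> 0"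
    by metis
  have wd: "has_weak_deriv \<Omega> i f (g i)" if i: "i \<in> Basis" for i
    unfolding has_weak_deriv_def
  proof (intro conjI ballI)
    fix \<psi> assume \<psi>: "\<psi> \<in> test_functions \<Omega>"
    have T: "\<psi> \<in> L2 \<Omega>" "partial_deriv i \<psi> \<in> L2 \<Omega>"
      using \<psi> i dom_measurable by (auto intro: test_functions_L2 test_functions_partial_deriv)
    have "(\<lambda>n. L2_ip \<Omega> (partial_deriv i \<psi>) (\<phi> n)) \<longlonglongrightarrow> L2_ip \<Omega> (partial_deriv i \<psi>) f"
      by (rule L2.tendsto_B_right[OF f(2)]) (auto simp: \<phi>S f T)
    moreover have "(\<lambda>n. - L2_ip \<Omega> \<psi> (wderiv \<Omega> i (\<phi> n))) \<longlonglongrightarrow> - L2_ip \<Omega> \<psi> (g i)"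
      by (intro tendsto_minus L2.tendsto_B_right[OF g(2)[OF i]]) (auto simp: \<phi>S g T wderiv_L2 i)
    moreover have "L2_ip \<Omega> (partial_deriv i \<psi>) (\<phi> n) = - L2_ip \<Omega> \<psi> (wderiv \<Omega> i (\<phi> n))" for n
      using wderiv[OF \<phi>S(1)[of n] i] \<psi> by (simp add: has_weak_deriv_def L2_ip_def mult.commute)
    ultimately have "L2_ip \<Omega> (partial_deriv i \<psi>) f = - L2_ip \<Omega> \<psi> (g i)"
      using LIMSEQ_unique by simp
    then show "(LINT x|lebesgue_on \<Omega>. f x * partial_deriv i \<psi> x) = - (LINT x|lebesgue_on \<Omega>. g i x * \<psi> x)"
      by (simp add: L2_ip_def mult.commute)
  qed (use f g i in auto)
  have fS: "f \<in> Sob1 \<Omega>" using f(1) wd by (auto simp: Sob1_def)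
  have eq: "L2.snorm \<Omega> (\<lambda>x. wderiv \<Omega> i (\<phi> n) x - wderiv \<Omega> i f x) = L2.snorm \<Omega> (\<lambda>x. wderiv \<Omega> i (\<phi> n) x - g i x)"
    if i: "i \<in> Basis" for i n
    using ae_eq_lincomb[OF ae_eq_refl[of \<Omega> "wderiv \<Omega> i (\<phi> n)"] wderiv_unique[OF wd[OF i] i fS],
        where c=1 and d="-1"]
    by (intro L2_snorm_cong_AE L2.diff_mem wderiv_L2 \<phi>S fS i g) simp
  have grad: "(\<lambda>n. grad.snorm (\<lambda>x. \<phi> n x - f x)) \<longlonglongrightarrow> 0"
  proof (rule Lim_null_comparison[OF always_eventually], rule allI)
    show "norm (grad.snorm (\<lambda>x. \<phi> n x - f x)) \<le> (\<Sum>i\<in>Basis. L2.snorm \<Omega> (\<lambda>x. wderiv \<Omega> i (\<phi> n) x - g i x))" for n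
    proof -
      have "grad.snorm (\<lambda>x. \<phi> n x - f x) \<le> (\<Sum>i\<in>Basis. L2.snorm \<Omega> (\<lambda>x. wderiv \<Omega> i (\<phi> n) x - wderiv \<Omega> i f x))"
        unfolding grad_snorm_diff[OF \<phi>S(1) fS] by (intro L2_set_le_sum L2.snorm_nonneg)
      then show ?thesis by (simp add: eq grad.snorm_nonneg)
    qed
    have "(\<lambda>n. \<Sum>i\<in>Basis. L2.snorm \<Omega> (\<lambda>x. wderiv \<Omega> i (\<phi> n) x - g i x)) \<longlonglongrightarrow> (\<Sum>i\<in>(Basis::'a set). 0)"
      by (intro tendsto_sum g)
    then show "(\<lambda>n. \<Sum>i\<in>Basis. L2.snorm \<Omega> (\<lambda>x. wderiv \<Omega> i (\<phi> n) x - g i x)) \<longlonglongrightarrow> 0" by simp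
  qed
  moreover have "f \<in> Sob1_0 \<Omega>"
    unfolding Sob1_0_def Sob1_norm_eq
    using fS \<phi> f(2) grad by (intro CollectI conjI exI[of _ \<phi>] allI) (auto simp: tendsto_H1_iff)
  ultimately show ?thesis using f(2) that by blast
qed


section \<open>The Poincare inequality and compactness\<close>

text \<open>Translating by a vector longer than the diameter of \<open>\<Omega>\<close> makes the supports disjoint.\<close>

lemma Poincare_test:
  obtains C where "0 < C" "\<And>\<phi>. \<phi> \<in> test_functions \<Omega> \<Longrightarrow> L2.snorm \<Omega> \<phi> \<le> C * grad.snorm \<phi>"
proof -
  obtain R where R: "0 < R" "\<And>x. x \<in> \<Omega> \<Longrightarrow> norm x \<le> R"
    using bounded_dom by (auto simp: bounded_pos)
  obtain i :: 'a where i: "i \<in> Basis" using nonempty_Basis by blast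
  \<comment> \<open>Two points of norm at most R differ by at most 2R, so a shift by 3R separates
    the supports. The cross terms vanish, twice the square norm appears on the left, and the factor
    2 is given away in the constant 3R.\<close>
  define z where "z = (3 * R) *\<^sub>R i"
  have nz: "norm z = 3 * R" using i R by (simp add: z_def)
  show thesis
  proof (rule that)
    fix \<phi> assume \<phi>: "\<phi> \<in> test_functions \<Omega>"
    note [measurable] = test_functions_borel[OF \<phi>]
    have disj: "\<phi> (z + x) = 0 \<or> \<phi> x = 0" for x
    proof (rule ccontr)
      assume "\<not> ?thesis"
      then have "norm (z + x) \<le> R" "norm x \<le> R" using R(2) test_functionsD(2)[OF \<phi>] by blast+
      then show False using norm_triangle_ineq4[of "z + x" x] nz R(1) by simp
    qed
    have sq: "integrable lborel (\<lambda>x. (\<phi> x)\<^sup>2)"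
      using test_functions_mult_integrable[OF \<phi> test_functions_continuous[OF \<phi>]]
      by (simp add: power2_eq_square)
    have I: "(\<integral>\<^sup>+x. ennreal ((\<phi> x)\<^sup>2) \<partial>lborel) = ennreal ((L2.snorm \<Omega> \<phi>)\<^sup>2)"
      unfolding test_functions_L2_snorm[OF \<phi>] by (intro nn_integral_eq_integral sq) auto
    have "ennreal ((L2.snorm \<Omega> \<phi>)\<^sup>2) + ennreal ((L2.snorm \<Omega> \<phi>)\<^sup>2)
      = (\<integral>\<^sup>+x. ennreal ((\<phi> (z + x))\<^sup>2) \<partial>lborel) + (\<integral>\<^sup>+x. ennreal ((\<phi> x)\<^sup>2) \<partial>lborel)"
      unfolding I[symmetric] by (simp add: nn_integral_lborel_translate[of "\<lambda>x. ennreal ((\<phi> x)\<^sup>2)"])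
    also have "\<dots> = (\<integral>\<^sup>+x. ennreal ((\<phi> (z + x))\<^sup>2) + ennreal ((\<phi> x)\<^sup>2) \<partial>lborel)"
      by (intro nn_integral_add[symmetric]) auto
    also have "\<dots> = (\<integral>\<^sup>+x. ennreal ((\<phi> (z + x) - \<phi> x)\<^sup>2) \<partial>lborel)"
    proof (intro nn_integral_cong)
      show "ennreal ((\<phi> (z + x))\<^sup>2) + ennreal ((\<phi> x)\<^sup>2) = ennreal ((\<phi> (z + x) - \<phi> x)\<^sup>2)" for x
        using disj[of x] by auto
    qed
    also have "\<dots> \<le> ennreal ((norm z)\<^sup>2) * (\<integral>\<^sup>+x. ennreal ((norm (classical_grad \<phi> x))\<^sup>2) \<partial>lborel)"
      by (rule translation_estimate[OF test_functionsD(1)[OF \<phi>]])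
    also have "(\<integral>\<^sup>+x. ennreal ((norm (classical_grad \<phi> x))\<^sup>2) \<partial>lborel) = ennreal ((grad.snorm \<phi>)\<^sup>2)"
      unfolding test_functions_grad_snorm[OF \<phi>]
      by (intro nn_integral_eq_integral test_functions_grad_snorm[OF \<phi>]) auto
    finally have "(L2.snorm \<Omega> \<phi>)\<^sup>2 + (L2.snorm \<Omega> \<phi>)\<^sup>2 \<le> (norm z)\<^sup>2 * (grad.snorm \<phi>)\<^sup>2"
      by (simp flip: ennreal_plus ennreal_mult)
    then have "(L2.snorm \<Omega> \<phi>)\<^sup>2 \<le> (3 * R * grad.snorm \<phi>)\<^sup>2"
      unfolding nz power_mult_distrib[symmetric] using zero_le_power2[of "L2.snorm \<Omega> \<phi>"] by linarith
    then show "L2.snorm \<Omega> \<phi> \<le> 3 * R * grad.snorm \<phi>"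
      by (rule power2_le_imp_le) (use R in \<open>simp add: grad.snorm_nonneg\<close>)
  qed (use R in simp)
qed

lemma Poincare:
  obtains C where "0 < C" "\<And>f. f \<in> Sob1_0 \<Omega> \<Longrightarrow> L2.snorm \<Omega> f \<le> C * grad.snorm f"
proof -
  obtain C where C: "0 < C" "\<And>\<phi>. \<phi> \<in> test_functions \<Omega> \<Longrightarrow> L2.snorm \<Omega> \<phi> \<le> C * grad.snorm \<phi>"
    by (rule Poincare_test) blast
  have "L2.snorm \<Omega> f \<le> C * grad.snorm f" if "f \<in> Sob1_0 \<Omega>" for f
  proof -
    obtain \<phi> :: "nat \<Rightarrow> 'a \<Rightarrow> real" where \<phi>: "\<And>n. \<phi> n \<in> test_functions \<Omega>"
      "(\<lambda>n. L2.snorm \<Omega> (\<phi> n)) \<longlonglongrightarrow> L2.snorm \<Omega> f" "(\<lambda>n. grad.snorm (\<phi> n)) \<longlonglongrightarrow> grad.snorm f"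
      by (rule Sob1_0_approx[OF \<open>f \<in> Sob1_0 \<Omega>\<close>]) blast
    show ?thesis
      by (rule LIMSEQ_le[OF \<phi>(2) tendsto_mult[OF tendsto_const \<phi>(3)]]) (use C(2) \<phi>(1) in auto)
  qed
  with C(1) that show thesis by blast
qed

end

section \<open>Cubes of side \<open>h\<close>, indexed by vectors of integer coordinates, and
  integrals over them\<close>

definition cell :: "real \<Rightarrow> 'a::euclidean_space \<Rightarrow> 'a" where
  "cell h x = (\<Sum>i\<in>Basis. real_of_int \<lfloor>x \<bullet> i / h\<rfloor> *\<^sub>R i)"

lemma cell_inner: "i \<in> Basis \<Longrightarrow> cell h x \<bullet> i = real_of_int \<lfloor>x \<bullet> i / h\<rfloor>"
  by (simp add: cell_def inner_sum_left_Basis)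

lemma cell_measurable [measurable]: "cell h \<in> borel_measurable borel"
  unfolding cell_def by measurable

lemma cell_eq_dist:
  fixes x y :: "'a::euclidean_space" and h :: real
  assumes "cell h x = cell h y" "0 < h"
  shows "norm (x - y) \<le> DIM('a) * h"
proof -
  have "\<bar>(x - y) \<bullet> i\<bar> \<le> h" if "i \<in> Basis" for i
  proof -
    have "\<lfloor>x \<bullet> i / h\<rfloor> = \<lfloor>y \<bullet> i / h\<rfloor>"
      using assms(1) cell_inner[OF that, of h] by (metis of_int_eq_iff)
    then have "\<bar>x \<bullet> i / h - y \<bullet> i / h\<bar> \<le> 1" by linarith
    then have "\<bar>(x \<bullet> i - y \<bullet> i) / h\<bar> \<le> 1" by (simp add: diff_divide_distrib)
    then show ?thesis using assms(2) by (simp add: abs_divide inner_diff_left)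
  qed
  then have "(\<Sum>i\<in>Basis. \<bar>(x - y) \<bullet> i\<bar>) \<le> (\<Sum>i\<in>(Basis::'a set). h)"
    by (intro sum_mono)
  with norm_le_l1[of "x - y"] show ?thesis by simp
qed

lemma emeasure_cell_ge:
  fixes x :: "'a::euclidean_space" and h :: real
  assumes "0 < h"
  shows "ennreal (h ^ DIM('a)) \<le> emeasure lborel {y. cell h y = cell h x}"
proof -
  let ?a = "h *\<^sub>R cell h x"
  have "box ?a (?a + h *\<^sub>R One) \<subseteq> {y. cell h y = cell h x}"
  proof safe
    fix y assume y: "y \<in> box ?a (?a + h *\<^sub>R One)"
    have "\<lfloor>y \<bullet> i / h\<rfloor> = \<lfloor>x \<bullet> i / h\<rfloor>" if i: "i \<in> Basis" for i
    proof -
      have "h * (cell h x \<bullet> i) < y \<bullet> i" "y \<bullet> i < h * (cell h x \<bullet> i) + h"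
        using y i by (auto simp: mem_box inner_add_left)
      then show ?thesis
        using assms by (intro floor_unique) (auto simp: cell_inner[OF i] field_simps)
    qed
    then show "cell h y = cell h x" by (simp add: cell_def)
  qed
  then have "emeasure lborel (box ?a (?a + h *\<^sub>R One)) \<le> emeasure lborel {y. cell h y = cell h x}"
    by (intro emeasure_mono) auto
  also have "emeasure lborel (box ?a (?a + h *\<^sub>R One)) = ennreal (h ^ DIM('a))"
    using assms by (subst emeasure_lborel_box) (auto simp: inner_add_left)
  finally show ?thesis .
qed

lemma finite_cell_image:
  fixes \<Omega> :: "'a::euclidean_space set"
  assumes "bounded \<Omega>" "0 < h"
  shows "finite (cell h ` \<Omega>)"
proof -
  obtain R where R: "\<And>x. x \<in> \<Omega> \<Longrightarrow> norm x \<le> R"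
    using assms(1) by (auto simp: bounded_iff)
  define Z where "Z = {\<lfloor>- R / h\<rfloor>..\<lfloor>R / h\<rfloor>}"
  have "cell h ` \<Omega> \<subseteq> (\<lambda>k. \<Sum>i\<in>Basis. real_of_int (k i) *\<^sub>R i) ` (Basis \<rightarrow>\<^sub>E Z)"
  proof safe
    fix x assume x: "x \<in> \<Omega>"
    have "\<lfloor>x \<bullet> i / h\<rfloor> \<in> Z" if "i \<in> Basis" for i
    proof -
      have "\<bar>x \<bullet> i\<bar> \<le> R" using Basis_le_norm[OF that, of x] R[OF x] by simp
      then have "- R / h \<le> x \<bullet> i / h" "x \<bullet> i / h \<le> R / h"
        using assms(2) by (auto simp: divide_right_mono simp del: divide_minus_left intro!: divide_right_mono)
      then show ?thesis unfolding Z_def by (auto intro: floor_mono)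
    qed
    then have "(\<lambda>i\<in>Basis. \<lfloor>x \<bullet> i / h\<rfloor>) \<in> Basis \<rightarrow>\<^sub>E Z" by auto
    moreover have "cell h x = (\<Sum>i\<in>Basis. real_of_int ((\<lambda>i\<in>Basis. \<lfloor>x \<bullet> i / h\<rfloor>) i) *\<^sub>R i)"
      by (simp add: cell_def)
    ultimately show "cell h x \<in> (\<lambda>k. \<Sum>i\<in>Basis. real_of_int (k i) *\<^sub>R i) ` (Basis \<rightarrow>\<^sub>E Z)"
      by blast
  qed
  moreover have "finite (Basis \<rightarrow>\<^sub>E Z :: ('a \<Rightarrow> int) set)"
    by (intro finite_PiE) (auto simp: Z_def)
  ultimately show ?thesis by (meson finite_imageI finite_subset)
qed

text \<open>Each pure square contributes the total mass times the second moment, the cross term the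
  square of the integral. The left side stays an extended integral because it is estimated
  afterwards by Tonelli.\<close>

lemma (in finite_measure) nn_integral_pairwise_difference:
  fixes f :: "'a \<Rightarrow> real"
  assumes f: "integrable M f" "integrable M (\<lambda>x. (f x)\<^sup>2)"
  shows "(\<integral>\<^sup>+x. (\<integral>\<^sup>+y. ennreal ((f y - f x)\<^sup>2) \<partial>M) \<partial>M) =
    ennreal (2 * measure M (space M) * (LINT x|M. (f x)\<^sup>2) - 2 * (LINT x|M. f x)\<^sup>2)"
proof -
  define A where "A = (LINT x|M. f x)"
  define S where "S = (LINT x|M. (f x)\<^sup>2)"
  define m where "m = measure M (space M)"
  have sq: "(f y - f x)\<^sup>2 = (f y)\<^sup>2 - 2 * f x * f y + (f x)\<^sup>2" for x y
    by (simp add: power2_eq_square algebra_simps)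
  have int: "integrable M (\<lambda>y. (f y - f x)\<^sup>2)" for x
    unfolding sq using f by simp
  have inner: "(LINT y|M. (f y - f x)\<^sup>2) = S - 2 * A * f x + m * (f x)\<^sup>2" for x
    unfolding sq using f by (simp add: A_def S_def m_def mult_ac)
  have nonneg: "0 \<le> S - 2 * A * f x + m * (f x)\<^sup>2" for x
    unfolding inner[symmetric] by simp
  have "(\<integral>\<^sup>+x. (\<integral>\<^sup>+y. ennreal ((f y - f x)\<^sup>2) \<partial>M) \<partial>M) = (\<integral>\<^sup>+x. ennreal (S - 2 * A * f x + m * (f x)\<^sup>2) \<partial>M)"
    by (simp add: nn_integral_eq_integral[OF int] inner)
  also have "\<dots> = ennreal (LINT x|M. S - 2 * A * f x + m * (f x)\<^sup>2)"
    by (rule nn_integral_eq_integral) (use f nonneg in auto)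
  also have "(LINT x|M. S - 2 * A * f x + m * (f x)\<^sup>2) = 2 * m * S - 2 * A\<^sup>2"
    using f by (simp add: A_def[symmetric] S_def[symmetric] m_def[symmetric])
      (simp add: power2_eq_square)
  finally show ?thesis by (simp add: A_def S_def m_def)
qed

lemma emeasure_cball_le:
  assumes "0 \<le> r"
  shows "emeasure lborel (cball (0::'a::euclidean_space) r) \<le> ennreal ((2 * r) ^ DIM('a))"
proof -
  have "cball (0::'a) r \<subseteq> cbox (- r *\<^sub>R One) (r *\<^sub>R One)"
    by (auto simp: mem_box) (meson Basis_le_norm abs_le_D1 abs_le_D2 minus_le_iff order_trans)+
  then have "emeasure lborel (cball (0::'a) r) \<le> emeasure lborel (cbox (- r *\<^sub>R One) (r *\<^sub>R One :: 'a))"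
    by (intro emeasure_mono) auto
  also have "\<dots> = ennreal ((2 * r) ^ DIM('a))"
    using assms by (subst emeasure_lborel_cbox) (auto simp: inner_diff_left algebra_simps)
  finally show ?thesis .
qed

text \<open>On each cell \<open>Q\<close> of side \<open>h\<close> one has
  \<open>2 |Q| \<integral>\<^sub>Q f\<^sup>2 = \<integral>\<^sub>Q \<integral>\<^sub>Q (f y - f x)\<^sup>2 + 2 (\<integral>\<^sub>Q f)\<^sup>2\<close>, and the double integrals are
  controlled by translations of length at most \<open>DIM('a) * h\<close>.\<close>

context bounded_open_set
begin

lemma cell_inequality:
  fixes h :: real
  assumes \<phi>: "\<phi> \<in> test_functions \<Omega>" and h: "0 < h"
  shows "(L2.snorm \<Omega> \<phi>)\<^sup>2 \<le> (real DIM('a))\<^sup>2 * (2 * real DIM('a)) ^ DIM('a) * h\<^sup>2 * (grad.snorm \<phi>)\<^sup>2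
    + (\<Sum>k\<in>cell h ` \<Omega>. (LINT x|lborel. indicator {x. cell h x = k} x * \<phi> x)\<^sup>2) / h ^ DIM('a)"
proof -
  define K where "K = cell h ` \<Omega>"
  define Q where "Q k = {x::'a. cell h x = k}" for k
  define d where "d = DIM('a) * h"
  define D where "D k = (\<integral>\<^sup>+x. (\<integral>\<^sup>+y. ennreal ((\<phi> y - \<phi> x)\<^sup>2) * indicator (Q k) y \<partial>lborel) * indicator (Q k) x \<partial>lborel)" for k
  define A where "A k = (LINT x|lborel. indicator (Q k) x * \<phi> x)" for k
  define S where "S k = (LINT x|lborel. indicator (Q k) x * (\<phi> x)\<^sup>2)" for k
  define G where "G = (grad.snorm \<phi>)\<^sup>2"
  have d: "0 \<le> d" using h by (simp add: d_def)
  have fin: "finite K" unfolding K_def by (rule finite_cell_image[OF bounded_dom h])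
  note [measurable] = test_functions_borel[OF \<phi>]
  have Qm [measurable]: "Q k \<in> sets borel" for k
    unfolding Q_def by measurable
  have [measurable]: "cball (0::'a) d \<in> sets borel" by simp
  have int: "integrable lborel \<phi>" "integrable lborel (\<lambda>x. (\<phi> x)\<^sup>2)"
    using test_functions_integrable[OF \<phi>] test_functions_mult_integrable[OF \<phi> test_functions_continuous[OF \<phi>]]
    by (simp_all add: power2_eq_square)
  have intQ: "integrable lborel (\<lambda>x. indicator (Q k) x * \<phi> x)"
    "integrable lborel (\<lambda>x. indicator (Q k) x * (\<phi> x)\<^sup>2)" for k
    using integrable_mult_indicator[of "Q k" lborel, OF _ int(1)]
      integrable_mult_indicator[of "Q k" lborel, OF _ int(2)] by simp_all
  have G: "(\<integral>\<^sup>+x. ennreal ((norm (classical_grad \<phi> x))\<^sup>2) \<partial>lborel) = ennreal G"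
    unfolding G_def test_functions_grad_snorm[OF \<phi>]
    by (intro nn_integral_eq_integral test_functions_grad_snorm[OF \<phi>]) auto
  \<comment> \<open>For fixed \<open>x\<close> only the cube of \<open>x\<close> can contribute, and
    two points of one cube differ by a vector of norm at most \<open>d\<close>; so the sum of the
    double integrals over cubes is one double integral over short differences.\<close>
  have "(\<Sum>k\<in>K. D k) = (\<integral>\<^sup>+x. (\<integral>\<^sup>+y. (\<Sum>k\<in>K. ennreal ((\<phi> y - \<phi> x)\<^sup>2) * indicator (Q k) y * indicator (Q k) x) \<partial>lborel) \<partial>lborel)"
    by (simp add: D_def nn_integral_sum nn_integral_multc)
  also have "\<dots> \<le> (\<integral>\<^sup>+x. (\<integral>\<^sup>+y. ennreal ((\<phi> y - \<phi> x)\<^sup>2) * indicator (cball 0 d) (y - x) \<partial>lborel) \<partial>lborel)"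
  proof (intro nn_integral_mono)
    fix x y
    have eq: "ennreal ((\<phi> y - \<phi> x)\<^sup>2) * indicator (Q k) y * indicator (Q k) x
        = (if k = cell h x then ennreal ((\<phi> y - \<phi> x)\<^sup>2) * indicator (Q (cell h x)) y else 0)" for k
      by (auto simp: Q_def indicator_def)
    have "indicator (Q (cell h x)) y \<le> (indicator (cball 0 d) (y - x) :: ennreal)"
      using cell_eq_dist[OF _ h, of y x] by (auto simp: Q_def indicator_def d_def)
    then show "(\<Sum>k\<in>K. ennreal ((\<phi> y - \<phi> x)\<^sup>2) * indicator (Q k) y * indicator (Q k) x)
        \<le> ennreal ((\<phi> y - \<phi> x)\<^sup>2) * indicator (cball 0 d) (y - x)"
      unfolding eq using fin by (simp add: sum.delta mult_left_mono)
  qed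
  also have "\<dots> = (\<integral>\<^sup>+x. (\<integral>\<^sup>+z. ennreal ((\<phi> (z + x) - \<phi> x)\<^sup>2) * indicator (cball 0 d) z \<partial>lborel) \<partial>lborel)"
  proof (rule nn_integral_cong)
    fix x
    show "(\<integral>\<^sup>+y. ennreal ((\<phi> y - \<phi> x)\<^sup>2) * indicator (cball 0 d) (y - x) \<partial>lborel)
      = (\<integral>\<^sup>+z. ennreal ((\<phi> (z + x) - \<phi> x)\<^sup>2) * indicator (cball 0 d) z \<partial>lborel)"
      using nn_integral_lborel_translate[of "\<lambda>y. ennreal ((\<phi> y - \<phi> x)\<^sup>2) * indicator (cball 0 d) (y - x)" x]
      by (simp add: add.commute)
  qed
  also have "\<dots> = (\<integral>\<^sup>+z. (\<integral>\<^sup>+x. ennreal ((\<phi> (z + x) - \<phi> x)\<^sup>2) * indicator (cball 0 d) z \<partial>lborel) \<partial>lborel)"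
    by (rule lborel_pair.Fubini') measurable
  \<comment> \<open>After the substitution y = z + x and Tonelli, the inner integral is the
    translation estimate for a fixed short vector \<open>z\<close>.\<close>
  also have "\<dots> \<le> (\<integral>\<^sup>+z. ennreal (d\<^sup>2 * G) * indicator (cball (0::'a) d) z \<partial>lborel)"
  proof (intro nn_integral_mono)
    fix z :: 'a
    show "(\<integral>\<^sup>+x. ennreal ((\<phi> (z + x) - \<phi> x)\<^sup>2) * indicator (cball 0 d) z \<partial>lborel) \<le> ennreal (d\<^sup>2 * G) * indicator (cball 0 d) z"
    proof (cases "z \<in> cball 0 d")
      case True
      have "(\<integral>\<^sup>+x. ennreal ((\<phi> (z + x) - \<phi> x)\<^sup>2) \<partial>lborel) \<le> ennreal ((norm z)\<^sup>2) * ennreal G"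
        using translation_estimate[OF test_functionsD(1)[OF \<phi>], of z] by (simp add: G)
      also have "\<dots> \<le> ennreal (d\<^sup>2 * G)"
        using True by (auto simp: G_def simp flip: ennreal_mult intro!: ennreal_leI mult_right_mono power_mono)
      finally show ?thesis using True by simp
    qed simp
  qed
  also have "\<dots> = ennreal (d\<^sup>2 * G) * emeasure lborel (cball (0::'a) d)"
    by (simp add: nn_integral_cmult)
  also have "\<dots> \<le> ennreal (d\<^sup>2 * G) * ennreal ((2 * d) ^ DIM('a))"
    by (intro mult_left_mono emeasure_cball_le d) auto
  also have "\<dots> = ennreal (d\<^sup>2 * G * (2 * d) ^ DIM('a))"
    using d by (simp add: G_def flip: ennreal_mult)
  finally have sumD: "(\<Sum>k\<in>K. D k) \<le> ennreal (d\<^sup>2 * G * (2 * d) ^ DIM('a))" .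
  have "\<exists>D'. D k = ennreal D' \<and> 0 \<le> D' \<and> h ^ DIM('a) * S k \<le> D' / 2 + (A k)\<^sup>2" if k: "k \<in> K" for k
  proof -
    obtain x where x: "x \<in> \<Omega>" "k = cell h x" using k by (auto simp: K_def)
    let ?N = "restrict_space lborel (Q k)"
    have "Q k \<subseteq> cball x d"
      using cell_eq_dist[OF _ h, of _ x] x by (auto simp: Q_def d_def dist_norm norm_minus_commute)
    then have "emeasure lborel (Q k) \<le> emeasure lborel (cball x d)"
      by (intro emeasure_mono) auto
    then have fm: "emeasure lborel (Q k) < \<infinity>"
      using emeasure_lborel_cball_finite[of x d] by (rule le_less_trans)
    interpret N: finite_measure ?N
      using fm by (intro finite_measureI) (simp add: emeasure_restrict_space space_restrict_space)
    define m where "m = measure lborel (Q k)"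
    have mN: "measure ?N (space ?N) = m"
      by (simp add: m_def measure_restrict_space space_restrict_space)
    have "ennreal (h ^ DIM('a)) \<le> ennreal m"
      using emeasure_cell_ge[OF h, of x] fm by (simp add: m_def x Q_def emeasure_eq_ennreal_measure)
    then have m: "h ^ DIM('a) \<le> m" by (subst (asm) ennreal_le_iff) (auto simp: m_def)
    have iN: "integrable ?N \<phi>" "integrable ?N (\<lambda>x. (\<phi> x)\<^sup>2)"
      using intQ by (simp_all add: integrable_restrict_space)
    have "D k = (\<integral>\<^sup>+x. (\<integral>\<^sup>+y. ennreal ((\<phi> y - \<phi> x)\<^sup>2) \<partial>?N) \<partial>?N)"
      by (simp add: D_def nn_integral_restrict_space)
    also have "\<dots> = ennreal (2 * m * S k - 2 * (A k)\<^sup>2)"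
      using N.nn_integral_pairwise_difference[OF iN, unfolded mN]
      by (simp add: S_def A_def integral_restrict_space)
    \<comment> \<open>\<open>ennreal\<close> truncates negative numbers to 0; the maximum records
      this and spares a separate proof of nonnegativity.\<close>
    finally have Dk: "D k = ennreal (max 0 (2 * m * S k - 2 * (A k)\<^sup>2))" by (simp add: ennreal_max_0)
    have "h ^ DIM('a) * S k \<le> m * S k"
      using m by (intro mult_right_mono) (auto simp: S_def)
    moreover have "a \<le> b \<Longrightarrow> a \<le> max 0 (2 * b - 2 * c) / 2 + c" for a b c :: real
      by (simp add: max_def field_simps)
    ultimately have "h ^ DIM('a) * S k \<le> max 0 (2 * (m * S k) - 2 * (A k)\<^sup>2) / 2 + (A k)\<^sup>2"
      by blast
    with Dk show ?thesis by (intro exI[of _ "max 0 (2 * m * S k - 2 * (A k)\<^sup>2)"]) (auto simp: mult.assoc)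
  qed
  then obtain D' where D': "\<And>k. k \<in> K \<Longrightarrow> D k = ennreal (D' k)" "\<And>k. k \<in> K \<Longrightarrow> 0 \<le> D' k"
    "\<And>k. k \<in> K \<Longrightarrow> h ^ DIM('a) * S k \<le> D' k / 2 + (A k)\<^sup>2" by metis
  have "ennreal (\<Sum>k\<in>K. D' k) = (\<Sum>k\<in>K. D k)"
    using D' by (simp add: sum_ennreal)
  with sumD have "ennreal (\<Sum>k\<in>K. D' k) \<le> ennreal (d\<^sup>2 * G * (2 * d) ^ DIM('a))" by simp
  then have sumD': "(\<Sum>k\<in>K. D' k) \<le> d\<^sup>2 * G * (2 * d) ^ DIM('a)"
    using d by (subst (asm) ennreal_le_iff) (auto simp: G_def)
  have "(L2.snorm \<Omega> \<phi>)\<^sup>2 = (LINT x|lborel. (\<Sum>k\<in>K. indicator (Q k) x * (\<phi> x)\<^sup>2))"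
    unfolding test_functions_L2_snorm[OF \<phi>]
  proof (intro Bochner_Integration.integral_cong refl)
    fix x
    show "(\<phi> x)\<^sup>2 = (\<Sum>k\<in>K. indicator (Q k) x * (\<phi> x)\<^sup>2)"
    proof (cases "x \<in> \<Omega>")
      case True
      have eq: "indicator (Q k) x * (\<phi> x)\<^sup>2 = (if k = cell h x then (\<phi> x)\<^sup>2 else 0)" for k
        by (auto simp: Q_def indicator_def)
      show ?thesis unfolding eq using fin True by (simp add: K_def)
    next
      case False
      then show ?thesis using test_functionsD(2)[OF \<phi>] by simp
    qed
  qed
  also have "\<dots> = (\<Sum>k\<in>K. S k)"
    unfolding S_def by (intro Bochner_Integration.integral_sum intQ)
  finally have "h ^ DIM('a) * (L2.snorm \<Omega> \<phi>)\<^sup>2 = (\<Sum>k\<in>K. h ^ DIM('a) * S k)"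
    by (simp add: sum_distrib_left)
  also have "\<dots> \<le> (\<Sum>k\<in>K. D' k / 2 + (A k)\<^sup>2)"
    by (intro sum_mono D')
  also have "\<dots> = (\<Sum>k\<in>K. D' k) / 2 + (\<Sum>k\<in>K. (A k)\<^sup>2)"
    by (simp add: sum.distrib sum_divide_distrib)
  also have "\<dots> \<le> d\<^sup>2 * G * (2 * d) ^ DIM('a) + (\<Sum>k\<in>K. (A k)\<^sup>2)"
    using sumD' d sum_nonneg[of K D'] D'(2) by simp
  \<comment> \<open>The ball of radius \<open>d\<close> has volume of the order of one cube.
    Dividing by the latter leaves the factor \<open>h\<^sup>2\<close> that makes the gradient term
    small on fine grids.\<close>
  also have "d\<^sup>2 * G * (2 * d) ^ DIM('a) = h ^ DIM('a) * ((real DIM('a))\<^sup>2 * (2 * real DIM('a)) ^ DIM('a) * h\<^sup>2 * G)"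
    by (simp add: d_def power_mult_distrib)
  finally have "(L2.snorm \<Omega> \<phi>)\<^sup>2 \<le> (h ^ DIM('a) * ((real DIM('a))\<^sup>2 * (2 * real DIM('a)) ^ DIM('a) * h\<^sup>2 * G) + (\<Sum>k\<in>K. (A k)\<^sup>2)) / h ^ DIM('a)"
    using h by (simp add: pos_le_divide_eq mult.commute)
  then show ?thesis using h by (simp add: add_divide_distrib K_def A_def Q_def G_def)
qed

text \<open>On a fixed grid there are finitely many cubes, and the integrals over them converge
  along a subsequence; a diagonal choice serves all grids. \<open>cell_inequality\<close> bounds
  differences by a term that is small on a fine grid plus differences of these integrals.\<close>

lemma Rellich:
  fixes \<phi> :: "nat \<Rightarrow> 'a \<Rightarrow> real"
  assumes \<phi>: "\<And>n. \<phi> n \<in> test_functions \<Omega>"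
    and B: "\<And>n. L2.snorm \<Omega> (\<phi> n) \<le> B" "\<And>n. grad.snorm (\<phi> n) \<le> B"
  obtains r :: "nat \<Rightarrow> nat" where "strict_mono r"
    "\<And>e. 0 < e \<Longrightarrow> \<exists>N. \<forall>m\<ge>N. \<forall>n\<ge>N. L2.snorm \<Omega> (\<lambda>x. \<phi> (r m) x - \<phi> (r n) x) < e"
proof -
  define h where "h m = 1 / real (Suc m)" for m
  have h: "0 < h m" for m by (simp add: h_def)
  \<comment> \<open>Indexing by pairs of a grid and a cube makes one diagonal extraction over the
    countable set \<open>S\<close> enough.\<close>
  define A where "A = (\<lambda>n (m, k). LINT x|lborel. indicator {x. cell (h m) x = k} x * \<phi> n x)"
  define S where "S = (SIGMA m:UNIV. cell (h m) ` \<Omega>)"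
  have \<phi>S: "\<phi> n \<in> Sob1 \<Omega>" "\<phi> n \<in> L2 \<Omega>" for n
    by (auto intro: test_functions_Sob1 Sob1_L2 \<phi>)
  have int: "integrable lborel (\<lambda>x. indicator {x. cell (h m) x = k} x * \<phi> n x)" for m n and k :: 'a
    using integrable_mult_indicator[of "{x. cell (h m) x = k}" lborel, OF _ test_functions_integrable[OF \<phi>[of n]]]
    by simp
  have "norm (A n s) \<le> B * L2.snorm \<Omega> (\<lambda>x. 1)" for n s
  proof -
    obtain m k where s: "s = (m, k)" by fastforce
    have "norm (A n s) \<le> (LINT x|lborel. norm (indicator {x. cell (h m) x = k} x * \<phi> n x))"
      unfolding A_def s prod.case by (rule integral_norm_bound)
    also have "\<dots> \<le> (LINT x|lborel. \<bar>\<phi> n x\<bar>)"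
      using int[of m k n] test_functions_integrable[OF \<phi>[of n]]
      by (intro integral_mono integrable_norm) (auto simp: indicator_def)
    also have "\<dots> = (LINT x|lebesgue_on \<Omega>. \<bar>\<phi> n x\<bar>)"
      using test_functions_borel[OF \<phi>] test_functionsD(2)[OF \<phi>] dom_measurable
      by (intro integral_lebesgue_on_eq_lborel(1)[symmetric]) auto
    also have "\<dots> \<le> L2.snorm \<Omega> (\<phi> n) * L2.snorm \<Omega> (\<lambda>x. 1)"
      by (rule L1_le_L2(2)[OF \<phi>S(2) one_L2])
    also have "\<dots> \<le> B * L2.snorm \<Omega> (\<lambda>x. 1)"
      by (intro mult_right_mono B L2.snorm_nonneg)
    finally show ?thesis .
  qed
  moreover have "countable S"
    unfolding S_def using finite_cell_image[OF bounded_dom h]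
    by (intro countable_SIGMA) (auto intro: countable_finite)
  ultimately obtain r where r: "strict_mono r" "\<And>s. s \<in> S \<Longrightarrow> \<exists>l. (\<lambda>n. A (r n) s) \<longlonglongrightarrow> l"
    using function_convergent_subsequence[of S A] by blast
  show thesis
  proof (rule that[OF r(1)])
    fix e :: real assume e: "0 < e"
    \<comment> \<open>\<open>C * (h m)\<^sup>2\<close> bounds the gradient term of
      \<open>cell_inequality\<close> for any difference of two members, whose gradient norm is at
      most 2B.\<close>
    define C where "C = (real DIM('a))\<^sup>2 * (2 * real DIM('a)) ^ DIM('a) * (2 * B)\<^sup>2"
    have "(\<lambda>m. C * (h m)\<^sup>2) \<longlonglongrightarrow> C * 0\<^sup>2"
      unfolding h_def by (intro tendsto_intros LIMSEQ_Suc[OF lim_1_over_n])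
    then have "\<forall>\<^sub>F m in sequentially. C * (h m)\<^sup>2 < e\<^sup>2 / 2"
      by (rule order_tendstoD(2)) (use e in auto)
    then obtain m where m: "C * (h m)\<^sup>2 < e\<^sup>2 / 2"
      using eventually_happens'[OF sequentially_bot] by blast
    let ?K = "cell (h m) ` \<Omega>"
    \<comment> \<open>The product filter lets both indices of the Cauchy condition tend to infinity
      independently.\<close>
    let ?F = "sequentially \<times>\<^sub>F sequentially"
    have "((\<lambda>p. (\<Sum>k\<in>?K. (A (r (fst p)) (m, k) - A (r (snd p)) (m, k))\<^sup>2) / h m ^ DIM('a)) \<longlongrightarrow>
        (\<Sum>k\<in>?K. 0) / h m ^ DIM('a)) ?F"
    proof (intro tendsto_divide tendsto_sum tendsto_const)
      fix k assume "k \<in> ?K"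
      then have "(m, k) \<in> S" by (auto simp: S_def)
      then obtain l where l: "(\<lambda>n. A (r n) (m, k)) \<longlonglongrightarrow> l" using r(2) by blast
      have "((\<lambda>p. (A (r (fst p)) (m, k) - A (r (snd p)) (m, k))\<^sup>2) \<longlongrightarrow> (l - l)\<^sup>2) ?F"
        by (intro tendsto_intros filterlim_compose[OF l filterlim_fst] filterlim_compose[OF l filterlim_snd])
      then show "((\<lambda>p. (A (r (fst p)) (m, k) - A (r (snd p)) (m, k))\<^sup>2) \<longlongrightarrow> 0) ?F" by simp
    qed (use h[of m] in auto)
    then have "((\<lambda>p. (\<Sum>k\<in>?K. (A (r (fst p)) (m, k) - A (r (snd p)) (m, k))\<^sup>2) / h m ^ DIM('a)) \<longlongrightarrow> 0) ?F"
      by simp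
    then have "\<forall>\<^sub>F p in ?F. (\<Sum>k\<in>?K. (A (r (fst p)) (m, k) - A (r (snd p)) (m, k))\<^sup>2) / h m ^ DIM('a) < e\<^sup>2 / 2"
      by (rule order_tendstoD(2)) (use e in auto)
    then obtain N where N: "\<And>i j. i \<ge> N \<Longrightarrow> j \<ge> N \<Longrightarrow>
        (\<Sum>k\<in>?K. (A (r i) (m, k) - A (r j) (m, k))\<^sup>2) / h m ^ DIM('a) < e\<^sup>2 / 2"
      by (auto simp: eventually_prod_sequentially)
    have "L2.snorm \<Omega> (\<lambda>x. \<phi> (r i) x - \<phi> (r j) x) < e" if ij: "i \<ge> N" "j \<ge> N" for i j
    proof -
      let ?d = "\<lambda>x. \<phi> (r i) x - \<phi> (r j) x"
      have d: "?d \<in> test_functions \<Omega>"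
        using test_functions_add[OF \<phi>[of "r i"] test_functions_scale[OF \<phi>[of "r j"], of "-1"]] by simp
      have eqA: "(LINT x|lborel. indicator {x. cell (h m) x = k} x * ?d x) = A (r i) (m, k) - A (r j) (m, k)" for k
        unfolding A_def prod.case right_diff_distrib by (rule Bochner_Integration.integral_diff[OF int int])
      have "grad.snorm ?d \<le> 2 * B"
        using grad.snorm_diff_le[OF \<phi>S(1)[of "r i"] \<phi>S(1)[of "r j"]] B(2)[of "r i"] B(2)[of "r j"] by linarith
      then have "(grad.snorm ?d)\<^sup>2 \<le> (2 * B)\<^sup>2"
        by (intro power_mono grad.snorm_nonneg)
      then have "(real DIM('a))\<^sup>2 * (2 * real DIM('a)) ^ DIM('a) * (h m)\<^sup>2 * (grad.snorm ?d)\<^sup>2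
          \<le> (real DIM('a))\<^sup>2 * (2 * real DIM('a)) ^ DIM('a) * (h m)\<^sup>2 * (2 * B)\<^sup>2"
        by (intro mult_left_mono) auto
      also have "\<dots> = C * (h m)\<^sup>2" by (simp add: C_def mult_ac)
      finally have 1: "(real DIM('a))\<^sup>2 * (2 * real DIM('a)) ^ DIM('a) * (h m)\<^sup>2 * (grad.snorm ?d)\<^sup>2 < e\<^sup>2 / 2"
        using m by linarith
      have "(L2.snorm \<Omega> ?d)\<^sup>2 < e\<^sup>2"
        using cell_inequality[OF d h[of m]] 1 N[OF ij] unfolding eqA by linarith
      then show ?thesis using e by (intro power_less_imp_less_base[of _ 2 e]) auto
    qed
    then show "\<exists>N. \<forall>i\<ge>N. \<forall>j\<ge>N. L2.snorm \<Omega> (\<lambda>x. \<phi> (r i) x - \<phi> (r j) x) < e" by blast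
  qed
qed


section \<open>The principal eigenvalue\<close>

text \<open>A minimising sequence of the Rayleigh quotient is precompact in \<open>L\<^sup>2\<close>, and then by the
  parallelogram identity Cauchy in \<open>H\<^sup>1\<close>.\<close>

lemma Rayleigh_minimizer:
  assumes ne: "\<Omega> \<noteq> {}"
  obtains f \<mu> where "f \<in> Sob1_0 \<Omega>" "L2.snorm \<Omega> f = 1" "(grad.snorm f)\<^sup>2 = \<mu>"
    "\<And>g. g \<in> Sob1_0 \<Omega> \<Longrightarrow> \<mu> * (L2.snorm \<Omega> g)\<^sup>2 \<le> (grad.snorm g)\<^sup>2"
proof -
  \<comment> \<open>Minimising over test functions lets \<open>Rellich\<close> and
    \<open>Sob1_0_complete\<close> apply directly; density carries the inequality to H_0^1 at the
    end.\<close>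
  define X where "X = {(grad.snorm \<phi>)\<^sup>2 | \<phi>. \<phi> \<in> test_functions \<Omega> \<and> L2.snorm \<Omega> \<phi> = 1}"
  define \<mu> where "\<mu> = Inf X"
  have bdd: "bdd_below X" unfolding X_def by (rule bdd_belowI[of _ 0]) auto
  have norm1: "\<mu> \<le> (grad.snorm \<phi>)\<^sup>2" if "\<phi> \<in> test_functions \<Omega>" "L2.snorm \<Omega> \<phi> = 1" for \<phi>
    unfolding \<mu>_def using bdd that by (intro cInf_lower) (auto simp: X_def)
  have scaled: "(\<lambda>x. (1 / L2.snorm \<Omega> \<phi>) * \<phi> x) \<in> test_functions \<Omega>"
    "L2.snorm \<Omega> (\<lambda>x. (1 / L2.snorm \<Omega> \<phi>) * \<phi> x) = 1"
    if "\<phi> \<in> test_functions \<Omega>" "L2.snorm \<Omega> \<phi> \<noteq> 0" for \<phi>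
    using that L2.snorm_nonneg[of \<Omega> \<phi>] test_functions_L2[OF that(1) dom_measurable]
    by (simp_all only: test_functions_scale L2.snorm_scale) simp
  have test: "\<mu> * (L2.snorm \<Omega> \<phi>)\<^sup>2 \<le> (grad.snorm \<phi>)\<^sup>2" if \<phi>: "\<phi> \<in> test_functions \<Omega>" for \<phi>
  proof (cases "L2.snorm \<Omega> \<phi> = 0")
    case False
    then show ?thesis
      using norm1[OF scaled[OF \<phi> False]] L2.snorm_nonneg[of \<Omega> \<phi>]
      unfolding grad.snorm_scale[OF test_functions_Sob1[OF \<phi>]]
      by (simp add: power_mult_distrib power_divide field_simps)
  qed simp
  have "X \<noteq> {}"
  proof -
    obtain p where p: "p \<in> \<Omega>" using ne by blast
    then obtain r where r: "0 < r" "cball p r \<subseteq> \<Omega>" using open_dom open_contains_cball by blast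
    obtain \<phi> where \<phi>: "\<phi> \<in> test_functions \<Omega>" "\<And>x. x \<in> ball p r \<Longrightarrow> 0 < \<phi> x"
      using test_functions_bump[OF r(2,1)] by blast
    have "L2.snorm \<Omega> \<phi> \<noteq> 0"
    proof
      assume "L2.snorm \<Omega> \<phi> = 0"
      then have "(LINT x|lborel. (\<phi> x)\<^sup>2) = 0" using test_functions_L2_snorm[OF \<phi>(1)] by simp
      moreover have "integrable lborel (\<lambda>x. (\<phi> x)\<^sup>2)"
        using test_functions_mult_integrable[OF \<phi>(1) test_functions_continuous[OF \<phi>(1)]]
        by (simp add: power2_eq_square)
      ultimately have "AE x in lborel. (\<phi> x)\<^sup>2 = 0"
        by (subst (asm) integral_nonneg_eq_0_iff_AE) auto
      then have "AE x in lborel. x \<notin> ball p r"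
        by eventually_elim (use \<phi>(2) in force)
      then have "emeasure lborel (ball p r) = 0"
        by (subst (asm) AE_iff_measurable[of "ball p r"]) auto
      moreover have "\<not> negligible (ball p r)" using r by (intro open_not_negligible) auto
      ultimately show False by (simp add: negligible_iff_emeasure0)
    qed
    with scaled[OF \<phi>(1)] show ?thesis by (auto simp: X_def)
  qed
  have "\<exists>\<phi>. \<phi> \<in> test_functions \<Omega> \<and> L2.snorm \<Omega> \<phi> = 1 \<and> (grad.snorm \<phi>)\<^sup>2 < \<mu> + 1 / real (Suc n)" for n
  proof -
    have "Inf X < \<mu> + 1 / real (Suc n)" by (simp add: \<mu>_def)
    then show ?thesis using cInf_lessD[OF \<open>X \<noteq> {}\<close>] by (auto simp: X_def)
  qed
  then obtain \<phi> where \<phi>: "\<And>n. \<phi> n \<in> test_functions \<Omega>" "\<And>n. L2.snorm \<Omega> (\<phi> n) = 1"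
    "\<And>n. (grad.snorm (\<phi> n))\<^sup>2 < \<mu> + 1 / real (Suc n)" by metis
  have \<mu>: "0 \<le> \<mu>" unfolding \<mu>_def using \<open>X \<noteq> {}\<close> by (intro cInf_greatest) (auto simp: X_def)
  have "grad.snorm (\<phi> n) \<le> \<mu> + 2" for n
  proof (rule power2_le_imp_le)
    have "(grad.snorm (\<phi> n))\<^sup>2 \<le> \<mu> + 1"
      using \<phi>(3)[of n] by (smt (verit) le_divide_eq_1_pos of_nat_0_less_iff of_nat_Suc of_nat_0_le_iff zero_less_Suc divide_le_eq_1_pos)
    also have "\<dots> \<le> (\<mu> + 2)\<^sup>2" using \<mu> by (simp add: power2_eq_square algebra_simps)
    finally show "(grad.snorm (\<phi> n))\<^sup>2 \<le> (\<mu> + 2)\<^sup>2" .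
  qed (use \<mu> in simp)
  then obtain r :: "nat \<Rightarrow> nat" where r: "strict_mono r"
    "\<And>e. 0 < e \<Longrightarrow> \<exists>N. \<forall>m\<ge>N. \<forall>n\<ge>N. L2.snorm \<Omega> (\<lambda>x. \<phi> (r m) x - \<phi> (r n) x) < e"
    using Rellich[of \<phi> "\<mu> + 2"] \<phi> \<mu> by auto
  define w where "w n = \<phi> (r n)" for n
  have w: "w n \<in> test_functions \<Omega>" "L2.snorm \<Omega> (w n) = 1" for n
    using \<phi> by (auto simp: w_def)
  have wS: "w n \<in> Sob1 \<Omega>" "w n \<in> L2 \<Omega>" for n
    by (auto intro: test_functions_Sob1 Sob1_L2 w)
  have wlt: "(grad.snorm (w n))\<^sup>2 < \<mu> + 1 / real (Suc n)" for n
  proof -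
    have "1 / real (Suc (r n)) \<le> 1 / real (Suc n)"
      using seq_suble[OF r(1), of n] by (intro divide_left_mono) auto
    then show ?thesis using \<phi>(3)[of "r n"] by (simp add: w_def)
  qed
  \<comment> \<open>The sum \<open>w m + w n\<close> is again a test function, so its Dirichlet norm
    squared is at least \<open>\<mu>\<close> times 4 minus the squared L^2 distance. The terms
    \<open>4 * \<mu>\<close> then cancel against the two almost minimal energies.\<close>
  have par: "(grad.snorm (\<lambda>x. w m x - w n x))\<^sup>2 \<le>
      2 / real (Suc m) + 2 / real (Suc n) + \<mu> * (L2.snorm \<Omega> (\<lambda>x. w m x - w n x))\<^sup>2" for m n
  proof -
    have "(grad.snorm (\<lambda>x. w m x - w n x))\<^sup>2 + (grad.snorm (\<lambda>x. w m x + w n x))\<^sup>2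
        = 2 * (grad.snorm (w m))\<^sup>2 + 2 * (grad.snorm (w n))\<^sup>2"
      using grad.expand[OF wS(1)[of m] wS(1)[of n], of 1 "-1"] grad.expand[OF wS(1)[of m] wS(1)[of n], of 1 1]
      by (simp add: grad.snorm_sq)
    moreover have "(L2.snorm \<Omega> (\<lambda>x. w m x - w n x))\<^sup>2 + (L2.snorm \<Omega> (\<lambda>x. w m x + w n x))\<^sup>2
        = 2 * (L2.snorm \<Omega> (w m))\<^sup>2 + 2 * (L2.snorm \<Omega> (w n))\<^sup>2"
      using L2.expand[OF wS(2)[of m] wS(2)[of n], of 1 "-1"] L2.expand[OF wS(2)[of m] wS(2)[of n], of 1 1]
      by (simp add: L2.snorm_sq)
    then have "\<mu> * (L2.snorm \<Omega> (\<lambda>x. w m x + w n x))\<^sup>2 = 4 * \<mu> - \<mu> * (L2.snorm \<Omega> (\<lambda>x. w m x - w n x))\<^sup>2"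
      by (simp add: w(2) algebra_simps flip: distrib_left)
    moreover have "\<mu> * (L2.snorm \<Omega> (\<lambda>x. w m x + w n x))\<^sup>2 \<le> (grad.snorm (\<lambda>x. w m x + w n x))\<^sup>2"
      by (intro test test_functions_add w)
    ultimately show ?thesis using wlt[of m] wlt[of n] by simp
  qed
  have Cg: "\<exists>N. \<forall>m\<ge>N. \<forall>n\<ge>N. grad.snorm (\<lambda>x. w m x - w n x) < e" if e: "0 < e" for e
  proof -
    \<comment> \<open>Chosen so that \<open>(\<mu> + 1) * e2 = e / 2\<close>; with
      \<open>\<mu> \<le> (\<mu> + 1)\<^sup>2\<close> the L^2 part of the estimate is at most a
      quarter of \<open>e\<^sup>2\<close>, and so are the two remainders beyond
      \<open>N2\<close>.\<close>
    define e2 where "e2 = e / (2 * (\<mu> + 1))"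
    have e2: "0 < e2" using e \<mu> by (simp add: e2_def)
    obtain N1 where N1: "\<And>m n. m \<ge> N1 \<Longrightarrow> n \<ge> N1 \<Longrightarrow> L2.snorm \<Omega> (\<lambda>x. w m x - w n x) < e2"
      using r(2)[OF e2] by (auto simp: w_def)
    obtain N2 :: nat where N2: "8 / e\<^sup>2 < real N2" using reals_Archimedean2 by blast
    have "grad.snorm (\<lambda>x. w m x - w n x) < e" if mn: "m \<ge> max N1 N2" "n \<ge> max N1 N2" for m n
    proof -
      have small: "2 / real (Suc k) < e\<^sup>2 / 4" if "k \<ge> N2" for k
      proof -
        have "8 / e\<^sup>2 < real (Suc k)" using N2 that by linarith
        then show ?thesis using e by (simp add: field_simps)
      qed
      have "(L2.snorm \<Omega> (\<lambda>x. w m x - w n x))\<^sup>2 \<le> e2\<^sup>2"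
        using N1[of m n] mn by (intro power_mono L2.snorm_nonneg) auto
      then have "\<mu> * (L2.snorm \<Omega> (\<lambda>x. w m x - w n x))\<^sup>2 \<le> \<mu> * e2\<^sup>2"
        using \<mu> by (rule mult_left_mono)
      also have "\<dots> \<le> (\<mu> + 1)\<^sup>2 * e2\<^sup>2"
        using \<mu> by (intro mult_right_mono) (auto simp: power2_eq_square algebra_simps)
      also have "\<dots> = ((\<mu> + 1) * e2)\<^sup>2" by (simp add: power_mult_distrib)
      also have "(\<mu> + 1) * e2 = e / 2" using \<mu> by (simp add: e2_def field_simps)
      also have "(e / 2)\<^sup>2 = e\<^sup>2 / 4" by (simp add: power_divide)
      finally have "\<mu> * (L2.snorm \<Omega> (\<lambda>x. w m x - w n x))\<^sup>2 \<le> e\<^sup>2 / 4" .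
      moreover have "2 / real (Suc m) < e\<^sup>2 / 4" "2 / real (Suc n) < e\<^sup>2 / 4"
        using small mn by auto
      ultimately have "(grad.snorm (\<lambda>x. w m x - w n x))\<^sup>2 < e\<^sup>2"
        using par[of m n] zero_less_power[OF e, of 2] by linarith
      then show ?thesis using e by (intro power_less_imp_less_base[of _ 2 e]) auto
    qed
    then show ?thesis by blast
  qed
  obtain f where f: "f \<in> Sob1_0 \<Omega>" "(\<lambda>n. L2.snorm \<Omega> (\<lambda>x. w n x - f x)) \<longlonglongrightarrow> 0"
    "(\<lambda>n. grad.snorm (\<lambda>x. w n x - f x)) \<longlonglongrightarrow> 0"
    by (rule Sob1_0_complete[OF w(1) r(2)[folded w_def] Cg])
  have fS: "f \<in> Sob1 \<Omega>" "f \<in> L2 \<Omega>" using f(1) by (auto intro: Sob1_0_Sob1 Sob1_L2)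
  have ext: "\<mu> * (L2.snorm \<Omega> g)\<^sup>2 \<le> (grad.snorm g)\<^sup>2" if g: "g \<in> Sob1_0 \<Omega>" for g
  proof -
    obtain \<psi> :: "nat \<Rightarrow> 'a \<Rightarrow> real" where \<psi>: "\<And>n. \<psi> n \<in> test_functions \<Omega>"
      "(\<lambda>n. L2.snorm \<Omega> (\<psi> n)) \<longlonglongrightarrow> L2.snorm \<Omega> g" "(\<lambda>n. grad.snorm (\<psi> n)) \<longlonglongrightarrow> grad.snorm g"
      by (rule Sob1_0_approx[OF g]) blast
    have "(\<lambda>n. \<mu> * (L2.snorm \<Omega> (\<psi> n))\<^sup>2) \<longlonglongrightarrow> \<mu> * (L2.snorm \<Omega> g)\<^sup>2"
      "(\<lambda>n. (grad.snorm (\<psi> n))\<^sup>2) \<longlonglongrightarrow> (grad.snorm g)\<^sup>2"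
      by (intro tendsto_intros \<psi>)+
    then show ?thesis by (rule LIMSEQ_le) (use test \<psi>(1) in auto)
  qed
  have f1: "L2.snorm \<Omega> f = 1"
  proof -
    have "(\<lambda>n. L2.snorm \<Omega> (w n)) \<longlonglongrightarrow> L2.snorm \<Omega> f"
      by (rule L2.tendsto_snorm[OF f(2) _ fS(2)]) (simp add: wS)
    then show ?thesis by (simp add: w LIMSEQ_const_iff)
  qed
  have "(grad.snorm f)\<^sup>2 \<le> \<mu> + 0"
  proof (rule LIMSEQ_le)
    show "(\<lambda>n. (grad.snorm (w n))\<^sup>2) \<longlonglongrightarrow> (grad.snorm f)\<^sup>2"
      by (intro tendsto_intros grad.tendsto_snorm[OF f(3) _ fS(1)]) (simp add: wS)
    show "(\<lambda>n. \<mu> + 1 / real (Suc n)) \<longlonglongrightarrow> \<mu> + 0"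
      by (intro tendsto_intros LIMSEQ_Suc[OF lim_1_over_n])
  qed (use wlt less_imp_le in blast)
  moreover have "\<mu> \<le> (grad.snorm f)\<^sup>2" using ext[OF f(1)] f1 by simp
  ultimately show ?thesis using that[of f \<mu>] f(1) f1 ext by simp
qed

lemma eigenfunction_norms:
  assumes "dirichlet_eigenfunction \<Omega> \<mu> \<psi>"
  shows "(grad.snorm \<psi>)\<^sup>2 = \<mu> * (L2.snorm \<Omega> \<psi>)\<^sup>2" and "0 < L2.snorm \<Omega> \<psi>"
proof -
  have \<psi>: "\<psi> \<in> Sob1_0 \<Omega>" "\<not> ae_eq \<Omega> \<psi> (\<lambda>_. 0)"
    using assms by (auto simp: dirichlet_eigenfunction_def)
  have L: "\<psi> \<in> L2 \<Omega>" using \<psi>(1) by (auto intro: Sob1_0_Sob1 Sob1_L2)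
  show "(grad.snorm \<psi>)\<^sup>2 = \<mu> * (L2.snorm \<Omega> \<psi>)\<^sup>2"
    using assms \<psi>(1) unfolding grad.snorm_sq L2.snorm_sq
    by (simp add: dirichlet_eigenfunction_def grad_ip_def L2_ip_def)
  have "L2.snorm \<Omega> \<psi> \<noteq> 0"
    using snorm_eq_0_imp_ae_eq[OF L L2.scale_mem[OF L, of 0]] \<psi>(2) by auto
  then show "0 < L2.snorm \<Omega> \<psi>" using L2.snorm_nonneg[of \<Omega> \<psi>] by simp
qed

text \<open>The Rayleigh minimum satisfies the Euler-Lagrange equation and so is an eigenvalue;
  testing any eigenfunction with itself shows that no eigenvalue is smaller. Hence the infimum of
  the eigenvalues is this minimum, and Poincare makes it positive.\<close>

lemma principal_eigenvalue_Rayleigh: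
  assumes ne: "\<Omega> \<noteq> {}"
  shows "f \<in> Sob1_0 \<Omega> \<Longrightarrow> principal_eigenvalue \<Omega> * (L2.snorm \<Omega> f)\<^sup>2 \<le> (grad.snorm f)\<^sup>2"
    and "0 < principal_eigenvalue \<Omega>"
proof -
  obtain w \<mu> where w: "w \<in> Sob1_0 \<Omega>" "L2.snorm \<Omega> w = 1" "(grad.snorm w)\<^sup>2 = \<mu>"
    and min: "\<And>g. g \<in> Sob1_0 \<Omega> \<Longrightarrow> \<mu> * (L2.snorm \<Omega> g)\<^sup>2 \<le> (grad.snorm g)\<^sup>2"
    by (rule Rayleigh_minimizer[OF ne]) blast
  have wS: "w \<in> Sob1 \<Omega>" "w \<in> L2 \<Omega>" using w(1) by (auto intro: Sob1_0_Sob1 Sob1_L2)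
  have weak: "grad_ip \<Omega> w v = \<mu> * L2_ip \<Omega> w v" if v: "v \<in> Sob1_0 \<Omega>" for v
  proof -
    have vS: "v \<in> Sob1 \<Omega>" "v \<in> L2 \<Omega>" using v by (auto intro: Sob1_0_Sob1 Sob1_L2)
    define D where "D = grad_ip \<Omega> w v - \<mu> * L2_ip \<Omega> w v"
    define K where "K = grad_ip \<Omega> v v - \<mu> * L2_ip \<Omega> v v"
    have K: "0 \<le> K" using min[OF v] by (simp add: K_def grad.snorm_sq L2.snorm_sq)
    have quad: "0 \<le> 2 * t * D + t\<^sup>2 * K" for t
    proof -
      have "\<mu> * (L2.snorm \<Omega> (\<lambda>x. 1 * w x + t * v x))\<^sup>2 \<le> (grad.snorm (\<lambda>x. 1 * w x + t * v x))\<^sup>2"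
        by (intro min Sob1_0_lincomb w v)
      then show ?thesis
        unfolding grad.snorm_sq L2.snorm_sq grad.expand[OF wS(1) vS(1)] L2.expand[OF wS(2) vS(2)]
        using w(2,3) by (simp add: D_def K_def algebra_simps flip: grad.snorm_sq L2.snorm_sq)
    qed
    \<comment> \<open>The variation \<open>t = - s\<close> gives the value
      \<open>- s\<^sup>2 * (K + 2)\<close>, which must be nonnegative; the added 1 keeps the
      quotient defined when \<open>K = 0\<close>.\<close>
    define s where "s = D / (K + 1)"
    have D: "D = s * (K + 1)" using K by (simp add: s_def)
    have "0 \<le> - (s\<^sup>2 * (K + 2))"
      using quad[of "- s"] by (simp add: D power2_eq_square algebra_simps)
    then have "s\<^sup>2 * (K + 2) \<le> 0" by simp
    then have "s\<^sup>2 \<le> 0" using K by (simp add: mult_le_0_iff)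
    then show ?thesis using D by (simp add: D_def)
  qed
  have nz: "\<not> ae_eq \<Omega> w (\<lambda>_. 0)"
  proof
    assume "ae_eq \<Omega> w (\<lambda>_. 0)"
    from L2_snorm_cong_AE[OF wS(2) _ this] L2.scale_mem[OF wS(2), of 0]
    have "L2.snorm \<Omega> w = L2.snorm \<Omega> (\<lambda>_. 0)" by simp
    then show False using w(2) by (simp add: L2.snorm_def L2_ip_def)
  qed
  have eig: "dirichlet_eigenfunction \<Omega> \<mu> w"
    using w(1) nz weak by (simp add: dirichlet_eigenfunction_def grad_ip_def L2_ip_def)
  have eq: "principal_eigenvalue \<Omega> = \<mu>"
    unfolding principal_eigenvalue_def
  proof (rule cInf_eq_minimum)
    show "\<mu> \<in> {\<mu>. \<exists>\<psi>. dirichlet_eigenfunction \<Omega> \<mu> \<psi>}" using eig by blast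
    fix \<nu> assume "\<nu> \<in> {\<mu>. \<exists>\<psi>. dirichlet_eigenfunction \<Omega> \<mu> \<psi>}"
    then obtain \<psi> where \<psi>: "dirichlet_eigenfunction \<Omega> \<nu> \<psi>" by blast
    then have "\<mu> * (L2.snorm \<Omega> \<psi>)\<^sup>2 \<le> \<nu> * (L2.snorm \<Omega> \<psi>)\<^sup>2"
      using min[of \<psi>] eigenfunction_norms[OF \<psi>] by (simp add: dirichlet_eigenfunction_def)
    then show "\<mu> \<le> \<nu>" using eigenfunction_norms(2)[OF \<psi>] by simp
  qed
  show "f \<in> Sob1_0 \<Omega> \<Longrightarrow> principal_eigenvalue \<Omega> * (L2.snorm \<Omega> f)\<^sup>2 \<le> (grad.snorm f)\<^sup>2"
    unfolding eq by (rule min)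
  obtain C where "0 < C" "L2.snorm \<Omega> w \<le> C * grad.snorm w"
    using Poincare w(1) by metis
  then have "grad.snorm w \<noteq> 0" using w(2) by auto
  then show "0 < principal_eigenvalue \<Omega>" unfolding eq w(3)[symmetric] by simp
qed

end


section \<open>The Ladyzhenskaya inequality\<close>

text \<open>The third coordinate is split off as the slicing variable; the pair holds the first and
  second coordinates in this order.\<close>

definition coords3 :: "real \<Rightarrow> real \<times> real \<Rightarrow> real^3" where
  "coords3 z p = z *\<^sub>R axis 3 1 + snd p *\<^sub>R axis 2 1 + fst p *\<^sub>R axis 1 1"

lemma coords3_measurable [measurable (raw)]:
  assumes f: "f \<in> borel_measurable M" and h: "h \<in> borel_measurable M"
  shows "(\<lambda>q. coords3 (f q) (h q)) \<in> borel_measurable M"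
proof -
  have [measurable]: "(\<lambda>q. fst (h q)) \<in> borel_measurable M" "(\<lambda>q. snd (h q)) \<in> borel_measurable M"
    by (intro measurable_compose[OF h] borel_measurable_continuous_onI continuous_intros)+
  note [measurable] = f
  show ?thesis unfolding coords3_def by measurable
qed

lemma coords3_borel_measurable:
  "(\<lambda>q. coords3 (fst q) (snd q)) \<in> borel_measurable borel"
  unfolding coords3_def by (intro borel_measurable_continuous_onI continuous_intros)

lemma coords3_nth [simp]:
  "coords3 z p $ 1 = fst p" "coords3 z p $ 2 = snd p" "coords3 z p $ 3 = z"
  by (simp_all add: coords3_def axis_def)

text \<open>Lebesgue measure is determined by its values on boxes, and the preimage of a box is a
  product of three intervals.\<close>

lemma lborel_coords3:
  "distr (lborel :: (real \<times> real \<times> real) measure) borel (\<lambda>q. coords3 (fst q) (snd q)) = lborel"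
proof (rule lborel_eqI[symmetric])
  fix l u :: "real^3" assume le: "\<And>b. b \<in> Basis \<Longrightarrow> l \<bullet> b \<le> u \<bullet> b"
  have le': "l $ i \<le> u $ i" for i
    using le[of "axis i 1"] by (simp add: inner_axis axis_in_Basis_iff)
  have "(\<lambda>q. coords3 (fst q) (snd q)) -` box l u = {l$3<..<u$3} \<times> {l$1<..<u$1} \<times> {l$2<..<u$2}"
    by (auto simp: mem_box_cart forall_3)
  then have "emeasure (distr lborel borel (\<lambda>q. coords3 (fst q) (snd q))) (box l u)
      = emeasure lborel ({l$3<..<u$3} \<times> {l$1<..<u$1} \<times> {l$2<..<u$2})"
    by (subst emeasure_distr) (simp_all add: coords3_borel_measurable)
  also have "\<dots> = ennreal (u$3 - l$3) * (ennreal (u$1 - l$1) * ennreal (u$2 - l$2))"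
  proof -
    have "emeasure lborel ({l$1<..<u$1} \<times> {l$2<..<u$2}) = ennreal (u$1 - l$1) * ennreal (u$2 - l$2)"
      using le' by (subst lborel_prod[symmetric], subst lborel.emeasure_pair_measure_Times) auto
    moreover have "{l$1<..<u$1} \<times> {l$2<..<u$2} \<in> sets borel"
      by (intro borel_open open_Times) auto
    ultimately show ?thesis
      using le' by (subst lborel_prod[symmetric], subst lborel.emeasure_pair_measure_Times) auto
  qed
  also have "\<dots> = (\<Prod>b\<in>Basis. (u - l) \<bullet> b)"
  proof -
    have B: "(Basis :: (real^3) set) = (\<lambda>i. axis i 1) ` UNIV"
      by (auto simp: Basis_vec_def)
    have I: "inj (\<lambda>i::3. axis i (1::real))" by (auto simp: inj_def axis_eq_axis)
    have "(\<Prod>b\<in>Basis. (u - l) \<bullet> b) = (\<Prod>i\<in>UNIV. (u - l) $ i)"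
      unfolding B by (subst prod.reindex[OF I]) (simp add: inner_axis)
    also have "\<dots> = (u$3 - l$3) * ((u$1 - l$1) * (u$2 - l$2))"
      unfolding UNIV_3 by (subst prod.insert, simp, simp)+ (simp add: mult.commute)
    finally show ?thesis
      using le' by (simp only: ennreal_mult mult_nonneg_nonneg diff_ge_0_iff_ge)
  qed
  finally show "emeasure (distr lborel borel (\<lambda>q. coords3 (fst q) (snd q))) (box l u) = (\<Prod>b\<in>Basis. (u - l) \<bullet> b)" .
qed simp

lemma nn_integral_coords3:
  fixes F :: "real^3 \<Rightarrow> ennreal"
  assumes [measurable]: "F \<in> borel_measurable borel"
  shows "(\<integral>\<^sup>+x. F x \<partial>lborel) = (\<integral>\<^sup>+z. (\<integral>\<^sup>+p. F (coords3 z p) \<partial>lborel) \<partial>lborel)"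
proof -
  have m: "(\<lambda>q. F (coords3 (fst q) (snd q))) \<in> borel_measurable (lborel \<Otimes>\<^sub>M lborel)" by measurable
  note [measurable] = coords3_borel_measurable
  have "(\<integral>\<^sup>+x. F x \<partial>lborel) = (\<integral>\<^sup>+q. F (coords3 (fst q) (snd q)) \<partial>(lborel \<Otimes>\<^sub>M lborel))"
    by (subst lborel_coords3[symmetric]) (simp add: nn_integral_distr lborel_prod)
  also have "\<dots> = (\<integral>\<^sup>+z. (\<integral>\<^sup>+p. F (coords3 z p) \<partial>lborel) \<partial>lborel)"
    using lborel.nn_integral_fst[OF m] by simp
  finally show ?thesis .
qed

text \<open>The integrand dominates the derivative of the square of \<open>\<phi>\<close> along the
  line, and the square vanishes far out. The bound does not depend on \<open>t\<close>, the position
  on the line.\<close>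

lemma sq_le_line_integral:
  fixes \<phi> :: "'a::euclidean_space \<Rightarrow> real"
  assumes \<phi>: "\<phi> \<in> test_functions \<Omega>" and i: "i \<in> Basis"
  shows "ennreal ((\<phi> (q + t *\<^sub>R i))\<^sup>2) \<le>
    (\<integral>\<^sup>+s. ennreal (2 * \<bar>\<phi> (q + s *\<^sub>R i)\<bar> * \<bar>partial_deriv i \<phi> (q + s *\<^sub>R i)\<bar>) \<partial>lborel)"
proof -
  have s: "smooth_on UNIV \<phi>" by (rule test_functionsD(1)[OF \<phi>])
  obtain R where R: "\<And>x. \<phi> x \<noteq> 0 \<Longrightarrow> norm x \<le> R"
    using test_functionsD(4)[OF \<phi>] by (auto simp: bounded_iff)
  \<comment> \<open>A starting point to the left of \<open>t\<close> that is so remote that the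
    reverse triangle inequality places it outside the support.\<close>
  define a where "a = - (\<bar>R\<bar> + norm q + \<bar>t\<bar> + 1)"
  have a: "a \<le> t" unfolding a_def using norm_ge_zero[of q] by linarith
  have "\<bar>a\<bar> = norm (a *\<^sub>R i)" using i by simp
  also have "\<dots> \<le> norm (q + a *\<^sub>R i) + norm q"
    using norm_triangle_ineq4[of "q + a *\<^sub>R i" q] by simp
  finally have "R < norm (q + a *\<^sub>R i)" unfolding a_def by simp
  then have z: "\<phi> (q + a *\<^sub>R i) = 0" using R by force
  let ?f = "\<lambda>s. 2 * \<phi> (q + s *\<^sub>R i) * partial_deriv i \<phi> (q + s *\<^sub>R i)"
  have "ennreal \<bar>(\<phi> (q + t *\<^sub>R i))\<^sup>2 - (\<phi> (q + a *\<^sub>R i))\<^sup>2\<bar> \<le> (\<integral>\<^sup>+s. ennreal \<bar>?f s\<bar> * indicator {a..t} s \<partial>lborel)"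
  proof (rule FTC_nn_integral_bound[OF _ _ a])
    show "((\<lambda>s. (\<phi> (q + s *\<^sub>R i))\<^sup>2) has_real_derivative ?f s) (at s)" for s
      using DERIV_power[OF smooth_on_line_derivative[OF s, of q i s], of 2] by (simp add: mult_ac)
    have "continuous_on UNIV (\<lambda>s. \<phi> (q + s *\<^sub>R i))" "continuous_on UNIV (\<lambda>s. partial_deriv i \<phi> (q + s *\<^sub>R i))"
      by (rule continuous_on_compose2[of UNIV _ UNIV "\<lambda>s. q + s *\<^sub>R i"];
          auto intro!: continuous_intros smooth_on_continuous smooth_on_partial_deriv s i)+
    then show "continuous_on UNIV ?f" by (intro continuous_intros)
  qed
  also have "\<dots> \<le> (\<integral>\<^sup>+s. ennreal \<bar>?f s\<bar> \<partial>lborel)"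
    by (intro nn_integral_mono) (auto simp: indicator_def)
  finally show ?thesis using z by (simp add: abs_mult)
qed

text \<open>Each \<open>\<phi>\<^sup>2\<close> is bounded by line integrals in the three coordinate directions. On a slice \<open>x\<^sub>3 = z\<close>
  the product of the first two separates; the third bounds \<open>\<integral>\<phi>\<^sup>2\<close> over the slice uniformly in \<open>z\<close>.\<close>

lemma Ladyzhenskaya_nn_integral:
  fixes \<Omega> :: "(real^3) set"
  assumes \<phi>: "\<phi> \<in> test_functions \<Omega>"
  shows "(\<integral>\<^sup>+x. ennreal ((\<phi> x)^4) \<partial>lborel) \<le>
    4 * (\<integral>\<^sup>+x. ennreal (2 * \<bar>\<phi> x\<bar> * \<bar>partial_deriv (axis 3 1) \<phi> x\<bar>) \<partial>lborel) *
    (\<integral>\<^sup>+x. ennreal ((norm (classical_grad \<phi> x))\<^sup>2) \<partial>lborel)"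
proof -
  have ax: "axis k 1 \<in> (Basis :: (real^3) set)" for k by (simp add: axis_in_Basis_iff)
  define P where "P k x = ennreal \<bar>partial_deriv (axis k 1) \<phi> x\<bar>" for k x
  define F where "F x = ennreal \<bar>\<phi> x\<bar>" for x
  define g where "g k x = ennreal (2 * \<bar>\<phi> x\<bar> * \<bar>partial_deriv (axis k 1) \<phi> x\<bar>)" for k x
  define G where "G z = (\<integral>\<^sup>+p. ennreal ((norm (classical_grad \<phi> (coords3 z p)))\<^sup>2) \<partial>lborel)" for z
  define K where "K = (\<integral>\<^sup>+x. g 3 x \<partial>lborel)"
  have [measurable]: "\<phi> \<in> borel_measurable borel" by (rule test_functions_borel[OF \<phi>])
  have [measurable]: "partial_deriv (axis k 1) \<phi> \<in> borel_measurable borel" for k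
    by (rule test_functions_borel[OF test_functions_partial_deriv[OF \<phi> ax]])
  have [measurable]: "classical_grad \<phi> \<in> borel_measurable borel"
    by (intro borel_measurable_continuous_onI classical_grad_continuous test_functionsD(1)[OF \<phi>])
  have [measurable]: "g k \<in> borel_measurable borel" "F \<in> borel_measurable borel" "P k \<in> borel_measurable borel" for k
    unfolding g_def F_def P_def by measurable
  have g_eq: "g k x = 2 * (F x * P k x)" for k x
    by (simp add: g_def F_def P_def ennreal_mult' mult_ac flip: ennreal_numeral)
  have FF: "F x * F x = ennreal ((\<phi> x)\<^sup>2)" "F x ^ 2 = ennreal ((\<phi> x)\<^sup>2)" for x
    by (simp_all add: F_def power2_eq_square flip: ennreal_mult)
  define A1 where "A1 z y = (\<integral>\<^sup>+x. g 1 (coords3 z (x, y)) \<partial>lborel)" for z y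
  define A2 where "A2 z x = (\<integral>\<^sup>+y. g 2 (coords3 z (x, y)) \<partial>lborel)" for z x
  define A3 where "A3 p = (\<integral>\<^sup>+z. g 3 (coords3 z p) \<partial>lborel)" for p
  have s1: "ennreal ((\<phi> (coords3 z (x, y)))\<^sup>2) \<le> A1 z y" for x y z
    using sq_le_line_integral[OF \<phi> ax[of 1], of "coords3 z (0, y)" x] by (simp add: A1_def g_def coords3_def)
  have s2: "ennreal ((\<phi> (coords3 z (x, y)))\<^sup>2) \<le> A2 z x" for x y z
    using sq_le_line_integral[OF \<phi> ax[of 2], of "coords3 z (x, 0)" y]
    by (simp add: A2_def g_def coords3_def algebra_simps)
  have s3: "ennreal ((\<phi> (coords3 z p))\<^sup>2) \<le> A3 p" for z p
    using sq_le_line_integral[OF \<phi> ax[of 3], of "coords3 0 p" z]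
    by (simp add: A3_def g_def coords3_def algebra_simps)
  have B: "(\<integral>\<^sup>+p. ennreal ((\<phi> (coords3 z p))\<^sup>2) \<partial>lborel) \<le> K" for z
  proof -
    have "(\<integral>\<^sup>+p. ennreal ((\<phi> (coords3 z p))\<^sup>2) \<partial>lborel) \<le> (\<integral>\<^sup>+p. A3 p \<partial>lborel)"
      by (intro nn_integral_mono s3)
    also have "\<dots> = (\<integral>\<^sup>+z. (\<integral>\<^sup>+p. g 3 (coords3 z p) \<partial>lborel) \<partial>lborel)"
      unfolding A3_def by (rule lborel_pair.Fubini') measurable
    also have "\<dots> = K" unfolding K_def by (rule nn_integral_coords3[symmetric]) measurable
    finally show ?thesis .
  qed
  \<comment> \<open>Cauchy-Schwarz on one slice: the square integral of \<open>\<phi>\<close> is at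
    most \<open>K\<close> by \<open>B\<close>, that of a single partial derivative at most
    \<open>G z\<close>; the 4 is the square of the factor 2 in \<open>g\<close>.\<close>
  have CS: "(\<integral>\<^sup>+p. g k (coords3 z p) \<partial>lborel)\<^sup>2 \<le> 4 * K * G z" for k z
  proof -
    have "(\<integral>\<^sup>+p. g k (coords3 z p) \<partial>lborel) = 2 * (\<integral>\<^sup>+p. F (coords3 z p) * P k (coords3 z p) \<partial>lborel)"
      unfolding g_eq by (intro nn_integral_cmult) measurable
    then have "(\<integral>\<^sup>+p. g k (coords3 z p) \<partial>lborel)\<^sup>2 = 4 * (\<integral>\<^sup>+p. F (coords3 z p) * P k (coords3 z p) \<partial>lborel)\<^sup>2"
      by (simp add: power_mult_distrib)
    also have "\<dots> \<le> 4 * ((\<integral>\<^sup>+p. (F (coords3 z p))\<^sup>2 \<partial>lborel) * (\<integral>\<^sup>+p. (P k (coords3 z p))\<^sup>2 \<partial>lborel))"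
      by (intro mult_left_mono Cauchy_Schwarz_nn_integral) auto
    also have "\<dots> \<le> 4 * (K * G z)"
    proof (intro mult_left_mono mult_mono)
      show "(\<integral>\<^sup>+p. (F (coords3 z p))\<^sup>2 \<partial>lborel) \<le> K" unfolding FF by (rule B)
      show "(\<integral>\<^sup>+p. (P k (coords3 z p))\<^sup>2 \<partial>lborel) \<le> G z"
        unfolding G_def
      proof (intro nn_integral_mono)
        fix p
        have "(partial_deriv (axis k 1) \<phi> (coords3 z p))\<^sup>2 \<le> (norm (classical_grad \<phi> (coords3 z p)))\<^sup>2"
          unfolding norm_classical_grad
          by (rule member_le_sum[where f="\<lambda>i. (partial_deriv i \<phi> (coords3 z p))\<^sup>2"]) (auto simp: ax)
        then show "(P k (coords3 z p))\<^sup>2 \<le> ennreal ((norm (classical_grad \<phi> (coords3 z p)))\<^sup>2)"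
          by (simp add: P_def ennreal_power ennreal_leI)
      qed
    qed auto
    finally show ?thesis by (simp add: mult.assoc)
  qed
  have slice: "(\<integral>\<^sup>+p. ennreal ((\<phi> (coords3 z p))^4) \<partial>lborel) \<le> 4 * K * G z" for z
  proof -
    let ?U = "\<integral>\<^sup>+p. g 1 (coords3 z p) \<partial>lborel" and ?W = "\<integral>\<^sup>+p. g 2 (coords3 z p) \<partial>lborel"
    have [measurable]: "A1 z \<in> borel_measurable borel" "A2 z \<in> borel_measurable borel"
    proof -
      show "A1 z \<in> borel_measurable borel" "A2 z \<in> borel_measurable borel"
        unfolding A1_def A2_def by measurable
    qed
    have U: "(\<integral>\<^sup>+y. A1 z y \<partial>lborel) = ?U"
      unfolding A1_def by (subst lborel_prod[symmetric], subst lborel_pair.nn_integral_snd[symmetric])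
        (simp_all add: lborel_prod)
    have W: "(\<integral>\<^sup>+x. A2 z x \<partial>lborel) = ?W"
      unfolding A2_def by (subst lborel_prod[symmetric], subst lborel.nn_integral_fst[symmetric])
        (simp_all add: lborel_prod)
    have "(\<integral>\<^sup>+p. ennreal ((\<phi> (coords3 z p))^4) \<partial>lborel) \<le> (\<integral>\<^sup>+p. A2 z (fst p) * A1 z (snd p) \<partial>lborel)"
    proof (intro nn_integral_mono)
      fix p :: "real \<times> real"
      have "ennreal ((\<phi> (coords3 z p))^4) = ennreal ((\<phi> (coords3 z p))\<^sup>2) * ennreal ((\<phi> (coords3 z p))\<^sup>2)"
        by (simp flip: ennreal_mult power_add)
      also have "\<dots> \<le> A2 z (fst p) * A1 z (snd p)"
        using s1[of z "fst p" "snd p"] s2[of z "fst p" "snd p"] by (intro mult_mono) auto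
      finally show "ennreal ((\<phi> (coords3 z p))^4) \<le> A2 z (fst p) * A1 z (snd p)" .
    qed
    also have "\<dots> = (\<integral>\<^sup>+x. (\<integral>\<^sup>+y. A2 z x * A1 z y \<partial>lborel) \<partial>lborel)"
      by (subst lborel_prod[symmetric], subst lborel.nn_integral_fst[symmetric]) simp_all
    also have "\<dots> = ?W * ?U"
      by (simp add: nn_integral_cmult nn_integral_multc U W)
    \<comment> \<open>Replacing the product by the square of the larger factor lets
      \<open>CS\<close> be used as it stands, without square roots of extended numbers.\<close>
    also have "\<dots> \<le> (max ?U ?W)\<^sup>2"
      unfolding power2_eq_square by (intro mult_mono) auto
    also have "\<dots> \<le> 4 * K * G z"
      using CS[of 1 z] CS[of 2 z] by (simp add: max_def)
    finally show ?thesis .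
  qed
  have "(\<integral>\<^sup>+x. ennreal ((\<phi> x)^4) \<partial>lborel) = (\<integral>\<^sup>+z. (\<integral>\<^sup>+p. ennreal ((\<phi> (coords3 z p))^4) \<partial>lborel) \<partial>lborel)"
    by (rule nn_integral_coords3) measurable
  also have "\<dots> \<le> (\<integral>\<^sup>+z. 4 * K * G z \<partial>lborel)"
    by (intro nn_integral_mono slice)
  also have "\<dots> = 4 * K * (\<integral>\<^sup>+z. G z \<partial>lborel)"
  proof (rule nn_integral_cmult)
    show "G \<in> borel_measurable lborel" unfolding G_def by measurable
  qed
  also have "(\<integral>\<^sup>+z. G z \<partial>lborel) = (\<integral>\<^sup>+x. ennreal ((norm (classical_grad \<phi> x))\<^sup>2) \<partial>lborel)"
    unfolding G_def by (rule nn_integral_coords3[symmetric]) measurable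
  finally show ?thesis by (simp add: K_def g_def)
qed

section \<open>The embedding of H_0^1 into L^4 in three dimensions\<close>

locale bounded_open_set3 = bounded_open_set \<Omega> for \<Omega> :: "(real^3) set"
begin

text \<open>In the Ladyzhenskaya bound the mixed integral is at most twice the product of the norms
  of the function and of its gradient, and Poincare turns this product into the squared gradient
  norm.\<close>

lemma L4_test:
  obtains C where "0 < C" "\<And>\<phi>. \<phi> \<in> test_functions \<Omega> \<Longrightarrow> L2.snorm \<Omega> (\<lambda>x. (\<phi> x)\<^sup>2) \<le> C * (grad.snorm \<phi>)\<^sup>2"
proof -
  obtain C where C: "0 < C" "\<And>\<phi>. \<phi> \<in> test_functions \<Omega> \<Longrightarrow> L2.snorm \<Omega> \<phi> \<le> C * grad.snorm \<phi>"
    by (rule Poincare_test) blast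
  have ax: "axis 3 1 \<in> (Basis :: (real^3) set)" by (simp add: axis_in_Basis_iff)
  \<comment> \<open>The square of the left side is at most \<open>8 * C\<close> times the fourth
    power of the gradient norm; \<open>8 * C + 1\<close> replaces the square root of
    \<open>8 * C\<close>.\<close>
  have "L2.snorm \<Omega> (\<lambda>x. (\<phi> x)\<^sup>2) \<le> (8 * C + 1) * (grad.snorm \<phi>)\<^sup>2" if \<phi>: "\<phi> \<in> test_functions \<Omega>" for \<phi>
  proof -
    let ?d = "partial_deriv (axis 3 1) \<phi>"
    have \<phi>2: "(\<lambda>x. (\<phi> x)\<^sup>2) \<in> test_functions \<Omega>"
      using test_functions_smooth_mult[OF \<phi> test_functionsD(1)[OF \<phi>]] by (simp add: power2_eq_square)
    have d: "?d \<in> test_functions \<Omega>" by (rule test_functions_partial_deriv[OF \<phi> ax])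
    have aL: "(\<lambda>x. \<bar>\<phi> x\<bar>) \<in> L2 \<Omega>" "(\<lambda>x. \<bar>?d x\<bar>) \<in> L2 \<Omega>"
      using test_functions_L2[OF \<phi> dom_measurable] test_functions_L2[OF d dom_measurable]
      by (auto simp: L2_def)
    have abs: "L2.snorm \<Omega> (\<lambda>x. \<bar>f x\<bar>) = L2.snorm \<Omega> f" for f
      by (simp add: L2.snorm_def L2_ip_def)
    have int: "integrable lborel (\<lambda>x. 2 * \<bar>\<phi> x\<bar> * \<bar>?d x\<bar>)"
      using integrable_norm[OF test_functions_mult_integrable[OF d test_functions_continuous[OF \<phi>]]]
      by (simp add: abs_mult mult.assoc)
    have K: "(\<integral>\<^sup>+x. ennreal (2 * \<bar>\<phi> x\<bar> * \<bar>?d x\<bar>) \<partial>lborel) = ennreal (LINT x|lborel. 2 * \<bar>\<phi> x\<bar> * \<bar>?d x\<bar>)"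
      by (intro nn_integral_eq_integral int) auto
    have "(LINT x|lborel. 2 * \<bar>\<phi> x\<bar> * \<bar>?d x\<bar>) = 2 * L2_ip \<Omega> (\<lambda>x. \<bar>\<phi> x\<bar>) (\<lambda>x. \<bar>?d x\<bar>)"
      using test_functions_borel[OF \<phi>] test_functions_borel[OF d] test_functionsD(2)[OF \<phi>] dom_measurable
      unfolding L2_ip_def
      by (subst integral_lebesgue_on_eq_lborel(1)) (auto simp: mult.assoc)
    also have "\<dots> \<le> 2 * (L2.snorm \<Omega> \<phi> * L2.snorm \<Omega> ?d)"
      using L2.cauchy_schwarz[OF aL] by (simp add: abs)
    also have "L2.snorm \<Omega> ?d \<le> grad.snorm \<phi>"
    proof (rule power2_le_imp_le)
      have "integrable lborel (\<lambda>x. (?d x)\<^sup>2)"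
        using test_functions_mult_integrable[OF d test_functions_continuous[OF d]] by (simp add: power2_eq_square)
      then show "(L2.snorm \<Omega> ?d)\<^sup>2 \<le> (grad.snorm \<phi>)\<^sup>2"
        unfolding test_functions_L2_snorm[OF d] test_functions_grad_snorm(1)[OF \<phi>]
      proof (rule integral_mono[OF _ test_functions_grad_snorm(2)[OF \<phi>]])
        show "(?d x)\<^sup>2 \<le> (norm (classical_grad \<phi> x))\<^sup>2" for x
          unfolding norm_classical_grad
          by (rule member_le_sum[where f="\<lambda>i. (partial_deriv i \<phi> x)\<^sup>2"]) (auto simp: ax)
      qed
    qed (rule grad.snorm_nonneg)
    finally have "(LINT x|lborel. 2 * \<bar>\<phi> x\<bar> * \<bar>?d x\<bar>) \<le> 2 * (L2.snorm \<Omega> \<phi> * grad.snorm \<phi>)"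
      by (simp add: mult_left_mono L2.snorm_nonneg)
    also have "\<dots> \<le> 2 * (C * grad.snorm \<phi> * grad.snorm \<phi>)"
      using C(2)[OF \<phi>] by (simp add: mult_right_mono grad.snorm_nonneg)
    finally have K2: "(LINT x|lborel. 2 * \<bar>\<phi> x\<bar> * \<bar>?d x\<bar>) \<le> 2 * C * (grad.snorm \<phi>)\<^sup>2"
      by (simp add: power2_eq_square mult.assoc)
    have "ennreal ((L2.snorm \<Omega> (\<lambda>x. (\<phi> x)\<^sup>2))\<^sup>2) = (\<integral>\<^sup>+x. ennreal ((\<phi> x)^4) \<partial>lborel)"
    proof -
      have "integrable lborel (\<lambda>x. ((\<phi> x)\<^sup>2)\<^sup>2)"
        using test_functions_mult_integrable[OF \<phi>2 test_functions_continuous[OF \<phi>2]] by (simp add: power2_eq_square)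
      then show ?thesis
        unfolding test_functions_L2_snorm[OF \<phi>2]
        by (subst nn_integral_eq_integral[symmetric]) (auto simp flip: power_mult)
    qed
    also have "\<dots> \<le> 4 * ennreal (LINT x|lborel. 2 * \<bar>\<phi> x\<bar> * \<bar>?d x\<bar>) * ennreal ((grad.snorm \<phi>)\<^sup>2)"
      using Ladyzhenskaya_nn_integral[OF \<phi>] nn_integral_eq_integral[OF test_functions_grad_snorm(2)[OF \<phi>]]
      unfolding K test_functions_grad_snorm(1)[OF \<phi>] by simp
    also have "\<dots> = ennreal (4 * (LINT x|lborel. 2 * \<bar>\<phi> x\<bar> * \<bar>?d x\<bar>) * (grad.snorm \<phi>)\<^sup>2)"
      by (simp add: ennreal_mult' flip: ennreal_numeral)
    finally have "(L2.snorm \<Omega> (\<lambda>x. (\<phi> x)\<^sup>2))\<^sup>2 \<le> 4 * (LINT x|lborel. 2 * \<bar>\<phi> x\<bar> * \<bar>?d x\<bar>) * (grad.snorm \<phi>)\<^sup>2"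
      by (subst (asm) ennreal_le_iff) auto
    also have "\<dots> \<le> 4 * (2 * C * (grad.snorm \<phi>)\<^sup>2) * (grad.snorm \<phi>)\<^sup>2"
      by (intro mult_right_mono mult_left_mono K2) auto
    also have "\<dots> = 8 * C * ((grad.snorm \<phi>)\<^sup>2)\<^sup>2" by (simp add: power2_eq_square)
    also have "\<dots> \<le> (8 * C + 1)\<^sup>2 * ((grad.snorm \<phi>)\<^sup>2)\<^sup>2"
    proof (rule mult_right_mono)
      show "8 * C \<le> (8 * C + 1)\<^sup>2" using C(1) by (simp add: power2_eq_square algebra_simps)
    qed simp
    finally have "(L2.snorm \<Omega> (\<lambda>x. (\<phi> x)\<^sup>2))\<^sup>2 \<le> ((8 * C + 1) * (grad.snorm \<phi>)\<^sup>2)\<^sup>2"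
      by (simp add: power_mult_distrib)
    then show ?thesis by (rule power2_le_imp_le) (use C(1) in simp)
  qed
  with C(1) show thesis by (intro that[of "8 * C + 1"]) auto
qed

text \<open>Fatou along an a.e. convergent subsequence of approximating test functions. Their
  gradient norms only converge to that of \<open>f\<close>, hence the slack \<open>e\<close>, which
  is removed in the limit.\<close>

lemma L4_embedding:
  obtains C where "0 < C" "\<And>f. f \<in> Sob1_0 \<Omega> \<Longrightarrow> (\<lambda>x. (f x)\<^sup>2) \<in> L2 \<Omega>"
    "\<And>f. f \<in> Sob1_0 \<Omega> \<Longrightarrow> L2.snorm \<Omega> (\<lambda>x. (f x)\<^sup>2) \<le> C * (grad.snorm f)\<^sup>2"
proof -
  obtain C where C: "0 < C"
    "\<And>\<phi>. \<phi> \<in> test_functions \<Omega> \<Longrightarrow> L2.snorm \<Omega> (\<lambda>x. (\<phi> x)\<^sup>2) \<le> C * (grad.snorm \<phi>)\<^sup>2"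
    by (rule L4_test) blast
  have eps: "(\<lambda>x. (f x)\<^sup>2) \<in> L2 \<Omega> \<and> L2.snorm \<Omega> (\<lambda>x. (f x)\<^sup>2) \<le> C * (grad.snorm f + e)\<^sup>2"
    if f: "f \<in> Sob1_0 \<Omega>" and e: "0 < e" for f e
  proof -
    let ?M = "lebesgue_on \<Omega>"
    have fL: "f \<in> L2 \<Omega>" using f by (auto intro: Sob1_0_Sob1 Sob1_L2)
    obtain \<phi> :: "nat \<Rightarrow> real^3 \<Rightarrow> real" where \<phi>: "\<And>n. \<phi> n \<in> test_functions \<Omega>"
      "(\<lambda>n. L2.snorm \<Omega> (\<lambda>x. \<phi> n x - f x)) \<longlonglongrightarrow> 0" "(\<lambda>n. grad.snorm (\<phi> n)) \<longlonglongrightarrow> grad.snorm f"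
      by (rule Sob1_0_approx[OF f]) blast
    have \<phi>L: "\<phi> n \<in> L2 \<Omega>" for n by (rule test_functions_L2[OF \<phi>(1) dom_measurable])
    have [measurable]: "f \<in> borel_measurable ?M" "\<phi> n \<in> borel_measurable ?M" for n
      using fL \<phi>L by (auto intro: L2_measurable)
    have "(\<lambda>n. (L2.snorm \<Omega> (\<lambda>x. \<phi> n x - f x))\<^sup>2) \<longlonglongrightarrow> 0\<^sup>2" by (intro tendsto_intros \<phi>)
    then have "(\<lambda>n. LINT x|?M. norm ((\<phi> n x - f x)\<^sup>2)) \<longlonglongrightarrow> 0"
      unfolding L2.snorm_sq by (simp add: L2_ip_def power2_eq_square)
    moreover have "integrable ?M (\<lambda>x. (\<phi> n x - f x)\<^sup>2)" for n
      using L2.diff_mem[OF \<phi>L fL] by (simp add: L2_def)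
    ultimately obtain r where r: "strict_mono r" "AE x in ?M. (\<lambda>n. (\<phi> (r n) x - f x)\<^sup>2) \<longlonglongrightarrow> 0"
      using tendsto_L1_AE_subseq[of ?M "\<lambda>n x. (\<phi> n x - f x)\<^sup>2"] by blast
    have "(\<integral>\<^sup>+x. ennreal (((f x)\<^sup>2)\<^sup>2) \<partial>?M) \<le> ennreal ((C * (grad.snorm f + e)\<^sup>2)\<^sup>2)"
    proof (rule nn_integral_Fatou_bound)
      show "AE x in ?M. (\<lambda>n. ((\<phi> (r n) x)\<^sup>2)\<^sup>2) \<longlonglongrightarrow> ((f x)\<^sup>2)\<^sup>2"
        using r(2)
      proof eventually_elim
        case (elim x)
        have "(\<lambda>n. sqrt ((\<phi> (r n) x - f x)\<^sup>2)) \<longlonglongrightarrow> sqrt 0"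
          by (intro tendsto_real_sqrt elim)
        then have "(\<lambda>n. \<phi> (r n) x - f x) \<longlonglongrightarrow> 0" by (simp add: tendsto_rabs_zero_iff)
        then have "(\<lambda>n. \<phi> (r n) x) \<longlonglongrightarrow> f x" by (simp add: LIM_zero_iff)
        then show ?case by (intro tendsto_intros)
      qed
      have "\<forall>\<^sub>F n in sequentially. grad.snorm (\<phi> n) < grad.snorm f + e"
        using \<phi>(3) by (rule order_tendstoD(2)) (use e in simp)
      then have "\<forall>\<^sub>F n in sequentially. grad.snorm (\<phi> (r n)) < grad.snorm f + e"
        by (rule eventually_subseq[OF r(1)])
      then show "\<forall>\<^sub>F n in sequentially. (\<integral>\<^sup>+x. ennreal (((\<phi> (r n) x)\<^sup>2)\<^sup>2) \<partial>?M) \<le> ennreal ((C * (grad.snorm f + e)\<^sup>2)\<^sup>2)"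
      proof eventually_elim
        case (elim n)
        have \<phi>2: "(\<lambda>x. (\<phi> (r n) x)\<^sup>2) \<in> test_functions \<Omega>"
          using test_functions_smooth_mult[OF \<phi>(1)[of "r n"] test_functionsD(1)[OF \<phi>(1)[of "r n"]]]
          by (simp add: power2_eq_square)
        have "L2.snorm \<Omega> (\<lambda>x. (\<phi> (r n) x)\<^sup>2) \<le> C * (grad.snorm (\<phi> (r n)))\<^sup>2" by (rule C(2)[OF \<phi>(1)])
        also have "\<dots> \<le> C * (grad.snorm f + e)\<^sup>2"
          using C(1) elim by (intro mult_left_mono power_mono grad.snorm_nonneg) auto
        finally show ?case
          unfolding nn_integral_L2[OF test_functions_L2[OF \<phi>2 dom_measurable]]
          by (intro ennreal_leI power_mono L2.snorm_nonneg)
      qed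
    qed auto
    then show ?thesis
      using L2_from_nn_integral[of "\<lambda>x. (f x)\<^sup>2" \<Omega> "C * (grad.snorm f + e)\<^sup>2"] C(1) by simp
  qed
  show thesis
  proof (rule that[OF C(1)])
    fix f assume f: "f \<in> Sob1_0 \<Omega>"
    show "(\<lambda>x. (f x)\<^sup>2) \<in> L2 \<Omega>" using eps[OF f, of 1] by simp
    have "((\<lambda>e. C * (grad.snorm f + e)\<^sup>2) \<longlongrightarrow> C * (grad.snorm f + 0)\<^sup>2) (at_right 0)"
      by (intro tendsto_intros)
    then have "L2.snorm \<Omega> (\<lambda>x. (f x)\<^sup>2) \<le> C * (grad.snorm f + 0)\<^sup>2"
      by (rule tendsto_lowerbound) (auto intro: eventually_mono[OF eventually_at_right_less] eps[OF f, THEN conjunct2])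
    then show "L2.snorm \<Omega> (\<lambda>x. (f x)\<^sup>2) \<le> C * (grad.snorm f)\<^sup>2" by simp
  qed
qed

end


section \<open>Time derivatives and conservation of energy\<close>

text \<open>Limits within the interval are not vacuous, also at the endpoint 0; this is what makes
  time derivatives unique there.\<close>

lemma time_interval_nontrivial:
  assumes "t \<in> time_interval T"
  shows "at t within time_interval T \<noteq> bot"
proof -
  have t: "0 \<le> t" "ereal t < T" using assms by (auto simp: time_interval_def)
  then obtain r where r: "ereal t < ereal r" "ereal r < T" using ereal_dense2 by blast
  then have "{t<..<r} \<subseteq> time_interval T"
    using t by (auto simp: time_interval_def intro: le_less_trans[of _ "ereal r"])
  then have "at t within {t<..<r} \<le> at t within time_interval T" by (rule at_le)
  moreover have "at t within {t<..<r} \<noteq> bot"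
    using r by (simp add: trivial_limit_within islimpt_greaterThanLessThan1)
  ultimately show ?thesis by (metis bot.extremum_uniqueI)
qed

lemma time_interval_downward: "t \<in> time_interval T \<Longrightarrow> 0 \<le> s \<Longrightarrow> s \<le> t \<Longrightarrow> s \<in> time_interval T"
  by (auto simp: time_interval_def intro: le_less_trans[of _ "ereal t"])

lemma eventually_within_mem: "\<forall>\<^sub>F s in at t within I. s \<in> I"
  by (simp add: eventually_at_filter)

lemma has_time_deriv_at_L2_unique:
  assumes v: "has_time_deriv_at (Lnorm \<Omega> 2) I u t v" and w: "has_time_deriv_at (Lnorm \<Omega> 2) I u t w"
    and L: "\<And>s. s \<in> I \<Longrightarrow> u s \<in> L2 \<Omega>" "v \<in> L2 \<Omega>" "w \<in> L2 \<Omega>" and t: "t \<in> I" "at t within I \<noteq> bot"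
  shows "ae_eq \<Omega> v w"
proof (rule snorm_eq_0_imp_ae_eq[OF L(2,3)])
  show "L2.snorm \<Omega> (\<lambda>x. v x - w x) = 0"
  proof (rule L2.limit_unique[OF _ _ _ L(2,3) t(2)])
    show "((\<lambda>s. L2.snorm \<Omega> (\<lambda>x. (u s x - u t x) / (s - t) - v x)) \<longlongrightarrow> 0) (at t within I)"
      "((\<lambda>s. L2.snorm \<Omega> (\<lambda>x. (u s x - u t x) / (s - t) - w x)) \<longlongrightarrow> 0) (at t within I)"
      using v w by (auto simp: has_time_deriv_at_def Lnorm_2_eq_snorm)
    show "\<forall>\<^sub>F s in at t within I. (\<lambda>x. (u s x - u t x) / (s - t)) \<in> L2 \<Omega>"
      using eventually_within_mem by eventually_elim (intro L2.diff_quotient_mem L t)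
  qed
qed

lemma time_deriv_ae_eq:
  assumes v: "has_time_deriv_at (Lnorm \<Omega> 2) (time_interval T) u t v"
    and L: "\<And>s. s \<in> time_interval T \<Longrightarrow> u s \<in> L2 \<Omega>" "v \<in> L2 \<Omega>" and t: "t \<in> time_interval T"
  shows "ae_eq \<Omega> (time_deriv \<Omega> T u t) v" and "time_deriv \<Omega> T u t \<in> L2 \<Omega>"
proof -
  have "time_deriv \<Omega> T u t \<in> L2 \<Omega> \<and> has_time_deriv_at (Lnorm \<Omega> 2) (time_interval T) u t (time_deriv \<Omega> T u t)"
    unfolding time_deriv_def by (rule someI[of _ v]) (use v L in auto)
  then show "ae_eq \<Omega> (time_deriv \<Omega> T u t) v" "time_deriv \<Omega> T u t \<in> L2 \<Omega>"
    using has_time_deriv_at_L2_unique[OF _ v L(1) _ L(2) t time_interval_nontrivial[OF t]] by auto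
qed

text \<open>The iterated \<open>time_deriv\<close> differentiates a chosen representative of u_t at
  each time, so a.e. equality at every time has to be transported through difference
  quotients.\<close>

lemma has_time_deriv_at_L2_cong:
  assumes u: "has_time_deriv_at (Lnorm \<Omega> 2) I u t v"
    and L: "\<And>s. s \<in> I \<Longrightarrow> u s \<in> L2 \<Omega>" "\<And>s. s \<in> I \<Longrightarrow> u' s \<in> L2 \<Omega>" "v \<in> L2 \<Omega>" "v' \<in> L2 \<Omega>"
    and eq: "\<And>s. s \<in> I \<Longrightarrow> ae_eq \<Omega> (u s) (u' s)" "ae_eq \<Omega> v v'" and t: "t \<in> I"
  shows "has_time_deriv_at (Lnorm \<Omega> 2) I u' t v'"
proof -
  have "\<forall>\<^sub>F s in at t within I. L2.snorm \<Omega> (\<lambda>x. (u s x - u t x) / (s - t) - v x)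
      = L2.snorm \<Omega> (\<lambda>x. (u' s x - u' t x) / (s - t) - v' x)"
    using eventually_within_mem
  proof eventually_elim
    case (elim s)
    show ?case
    proof (intro L2_snorm_cong_AE L2.diff_mem L2.diff_quotient_mem L elim t)
      show "ae_eq \<Omega> (\<lambda>x. (u s x - u t x) / (s - t) - v x) (\<lambda>x. (u' s x - u' t x) / (s - t) - v' x)"
        using eq(1)[OF elim] eq(1)[OF t] eq(2) unfolding ae_eq_def by eventually_elim simp
    qed
  qed
  then show ?thesis
    using u unfolding has_time_deriv_at_def Lnorm_2_eq_snorm by (rule Lim_transform_eventually[rotated])
qed

context bounded_open_set3
begin

text \<open>Membership follows by polarisation from squares; the bound is Cauchy-Schwarz for the two
  squares followed by the L^4 estimate.\<close>

lemma Sob1_0_mult: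
  obtains C where "0 < C"
    "\<And>f g. f \<in> Sob1_0 \<Omega> \<Longrightarrow> g \<in> Sob1_0 \<Omega> \<Longrightarrow> (\<lambda>x. f x * g x) \<in> L2 \<Omega>"
    "\<And>f g. f \<in> Sob1_0 \<Omega> \<Longrightarrow> g \<in> Sob1_0 \<Omega> \<Longrightarrow> L2.snorm \<Omega> (\<lambda>x. f x * g x) \<le> C * grad.snorm f * grad.snorm g"
proof -
  obtain C where C: "0 < C" "\<And>f. f \<in> Sob1_0 \<Omega> \<Longrightarrow> (\<lambda>x. (f x)\<^sup>2) \<in> L2 \<Omega>"
    "\<And>f. f \<in> Sob1_0 \<Omega> \<Longrightarrow> L2.snorm \<Omega> (\<lambda>x. (f x)\<^sup>2) \<le> C * (grad.snorm f)\<^sup>2"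
    by (rule L4_embedding) blast
  show thesis
  proof (rule that[OF C(1)])
    fix f g assume fg: "f \<in> Sob1_0 \<Omega>" "g \<in> Sob1_0 \<Omega>"
    have sum: "(\<lambda>x. 1 * f x + 1 * g x) \<in> Sob1_0 \<Omega>" by (rule Sob1_0_lincomb[OF fg])
    have "(\<lambda>x. (1 / 2) * (((1 * f x + 1 * g x)\<^sup>2 - (f x)\<^sup>2) - (g x)\<^sup>2)) \<in> L2 \<Omega>"
      by (intro L2.scale_mem L2.diff_mem C(2) fg sum)
    moreover have "(\<lambda>x. (1 / 2) * (((1 * f x + 1 * g x)\<^sup>2 - (f x)\<^sup>2) - (g x)\<^sup>2)) = (\<lambda>x. f x * g x)"
      by (simp add: power2_eq_square algebra_simps fun_eq_iff)
    ultimately show "(\<lambda>x. f x * g x) \<in> L2 \<Omega>" by simp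
    have "(L2.snorm \<Omega> (\<lambda>x. f x * g x))\<^sup>2 = L2_ip \<Omega> (\<lambda>x. (f x)\<^sup>2) (\<lambda>x. (g x)\<^sup>2)"
      unfolding L2.snorm_sq by (simp add: L2_ip_def power2_eq_square mult_ac)
    also have "\<dots> \<le> L2.snorm \<Omega> (\<lambda>x. (f x)\<^sup>2) * L2.snorm \<Omega> (\<lambda>x. (g x)\<^sup>2)"
      using L2.cauchy_schwarz[OF C(2)[OF fg(1)] C(2)[OF fg(2)]] by simp
    also have "\<dots> \<le> (C * (grad.snorm f)\<^sup>2) * (C * (grad.snorm g)\<^sup>2)"
      using C(1) by (intro mult_mono C(3) fg) (auto simp: L2.snorm_nonneg)
    also have "\<dots> = (C * grad.snorm f * grad.snorm g)\<^sup>2" by (simp add: power2_eq_square mult_ac)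
    finally show "L2.snorm \<Omega> (\<lambda>x. f x * g x) \<le> C * grad.snorm f * grad.snorm g"
      by (rule power2_le_imp_le) (use C(1) in \<open>simp add: grad.snorm_nonneg\<close>)
  qed
qed

lemma Sob1_0_sq_L2: "f \<in> Sob1_0 \<Omega> \<Longrightarrow> (\<lambda>x. (f x)\<^sup>2) \<in> L2 \<Omega>"
  by (rule L4_embedding) blast

lemma Sob1_0_mult_L2: "f \<in> Sob1_0 \<Omega> \<Longrightarrow> g \<in> Sob1_0 \<Omega> \<Longrightarrow> (\<lambda>x. f x * g x) \<in> L2 \<Omega>"
  by (rule Sob1_0_mult) blast

text \<open>Multiplication is bounded from H_0^1 times H_0^1 into L^2, so the remainder
  \<open>2 u r + (s - t) q\<^sup>2\<close> is small in L^2. The quartic term can then be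
  differentiated as a quadratic form in u^2.\<close>

lemma square_time_deriv:
  assumes u: "\<And>s. s \<in> I \<Longrightarrow> u s \<in> Sob1_0 \<Omega>" and v: "v \<in> Sob1_0 \<Omega>" and t: "t \<in> I"
    and lim: "((\<lambda>s. grad.snorm (\<lambda>x. (u s x - u t x) / (s - t) - v x)) \<longlongrightarrow> 0) (at t within I)"
  shows "((\<lambda>s. L2.snorm \<Omega> (\<lambda>x. ((u s x)\<^sup>2 - (u t x)\<^sup>2) / (s - t) - 2 * (u t x * v x))) \<longlongrightarrow> 0) (at t within I)"
proof -
  obtain C where C: "0 < C"
    "\<And>f g. f \<in> Sob1_0 \<Omega> \<Longrightarrow> g \<in> Sob1_0 \<Omega> \<Longrightarrow> (\<lambda>x. f x * g x) \<in> L2 \<Omega>"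
    "\<And>f g. f \<in> Sob1_0 \<Omega> \<Longrightarrow> g \<in> Sob1_0 \<Omega> \<Longrightarrow> L2.snorm \<Omega> (\<lambda>x. f x * g x) \<le> C * grad.snorm f * grad.snorm g"
    by (rule Sob1_0_mult) blast
  define r where "r s = (\<lambda>x. (u s x - u t x) / (s - t) - v x)" for s
  have lim: "((\<lambda>s. grad.snorm (r s)) \<longlongrightarrow> 0) (at t within I)" using lim by (simp add: r_def)
  show ?thesis
  proof (rule Lim_null_comparison)
    show "\<forall>\<^sub>F s in at t within I. norm (L2.snorm \<Omega> (\<lambda>x. ((u s x)\<^sup>2 - (u t x)\<^sup>2) / (s - t) - 2 * (u t x * v x)))
        \<le> 2 * (C * grad.snorm (u t) * grad.snorm (r s)) + \<bar>s - t\<bar> * (C * (grad.snorm v + grad.snorm (r s))\<^sup>2)"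
      unfolding eventually_at_filter
    proof (intro always_eventually allI impI)
      fix s assume s: "s \<noteq> t" "s \<in> I"
      define q where "q = (\<lambda>x. 1 * v x + 1 * r s x)"
      have r: "r s \<in> Sob1_0 \<Omega>"
        using Sob1_0_diff[OF Sob1_0_scale[OF Sob1_0_diff[OF u[OF s(2)] u[OF t]], of "1 / (s - t)"] v]
        by (simp add: r_def)
      have q: "q \<in> Sob1_0 \<Omega>" unfolding q_def by (rule Sob1_0_lincomb[OF v r])
      have us: "u s x = u t x + (s - t) * q x" for x using s by (simp add: q_def r_def)
      have "(u s x)\<^sup>2 - (u t x)\<^sup>2 = (s - t) * (2 * (u t x * q x) + (s - t) * (q x * q x))" for x
        unfolding us by (simp add: power2_eq_square algebra_simps)
      moreover have "2 * (u t x * q x) - 2 * (u t x * v x) = 2 * (u t x * r s x)" for x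
        by (simp add: q_def algebra_simps)
      ultimately have eq: "(\<lambda>x. ((u s x)\<^sup>2 - (u t x)\<^sup>2) / (s - t) - 2 * (u t x * v x))
          = (\<lambda>x. 2 * (u t x * r s x) + (s - t) * (q x * q x))"
        using s by (simp add: fun_eq_iff)
      have "L2.snorm \<Omega> (\<lambda>x. 2 * (u t x * r s x) + (s - t) * (q x * q x))
          \<le> \<bar>2\<bar> * L2.snorm \<Omega> (\<lambda>x. u t x * r s x) + \<bar>s - t\<bar> * L2.snorm \<Omega> (\<lambda>x. q x * q x)"
        by (intro L2.snorm_lincomb_le C(2) u t r q)
      also have "\<dots> \<le> \<bar>2\<bar> * (C * grad.snorm (u t) * grad.snorm (r s)) + \<bar>s - t\<bar> * (C * (grad.snorm v + grad.snorm (r s))\<^sup>2)"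
      proof (intro add_mono mult_left_mono)
        show "L2.snorm \<Omega> (\<lambda>x. u t x * r s x) \<le> C * grad.snorm (u t) * grad.snorm (r s)"
          by (intro C(3) u t r)
        have "grad.snorm q \<le> grad.snorm v + grad.snorm (r s)"
          unfolding q_def using grad.snorm_add_le[OF Sob1_0_Sob1[OF v] Sob1_0_Sob1[OF r]] by simp
        then have "C * (grad.snorm q)\<^sup>2 \<le> C * (grad.snorm v + grad.snorm (r s))\<^sup>2"
          using C(1) by (intro mult_left_mono power_mono grad.snorm_nonneg) auto
        with C(3)[OF q q] show "L2.snorm \<Omega> (\<lambda>x. q x * q x) \<le> C * (grad.snorm v + grad.snorm (r s))\<^sup>2"
          by (simp add: power2_eq_square mult.assoc)
      qed auto
      finally show "norm (L2.snorm \<Omega> (\<lambda>x. ((u s x)\<^sup>2 - (u t x)\<^sup>2) / (s - t) - 2 * (u t x * v x)))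
        \<le> 2 * (C * grad.snorm (u t) * grad.snorm (r s)) + \<bar>s - t\<bar> * (C * (grad.snorm v + grad.snorm (r s))\<^sup>2)"
        unfolding eq by (simp add: L2.snorm_nonneg)
    qed
    have "((\<lambda>s. 2 * (C * grad.snorm (u t) * grad.snorm (r s)) + \<bar>s - t\<bar> * (C * (grad.snorm v + grad.snorm (r s))\<^sup>2))
        \<longlongrightarrow> 2 * (C * grad.snorm (u t) * 0) + \<bar>t - t\<bar> * (C * (grad.snorm v + 0)\<^sup>2)) (at t within I)"
      by (intro tendsto_intros lim)
    then show "((\<lambda>s. 2 * (C * grad.snorm (u t) * grad.snorm (r s)) + \<bar>s - t\<bar> * (C * (grad.snorm v + grad.snorm (r s))\<^sup>2))
        \<longlongrightarrow> 0) (at t within I)" by simp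
  qed
qed

text \<open>The first-order and the second-order regularity supply different derivatives, one in
  H_0^1 and one in L^2 that is differentiable again. Both agree a.e. with each other and with
  \<open>time_deriv\<close>, so a single \<open>v\<close> has both properties: it may be used as a
  test function and has \<open>z\<close> as its derivative.\<close>

lemma solution_derivatives:
  assumes u: "u \<in> solution_space \<Omega> T"
  obtains v z where
    "\<And>t. t \<in> time_interval T \<Longrightarrow> u t \<in> Sob1_0 \<Omega> \<and> u t \<in> Sob2 \<Omega> \<and> v t \<in> Sob1_0 \<Omega> \<and> z t \<in> L2 \<Omega>"
    "\<And>t. t \<in> time_interval T \<Longrightarrow> has_time_deriv_at (Sob1_norm \<Omega>) (time_interval T) u t (v t)"
    "\<And>t. t \<in> time_interval T \<Longrightarrow> has_time_deriv_at (Lnorm \<Omega> 2) (time_interval T) v t (z t)"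
    "\<And>t. t \<in> time_interval T \<Longrightarrow> ae_eq \<Omega> (time_deriv \<Omega> T u t) (v t) \<and> time_deriv \<Omega> T u t \<in> L2 \<Omega>"
    "\<And>t. t \<in> time_interval T \<Longrightarrow> ae_eq \<Omega> (time_deriv \<Omega> T (time_deriv \<Omega> T u) t) (z t)"
proof -
  let ?I = "time_interval T"
  have uS: "u t \<in> Sob1_0 \<Omega>" "u t \<in> Sob2 \<Omega>" "u t \<in> L2 \<Omega>" if "t \<in> ?I" for t
    using u that by (auto simp: solution_space_def intro: Sob1_0_Sob1 Sob1_L2)
  have "u \<in> Ck_time 1 (Sob1_0 \<Omega>) (Sob1_norm \<Omega>) ?I" using u by (simp add: solution_space_def)
  then obtain v where v: "\<And>t. t \<in> ?I \<Longrightarrow> v t \<in> Sob1_0 \<Omega>"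
    "\<And>t. t \<in> ?I \<Longrightarrow> has_time_deriv_at (Sob1_norm \<Omega>) ?I u t (v t)"
    unfolding One_nat_def Ck_time.simps by blast
  have "u \<in> Ck_time 2 (L2 \<Omega>) (Lnorm \<Omega> 2) ?I" using u by (simp add: solution_space_def)
  then obtain w where w: "w \<in> Ck_time (Suc 0) (L2 \<Omega>) (Lnorm \<Omega> 2) ?I"
    "\<And>t. t \<in> ?I \<Longrightarrow> has_time_deriv_at (Lnorm \<Omega> 2) ?I u t (w t)"
    unfolding numeral_2_eq_2 Ck_time.simps(2)[of "Suc 0"] by blast
  from w(1) obtain z where wL: "\<And>t. t \<in> ?I \<Longrightarrow> w t \<in> L2 \<Omega>" and z: "\<And>t. t \<in> ?I \<Longrightarrow> z t \<in> L2 \<Omega>"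
    "\<And>t. t \<in> ?I \<Longrightarrow> has_time_deriv_at (Lnorm \<Omega> 2) ?I w t (z t)"
    unfolding Ck_time.simps by blast
  have vL: "v t \<in> L2 \<Omega>" if "t \<in> ?I" for t using v(1)[OF that] by (auto intro: Sob1_0_Sob1 Sob1_L2)
  have vL2: "has_time_deriv_at (Lnorm \<Omega> 2) ?I u t (v t)" if "t \<in> ?I" for t
    using v(2)[OF that] by (simp add: has_time_deriv_at_def Sob1_norm_eq tendsto_H1_iff Lnorm_2_eq_snorm)
  have wv: "ae_eq \<Omega> (w t) (v t)" if "t \<in> ?I" for t
    by (rule has_time_deriv_at_L2_unique[OF w(2)[OF that] vL2[OF that] uS(3) wL[OF that] vL[OF that] that
          time_interval_nontrivial[OF that]])
  have vz: "has_time_deriv_at (Lnorm \<Omega> 2) ?I v t (z t)" if "t \<in> ?I" for t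
    by (rule has_time_deriv_at_L2_cong[OF z(2)[OF that] wL vL z(1)[OF that] z(1)[OF that] wv ae_eq_refl that])
  have ut: "ae_eq \<Omega> (time_deriv \<Omega> T u t) (v t)" "time_deriv \<Omega> T u t \<in> L2 \<Omega>" if "t \<in> ?I" for t
    using time_deriv_ae_eq[OF vL2[OF that] uS(3) vL[OF that] that] by auto
  have utt: "ae_eq \<Omega> (time_deriv \<Omega> T (time_deriv \<Omega> T u) t) (z t)" if "t \<in> ?I" for t
    by (rule time_deriv_ae_eq(1)[OF has_time_deriv_at_L2_cong[OF vz[OF that] vL ut(2) z(1)[OF that] z(1)[OF that]
          ae_eq_sym[OF ut(1)] ae_eq_refl that] ut(2) z(1)[OF that] that])
  show thesis
    by (rule that[of v z]) (use uS v z vz ut utt in auto)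
qed

lemma Lnorm_4_power:
  "(Lnorm \<Omega> 4 f) ^ 4 = L2_ip \<Omega> (\<lambda>x. (f x)\<^sup>2) (\<lambda>x. (f x)\<^sup>2)"
proof -
  define A where "A = (LINT x|lebesgue_on \<Omega>. norm (f x) powr 4)"
  have A: "0 \<le> A" unfolding A_def by simp
  have "(Lnorm \<Omega> 4 f) ^ 4 = (A powr (1 / 4)) powr 4"
    unfolding Lnorm_def A_def by (subst powr_numeral) auto
  also have "\<dots> = A" using A by (simp add: powr_powr)
  also have "A = L2_ip \<Omega> (\<lambda>x. (f x)\<^sup>2) (\<lambda>x. (f x)\<^sup>2)"
    unfolding A_def L2_ip_def by (intro Bochner_Integration.integral_cong) (auto simp flip: power_add)
  finally show ?thesis .
qed

lemma J_fun_eq: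
  "J_fun \<Omega> a b lam f = a / 4 * (grad_ip \<Omega> f f)\<^sup>2 + b / 2 * grad_ip \<Omega> f f - lam / 2 * L2_ip \<Omega> f f
     - 1 / 4 * L2_ip \<Omega> (\<lambda>x. (f x)\<^sup>2) (\<lambda>x. (f x)\<^sup>2)"
  and I_fun_eq:
  "I_fun \<Omega> a b lam f = a * (grad_ip \<Omega> f f)\<^sup>2 + b * grad_ip \<Omega> f f - lam * L2_ip \<Omega> f f
     - L2_ip \<Omega> (\<lambda>x. (f x)\<^sup>2) (\<lambda>x. (f x)\<^sup>2)"
proof -
  have "(grad.snorm f) ^ 4 = (grad_ip \<Omega> f f)\<^sup>2"
    unfolding grad.snorm_sq[symmetric] by (simp flip: power_mult)
  then show "J_fun \<Omega> a b lam f = a / 4 * (grad_ip \<Omega> f f)\<^sup>2 + b / 2 * grad_ip \<Omega> f f - lam / 2 * L2_ip \<Omega> f f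
     - 1 / 4 * L2_ip \<Omega> (\<lambda>x. (f x)\<^sup>2) (\<lambda>x. (f x)\<^sup>2)"
    "I_fun \<Omega> a b lam f = a * (grad_ip \<Omega> f f)\<^sup>2 + b * grad_ip \<Omega> f f - lam * L2_ip \<Omega> f f
     - L2_ip \<Omega> (\<lambda>x. (f x)\<^sup>2) (\<lambda>x. (f x)\<^sup>2)"
    by (simp_all add: J_fun_def I_fun_def Lnorm_grad Lnorm_2_eq_snorm Lnorm_4_power grad.snorm_sq L2.snorm_sq)
qed

text \<open>A solution attains its initial data only a.e.; this identifies the functionals at time 0
  with those of the data, and also evaluates them on functions that vanish a.e.\<close>

lemma functionals_cong_AE:
  assumes "f \<in> Sob1_0 \<Omega>" "g \<in> Sob1_0 \<Omega>" "ae_eq \<Omega> f g"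
  shows "grad_ip \<Omega> f f = grad_ip \<Omega> g g" "J_fun \<Omega> a b lam f = J_fun \<Omega> a b lam g"
    "I_fun \<Omega> a b lam f = I_fun \<Omega> a b lam g"
proof -
  show 1: "grad_ip \<Omega> f f = grad_ip \<Omega> g g"
    using grad_snorm_cong_AE[OF _ _ assms(3)] assms(1,2) unfolding grad.snorm_sq[symmetric]
    by (simp add: Sob1_0_Sob1)
  have 2: "L2_ip \<Omega> f f = L2_ip \<Omega> g g"
    using assms by (intro L2_ip_cong_AE) (auto intro: Sob1_0_Sob1 Sob1_L2)
  have "ae_eq \<Omega> (\<lambda>x. (f x)\<^sup>2) (\<lambda>x. (g x)\<^sup>2)"
    using assms(3) unfolding ae_eq_def by eventually_elim simp
  then have 3: "L2_ip \<Omega> (\<lambda>x. (f x)\<^sup>2) (\<lambda>x. (f x)\<^sup>2) = L2_ip \<Omega> (\<lambda>x. (g x)\<^sup>2) (\<lambda>x. (g x)\<^sup>2)"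
    using assms by (intro L2_ip_cong_AE Sob1_0_sq_L2)
  show "J_fun \<Omega> a b lam f = J_fun \<Omega> a b lam g" "I_fun \<Omega> a b lam f = I_fun \<Omega> a b lam g"
    unfolding J_fun_eq I_fun_eq 1 2 3 by simp_all
qed

lemma functionals_has_derivative:
  assumes u: "\<And>s. s \<in> I \<Longrightarrow> u s \<in> Sob1_0 \<Omega>" and v: "v \<in> Sob1_0 \<Omega>" and t: "t \<in> I"
    and lim: "has_time_deriv_at (Sob1_norm \<Omega>) I u t v"
  shows "((\<lambda>s. grad_ip \<Omega> (u s) (u s)) has_real_derivative 2 * grad_ip \<Omega> (u t) v) (at t within I)"
    and "((\<lambda>s. L2_ip \<Omega> (u s) (u s)) has_real_derivative 2 * L2_ip \<Omega> (u t) v) (at t within I)"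
    and "((\<lambda>s. L2_ip \<Omega> (\<lambda>x. (u s x)\<^sup>2) (\<lambda>x. (u s x)\<^sup>2)) has_real_derivative
      4 * L2_ip \<Omega> (\<lambda>x. (u t x)\<^sup>2) (\<lambda>x. u t x * v x)) (at t within I)"
proof -
  have lims: "((\<lambda>s. L2.snorm \<Omega> (\<lambda>x. (u s x - u t x) / (s - t) - v x)) \<longlongrightarrow> 0) (at t within I)"
    "((\<lambda>s. grad.snorm (\<lambda>x. (u s x - u t x) / (s - t) - v x)) \<longlongrightarrow> 0) (at t within I)"
    using lim by (auto simp: has_time_deriv_at_def Sob1_norm_eq tendsto_H1_iff)
  show "((\<lambda>s. grad_ip \<Omega> (u s) (u s)) has_real_derivative 2 * grad_ip \<Omega> (u t) v) (at t within I)"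
    by (rule grad.has_real_derivative_B[OF _ _ t lims(2)]) (auto intro: Sob1_0_Sob1 u v)
  show "((\<lambda>s. L2_ip \<Omega> (u s) (u s)) has_real_derivative 2 * L2_ip \<Omega> (u t) v) (at t within I)"
    by (rule L2.has_real_derivative_B[OF _ _ t lims(1)]) (auto intro: Sob1_0_Sob1 Sob1_L2 u v)
  have "((\<lambda>s. L2_ip \<Omega> (\<lambda>x. (u s x)\<^sup>2) (\<lambda>x. (u s x)\<^sup>2)) has_real_derivative
      2 * L2_ip \<Omega> (\<lambda>x. (u t x)\<^sup>2) (\<lambda>x. 2 * (u t x * v x))) (at t within I)"
    by (rule L2.has_real_derivative_B[OF _ _ t square_time_deriv[OF u v t lims(2)]])
      (auto intro!: Sob1_0_sq_L2 L2.scale_mem Sob1_0_mult_L2 u v t)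
  then show "((\<lambda>s. L2_ip \<Omega> (\<lambda>x. (u s x)\<^sup>2) (\<lambda>x. (u s x)\<^sup>2)) has_real_derivative
      4 * L2_ip \<Omega> (\<lambda>x. (u t x)\<^sup>2) (\<lambda>x. u t x * v x)) (at t within I)"
    by (simp add: L2.B_scale_right[OF Sob1_0_mult_L2[OF u[OF t] v] Sob1_0_sq_L2[OF u[OF t]]])
qed

text \<open>The equation is multiplied by \<open>v\<close> and integrated; Green's formula applies
  because \<open>v\<close> is in H_0^1. The cubic term is grouped as \<open>u\<^sup>2\<close> times
  \<open>u v\<close>, a product of two L^2 functions, which secures integrability.\<close>

lemma energy_derivative_zero:
  assumes u: "u \<in> Sob1_0 \<Omega>" "u \<in> Sob2 \<Omega>" and v: "v \<in> Sob1_0 \<Omega>" and z: "z \<in> L2 \<Omega>"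
    and eq: "AE x in lebesgue_on \<Omega>. z x - (a * grad_ip \<Omega> u u + b) * wlaplacian \<Omega> u x = lam * u x + \<bar>u x\<bar>\<^sup>2 * u x"
  shows "L2_ip \<Omega> v z + a * grad_ip \<Omega> u u * grad_ip \<Omega> u v + b * grad_ip \<Omega> u v - lam * L2_ip \<Omega> u v
    - L2_ip \<Omega> (\<lambda>x. (u x)\<^sup>2) (\<lambda>x. u x * v x) = 0"
proof -
  let ?M = "lebesgue_on \<Omega>"
  let ?c = "a * grad_ip \<Omega> u u + b"
  have L: "u \<in> L2 \<Omega>" "v \<in> L2 \<Omega>" "wlaplacian \<Omega> u \<in> L2 \<Omega>" "(\<lambda>x. (u x)\<^sup>2) \<in> L2 \<Omega>" "(\<lambda>x. u x * v x) \<in> L2 \<Omega>"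
    using u v grad_ip_laplacian(2)[OF u(2) v] Sob1_0_sq_L2 Sob1_0_mult_L2
    by (auto intro: Sob1_0_Sob1 Sob1_L2)
  note ints = L2_mult_integrable[OF L(3,2)] L2_mult_integrable[OF L(1,2)] L2_mult_integrable[OF L(4,5)]
  have "L2_ip \<Omega> v z = (LINT x|?M. ?c * (wlaplacian \<Omega> u x * v x) + lam * (u x * v x) + (u x)\<^sup>2 * (u x * v x))"
    unfolding L2_ip_def
  proof (rule integral_cong_AE)
    show "AE x in ?M. v x * z x = ?c * (wlaplacian \<Omega> u x * v x) + lam * (u x * v x) + (u x)\<^sup>2 * (u x * v x)"
      using eq
    proof eventually_elim
      case (elim x)
      then have "z x = ?c * wlaplacian \<Omega> u x + lam * u x + (u x)\<^sup>2 * u x" by simp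
      then show ?case by (simp only: distrib_left distrib_right mult_ac)
    qed
    show "(\<lambda>x. v x * z x) \<in> borel_measurable ?M" using L2_mult_integrable[OF L(2) z] by simp
    show "(\<lambda>x. ?c * (wlaplacian \<Omega> u x * v x) + lam * (u x * v x) + (u x)\<^sup>2 * (u x * v x)) \<in> borel_measurable ?M"
      by (rule borel_measurable_integrable) (use ints in simp)
  qed
  also have "\<dots> = ?c * L2_ip \<Omega> (wlaplacian \<Omega> u) v + lam * L2_ip \<Omega> u v + L2_ip \<Omega> (\<lambda>x. (u x)\<^sup>2) (\<lambda>x. u x * v x)"
    using ints by (simp add: L2_ip_def)
  finally show ?thesis
    using grad_ip_laplacian(1)[OF u(2) v] by (simp add: algebra_simps)
qed

lemma energy_conservation:
  assumes sol: "kirchhoff_solution \<Omega> a b lam u0 u1 T u"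
    and u0: "u0 \<in> Sob1_0 \<Omega>" and u1: "u1 \<in> Sob1_0 \<Omega>" and t: "t \<in> time_interval T"
  shows "1 / 2 * (Lnorm \<Omega> 2 (time_deriv \<Omega> T u t))\<^sup>2 + J_fun \<Omega> a b lam (u t) = initial_energy \<Omega> a b lam u0 u1"
proof -
  let ?I = "time_interval T"
  have us: "u \<in> solution_space \<Omega> T" using sol by (simp add: kirchhoff_solution_def)
  obtain v z where
    S: "\<And>t. t \<in> ?I \<Longrightarrow> u t \<in> Sob1_0 \<Omega> \<and> u t \<in> Sob2 \<Omega> \<and> v t \<in> Sob1_0 \<Omega> \<and> z t \<in> L2 \<Omega>"
    and uv: "\<And>t. t \<in> ?I \<Longrightarrow> has_time_deriv_at (Sob1_norm \<Omega>) ?I u t (v t)"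
    and vz: "\<And>t. t \<in> ?I \<Longrightarrow> has_time_deriv_at (Lnorm \<Omega> 2) ?I v t (z t)"
    and ut: "\<And>t. t \<in> ?I \<Longrightarrow> ae_eq \<Omega> (time_deriv \<Omega> T u t) (v t) \<and> time_deriv \<Omega> T u t \<in> L2 \<Omega>"
    and utt: "\<And>t. t \<in> ?I \<Longrightarrow> ae_eq \<Omega> (time_deriv \<Omega> T (time_deriv \<Omega> T u) t) (z t)"
    by (rule solution_derivatives[OF us]) blast
  have vL: "v t \<in> L2 \<Omega>" if "t \<in> ?I" for t using S[OF that] by (auto intro: Sob1_0_Sob1 Sob1_L2)
  define E where "E s = 1 / 2 * L2_ip \<Omega> (v s) (v s) + J_fun \<Omega> a b lam (u s)" for s
  define D where "D s = L2_ip \<Omega> (v s) (z s) + a * grad_ip \<Omega> (u s) (u s) * grad_ip \<Omega> (u s) (v s)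
      + b * grad_ip \<Omega> (u s) (v s) - lam * L2_ip \<Omega> (u s) (v s)
      - L2_ip \<Omega> (\<lambda>x. (u s x)\<^sup>2) (\<lambda>x. u s x * v s x)" for s
  have der: "(E has_real_derivative D s) (at s within ?I)" if s: "s \<in> ?I" for s
  proof -
    have vd: "((\<lambda>s. L2_ip \<Omega> (v s) (v s)) has_real_derivative 2 * L2_ip \<Omega> (v s) (z s)) (at s within ?I)"
      by (rule L2.has_real_derivative_B[OF vL _ s])
        (use vz[OF s] S[OF s] in \<open>auto simp: has_time_deriv_at_def Lnorm_2_eq_snorm\<close>)
    have uSob: "u s \<in> Sob1_0 \<Omega>" if "s \<in> ?I" for s using S that by blast
    note d = functionals_has_derivative[OF uSob S[OF s, THEN conjunct2, THEN conjunct2, THEN conjunct1] s uv[OF s]]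
    show ?thesis
      unfolding E_def J_fun_eq D_def
      by (rule derivative_eq_intros vd d refl | simp)+
  qed
  have "E t = E 0"
  proof (cases "t = 0")
    case False
    then have t0: "0 < t" using t by (simp add: time_interval_def)
    have sub: "{0..t} \<subseteq> ?I" using time_interval_downward[OF t] by auto
    show ?thesis
    \<comment> \<open>The equation is imposed only for positive times. The one-sided derivative at 0
      provides continuity there, and a vanishing derivative in the interior does the rest.\<close>
    proof (rule DERIV_isconst_end[OF t0])
      show "continuous_on {0..t} E"
        by (rule continuous_on_subset[OF _ sub], rule DERIV_continuous_on[OF der])
      fix s assume s: "0 < s" "s < t"
      have sI: "s \<in> ?I" using sub s by auto
      have "D s = 0"
        unfolding D_def
      proof (rule energy_derivative_zero)
        have "AE x in lebesgue_on \<Omega>. time_deriv \<Omega> T (time_deriv \<Omega> T u) s x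
             - (a * (LINT y|lebesgue_on \<Omega>. (norm (wgrad \<Omega> (u s) y))\<^sup>2) + b) * wlaplacian \<Omega> (u s) x
           = lam * u s x + \<bar>u s x\<bar>\<^sup>2 * u s x"
          using sol s(1) sI by (auto simp: kirchhoff_solution_def time_interval_def)
        then show "AE x in lebesgue_on \<Omega>. z s x - (a * grad_ip \<Omega> (u s) (u s) + b) * wlaplacian \<Omega> (u s) x
            = lam * u s x + \<bar>u s x\<bar>\<^sup>2 * u s x"
          using utt[OF sI] unfolding ae_eq_def grad_ip_def power2_norm_eq_inner
          by eventually_elim simp
      qed (use S[OF sI] in auto)
      moreover have "at s within ?I = at s"
      proof (rule at_within_open_subset[of s "{0<..<t}"])
        show "{0<..<t} \<subseteq> ?I" using sub by auto
      qed (use s in auto)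
      ultimately show "(E has_real_derivative 0) (at s)" using der[OF sI] by simp
    qed
  qed simp
  moreover have eqE: "E s = 1 / 2 * (Lnorm \<Omega> 2 (time_deriv \<Omega> T u s))\<^sup>2 + J_fun \<Omega> a b lam (u s)" if "s \<in> ?I" for s
    using L2_snorm_cong_AE[OF _ vL[OF that]] ut[OF that] by (simp add: E_def Lnorm_2_eq_snorm L2.snorm_sq)
  moreover have "0 \<in> ?I" using time_interval_downward[OF t, of 0] t by (simp add: time_interval_def)
  moreover have "1 / 2 * (Lnorm \<Omega> 2 (time_deriv \<Omega> T u 0))\<^sup>2 + J_fun \<Omega> a b lam (u 0) = initial_energy \<Omega> a b lam u0 u1"
  proof -
    have 0: "0 \<in> ?I" by fact
    have "ae_eq \<Omega> (u 0) u0" "ae_eq \<Omega> (time_deriv \<Omega> T u 0) u1"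
      using sol by (auto simp: kirchhoff_solution_def)
    then have "J_fun \<Omega> a b lam (u 0) = J_fun \<Omega> a b lam u0" "L2.snorm \<Omega> (time_deriv \<Omega> T u 0) = L2.snorm \<Omega> u1"
      using functionals_cong_AE(2)[OF _ u0] S[OF 0] L2_snorm_cong_AE ut[OF 0] Sob1_L2[OF Sob1_0_Sob1[OF u1]] by auto
    then show ?thesis by (simp add: initial_energy_def Lnorm_2_eq_snorm)
  qed
  ultimately show ?thesis using t by metis
qed

lemma solution_continuous:
  assumes sol: "kirchhoff_solution \<Omega> a b lam u0 u1 T u"
  shows "continuous_on (time_interval T) (\<lambda>t. grad_ip \<Omega> (u t) (u t))"
    and "continuous_on (time_interval T) (\<lambda>t. I_fun \<Omega> a b lam (u t))"
    and "t \<in> time_interval T \<Longrightarrow> u t \<in> Sob1_0 \<Omega>"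
proof -
  let ?I = "time_interval T"
  have us: "u \<in> solution_space \<Omega> T" using sol by (simp add: kirchhoff_solution_def)
  obtain v z where
    S: "\<And>t. t \<in> ?I \<Longrightarrow> u t \<in> Sob1_0 \<Omega> \<and> u t \<in> Sob2 \<Omega> \<and> v t \<in> Sob1_0 \<Omega> \<and> z t \<in> L2 \<Omega>"
    and uv: "\<And>t. t \<in> ?I \<Longrightarrow> has_time_deriv_at (Sob1_norm \<Omega>) ?I u t (v t)"
    by (rule solution_derivatives[OF us]) blast
  show "t \<in> ?I \<Longrightarrow> u t \<in> Sob1_0 \<Omega>" using S by blast
  have uSob: "u s \<in> Sob1_0 \<Omega>" "v s \<in> Sob1_0 \<Omega>" if "s \<in> ?I" for s using S that by blast+
  note d = functionals_has_derivative[OF uSob(1) uSob(2) _ uv]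
  have c: "continuous_on ?I (\<lambda>t. grad_ip \<Omega> (u t) (u t))" "continuous_on ?I (\<lambda>t. L2_ip \<Omega> (u t) (u t))"
    "continuous_on ?I (\<lambda>t. L2_ip \<Omega> (\<lambda>x. (u t x)\<^sup>2) (\<lambda>x. (u t x)\<^sup>2))"
    using d by (auto intro!: DERIV_continuous_on)
  then show "continuous_on ?I (\<lambda>t. grad_ip \<Omega> (u t) (u t))" by blast
  show "continuous_on ?I (\<lambda>t. I_fun \<Omega> a b lam (u t))"
    unfolding I_fun_eq by (intro continuous_intros c)
qed

end


section \<open>A priori bounds\<close>

context bounded_open_set3
begin

abbreviation quartic :: "(real^3 \<Rightarrow> real) \<Rightarrow> real" where
  "quartic f \<equiv> L2_ip \<Omega> (\<lambda>x. (f x)\<^sup>2) (\<lambda>x. (f x)\<^sup>2)"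

lemma quartic_scale: "quartic (\<lambda>x. c * f x) = c ^ 4 * quartic f"
proof -
  have "quartic (\<lambda>x. c * f x) = (LINT x|lebesgue_on \<Omega>. c ^ 4 * ((f x)\<^sup>2 * (f x)\<^sup>2))"
    unfolding L2_ip_def
    by (intro Bochner_Integration.integral_cong refl) (simp add: power2_eq_square power4_eq_xxxx mult_ac)
  then show ?thesis by (simp add: L2_ip_def)
qed

lemma quartic_le:
  obtains C where "0 < C" "\<And>f. f \<in> Sob1_0 \<Omega> \<Longrightarrow> quartic f \<le> C * (grad_ip \<Omega> f f)\<^sup>2"
proof -
  obtain C where C: "0 < C"
    "\<And>f. f \<in> Sob1_0 \<Omega> \<Longrightarrow> L2.snorm \<Omega> (\<lambda>x. (f x)\<^sup>2) \<le> C * (grad.snorm f)\<^sup>2"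
    by (rule L4_embedding) blast
  show thesis
  proof (rule that[of "C\<^sup>2"])
    fix f assume "f \<in> Sob1_0 \<Omega>"
    then have "(L2.snorm \<Omega> (\<lambda>x. (f x)\<^sup>2))\<^sup>2 \<le> (C * (grad.snorm f)\<^sup>2)\<^sup>2"
      by (intro power_mono C L2.snorm_nonneg)
    then show "quartic f \<le> C\<^sup>2 * (grad_ip \<Omega> f f)\<^sup>2"
      unfolding L2.snorm_sq grad.snorm_sq power_mult_distrib .
  qed (use C(1) in simp)
qed

lemma quartic_pos:
  assumes f: "f \<in> Sob1_0 \<Omega>" and nz: "\<not> ae_eq \<Omega> f (\<lambda>_. 0)"
  shows "0 < quartic f"
proof -
  have "quartic f \<noteq> 0"
  proof
    assume "quartic f = 0"
    then have "L2.snorm \<Omega> (\<lambda>x. (f x)\<^sup>2) = 0" by (simp add: L2.snorm_def)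
    then have "ae_eq \<Omega> (\<lambda>x. (f x)\<^sup>2) (\<lambda>x. 0 * (f x)\<^sup>2)"
      by (intro snorm_eq_0_imp_ae_eq L2.scale_mem Sob1_0_sq_L2 f) simp
    then show False using nz by (simp add: ae_eq_def)
  qed
  then show ?thesis using L2.nonneg[of \<Omega> "\<lambda>x. (f x)\<^sup>2"] by simp
qed

lemma Lnorm_4_nonneg: "0 \<le> Lnorm \<Omega> 4 f"
  by (simp add: Lnorm_def)

lemma grad_snorm_4: "(Lnorm \<Omega> 2 (wgrad \<Omega> f)) ^ 4 = (grad_ip \<Omega> f f)\<^sup>2"
  unfolding Lnorm_grad grad.snorm_sq[symmetric] by (simp flip: power_mult)

lemma quartic_normalise:
  assumes "quartic f \<noteq> 0"
  obtains c where "c ^ 4 * quartic f = 1" "Lnorm \<Omega> 4 (\<lambda>x. c * f x) = 1"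
proof
  let ?c = "1 / Lnorm \<Omega> 4 f"
  have "Lnorm \<Omega> 4 f \<noteq> 0" using assms Lnorm_4_power[of f] by auto
  then show 1: "?c ^ 4 * quartic f = 1" unfolding Lnorm_4_power[symmetric] by (simp add: power_one_over)
  have "(Lnorm \<Omega> 4 (\<lambda>x. ?c * f x)) ^ 4 = 1 ^ 4"
    unfolding Lnorm_4_power quartic_scale 1 by simp
  then show "Lnorm \<Omega> 4 (\<lambda>x. ?c * f x) = 1"
    by (rule power_eq_imp_eq_base) (simp_all add: Lnorm_4_nonneg)
qed

text \<open>Both sides are homogeneous of degree 4, so a nonzero function may be normalised in L^4.
  The L^4 embedding bounds the set below by a positive number, and the normalised Rayleigh minimiser
  shows that it is nonempty.\<close>

lemma Lambda_const_bound:
  assumes ne: "\<Omega> \<noteq> {}"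
  shows "0 < Lambda_const \<Omega>" and "f \<in> Sob1_0 \<Omega> \<Longrightarrow> Lambda_const \<Omega> * quartic f \<le> (grad_ip \<Omega> f f)\<^sup>2"
proof -
  define X where "X = {(Lnorm \<Omega> 2 (wgrad \<Omega> u)) ^ 4 | u. u \<in> Sob1_0 \<Omega> \<and> Lnorm \<Omega> 4 u = 1}"
  have eq: "Lambda_const \<Omega> = Inf X" by (simp add: Lambda_const_def X_def)
  obtain C where C: "0 < C" "\<And>f. f \<in> Sob1_0 \<Omega> \<Longrightarrow> quartic f \<le> C * (grad_ip \<Omega> f f)\<^sup>2"
    by (rule quartic_le) blast
  have lower: "1 / C \<le> x" if "x \<in> X" for x
  proof -
    obtain u where u: "u \<in> Sob1_0 \<Omega>" "Lnorm \<Omega> 4 u = 1" "x = (grad_ip \<Omega> u u)\<^sup>2"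
      using \<open>x \<in> X\<close> by (auto simp: X_def grad_snorm_4)
    have "1 \<le> C * x" using C(2)[OF u(1)] u(2,3) Lnorm_4_power[of u] by simp
    then show ?thesis using C(1) by (simp add: field_simps)
  qed
  then have bdd: "bdd_below X" by (rule bdd_belowI)
  obtain w where w: "w \<in> Sob1_0 \<Omega>" "L2.snorm \<Omega> w = 1"
    by (rule Rayleigh_minimizer[OF ne]) blast
  have wL: "w \<in> L2 \<Omega>" using w(1) by (auto intro: Sob1_0_Sob1 Sob1_L2)
  have "\<not> ae_eq \<Omega> w (\<lambda>_. 0)"
  proof
    assume "ae_eq \<Omega> w (\<lambda>_. 0)"
    from L2_snorm_cong_AE[OF wL _ this] L2.scale_mem[OF wL, of 0]
    show False using w(2) by (simp add: L2.snorm_def L2_ip_def)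
  qed
  from quartic_pos[OF w(1) this] obtain c where c: "Lnorm \<Omega> 4 (\<lambda>x. c * w x) = 1"
    using quartic_normalise[of w] by auto
  then have "X \<noteq> {}" using Sob1_0_scale[OF w(1), of c] by (auto simp: X_def)
  then have "1 / C \<le> Lambda_const \<Omega>" unfolding eq using lower by (rule cInf_greatest)
  moreover have "0 < 1 / C" using C(1) by simp
  ultimately show "0 < Lambda_const \<Omega>" by linarith
  assume f: "f \<in> Sob1_0 \<Omega>"
  show "Lambda_const \<Omega> * quartic f \<le> (grad_ip \<Omega> f f)\<^sup>2"
  proof (cases "quartic f = 0")
    case False
    obtain c where c: "c ^ 4 * quartic f = 1" "Lnorm \<Omega> 4 (\<lambda>x. c * f x) = 1"
      by (rule quartic_normalise[OF False]) blast
    have "Inf X \<le> (grad_ip \<Omega> (\<lambda>x. c * f x) (\<lambda>x. c * f x))\<^sup>2"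
      using c(2) Sob1_0_scale[OF f, of c] grad_snorm_4 by (intro cInf_lower[OF _ bdd]) (auto simp: X_def)
    also have "\<dots> = c ^ 4 * (grad_ip \<Omega> f f)\<^sup>2"
      by (simp add: grad.B_scale[OF Sob1_0_Sob1[OF f]] power_mult_distrib flip: power_mult)
    finally have "Lambda_const \<Omega> * quartic f \<le> c ^ 4 * (grad_ip \<Omega> f f)\<^sup>2 * quartic f"
      unfolding eq by (intro mult_right_mono L2.nonneg)
    also have "\<dots> = (c ^ 4 * quartic f) * (grad_ip \<Omega> f f)\<^sup>2" by (simp add: mult_ac)
    finally show ?thesis by (simp add: c(1))
  qed simp
qed

text \<open>For positive \<open>lam\<close> the Rayleigh bound absorbs the L^2 term; for negative
  \<open>lam\<close> that term has the good sign and is dropped, which explains the maximum.\<close>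

lemma coercive:
  assumes ne: "\<Omega> \<noteq> {}" and b: "0 < b" and lam: "lam < b * principal_eigenvalue \<Omega>"
  shows "0 < b - max lam 0 / principal_eigenvalue \<Omega>"
    and "f \<in> Sob1_0 \<Omega> \<Longrightarrow> (b - max lam 0 / principal_eigenvalue \<Omega>) * grad_ip \<Omega> f f
      \<le> b * grad_ip \<Omega> f f - lam * L2_ip \<Omega> f f"
proof -
  let ?l = "principal_eigenvalue \<Omega>"
  have l: "0 < ?l" by (rule principal_eigenvalue_Rayleigh(2)[OF ne])
  show "0 < b - max lam 0 / ?l" using l b lam by (auto simp: max_def field_simps)
  assume f: "f \<in> Sob1_0 \<Omega>"
  have "?l * L2_ip \<Omega> f f \<le> grad_ip \<Omega> f f"
    using principal_eigenvalue_Rayleigh(1)[OF ne f] by (simp add: L2.snorm_sq grad.snorm_sq)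
  then have "L2_ip \<Omega> f f \<le> grad_ip \<Omega> f f / ?l" using l by (simp add: field_simps)
  then have "max lam 0 * L2_ip \<Omega> f f \<le> max lam 0 * (grad_ip \<Omega> f f / ?l)"
    by (intro mult_left_mono) auto
  moreover have "lam * L2_ip \<Omega> f f \<le> max lam 0 * L2_ip \<Omega> f f"
    by (intro mult_right_mono L2.nonneg) auto
  ultimately show "(b - max lam 0 / ?l) * grad_ip \<Omega> f f \<le> b * grad_ip \<Omega> f f - lam * L2_ip \<Omega> f f"
    by (simp add: left_diff_distrib)
qed

section \<open>Bounds for solutions where J itself is coercive\<close>

lemma sol_size_eq: "sol_size \<Omega> T u t = Lnorm \<Omega> 2 (time_deriv \<Omega> T u t) + sqrt (grad_ip \<Omega> (u t) (u t))"
  by (simp add: sol_size_def Lnorm_2_wgrad)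

lemma sol_size_le:
  assumes "(Lnorm \<Omega> 2 (time_deriv \<Omega> T u t))\<^sup>2 \<le> A" "grad_ip \<Omega> (u t) (u t) \<le> Y"
  shows "sol_size \<Omega> T u t \<le> sqrt A + sqrt Y"
  unfolding sol_size_eq using assms by (intro add_mono real_le_rsqrt real_sqrt_le_mono)

lemma maximal_solution_energy:
  assumes "maximal_solution \<Omega> a b lam u0 u1 u" "0 \<le> t" "ereal t < T_max \<Omega> a b lam u0 u1"
  shows "1 / 2 * (Lnorm \<Omega> 2 (time_deriv \<Omega> (T_max \<Omega> a b lam u0 u1) u t))\<^sup>2 + J_fun \<Omega> a b lam (u t)
      = initial_energy \<Omega> a b lam u0 u1"
    and "u t \<in> Sob1_0 \<Omega>"
  using assms energy_conservation[of a b lam u0 u1 "T_max \<Omega> a b lam u0 u1" u t]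
    solution_continuous(3)[of a b lam u0 u1 "T_max \<Omega> a b lam u0 u1" u t]
  by (auto simp: maximal_solution_def time_interval_def)

text \<open>Here \<open>lam\<close> is arbitrary and the quadratic part of J may be negative; the
  surplus \<open>a - 1 / Lambda_const \<Omega>\<close> of the quartic coefficient dominates it for
  large gradients.\<close>

lemma bound_H1:
  assumes ne: "\<Omega> \<noteq> {}" and b: "0 < b" and H: "hyp_H1 \<Omega> a"
    and sol: "maximal_solution \<Omega> a b lam u0 u1 u"
  obtains K where "0 < K"
    "\<And>t. 0 \<le> t \<Longrightarrow> ereal t < T_max \<Omega> a b lam u0 u1 \<Longrightarrow> sol_size \<Omega> (T_max \<Omega> a b lam u0 u1) u t \<le> K"
proof -
  define c where "c = a - 1 / Lambda_const \<Omega>"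
  have c: "0 < c" using H by (simp add: c_def hyp_H1_def)
  obtain C where C: "0 < C" "\<And>f. f \<in> Sob1_0 \<Omega> \<Longrightarrow> L2.snorm \<Omega> f \<le> C * grad.snorm f"
    by (rule Poincare) blast
  define M where "M = \<bar>lam\<bar> * C\<^sup>2 / 2"
  have M: "0 \<le> M" by (simp add: M_def)
  define E0 where "E0 = initial_energy \<Omega> a b lam u0 u1"
  \<comment> \<open>Above \<open>4 * (M + 1) / c\<close> the lower bound for J exceeds its argument,
    so a value beyond \<open>Y\<close> would be at most \<open>E0\<close>; the summand
    \<open>\<bar>E0\<bar> + 1\<close> makes this impossible.\<close>
  define Y where "Y = 4 * (M + 1) / c + \<bar>E0\<bar> + 1"
  have Y: "1 \<le> Y" using c M by (simp add: Y_def)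
  have J: "c / 4 * (grad_ip \<Omega> f f)\<^sup>2 - M * grad_ip \<Omega> f f \<le> J_fun \<Omega> a b lam f" if f: "f \<in> Sob1_0 \<Omega>" for f
  proof -
    have "(L2.snorm \<Omega> f)\<^sup>2 \<le> (C * grad.snorm f)\<^sup>2" by (intro power_mono C f L2.snorm_nonneg)
    then have "L2_ip \<Omega> f f \<le> C\<^sup>2 * grad_ip \<Omega> f f" by (simp add: L2.snorm_sq grad.snorm_sq power_mult_distrib)
    then have "\<bar>lam\<bar> * L2_ip \<Omega> f f \<le> \<bar>lam\<bar> * (C\<^sup>2 * grad_ip \<Omega> f f)" by (intro mult_left_mono) auto
    moreover have "lam * L2_ip \<Omega> f f \<le> \<bar>lam\<bar> * L2_ip \<Omega> f f" by (intro mult_right_mono L2.nonneg) auto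
    ultimately have 1: "lam / 2 * L2_ip \<Omega> f f \<le> M * grad_ip \<Omega> f f" by (simp add: M_def)
    have "quartic f \<le> 1 / Lambda_const \<Omega> * (grad_ip \<Omega> f f)\<^sup>2"
      using Lambda_const_bound(2)[OF ne f] Lambda_const_bound(1)[OF ne] by (simp add: field_simps)
    then have 2: "c * (grad_ip \<Omega> f f)\<^sup>2 \<le> a * (grad_ip \<Omega> f f)\<^sup>2 - quartic f"
      by (simp add: c_def left_diff_distrib)
    have 3: "0 \<le> b / 2 * grad_ip \<Omega> f f" using b grad.nonneg[of f] by simp
    show ?thesis unfolding J_fun_eq using 1 2 3 by linarith
  qed
  have bound: "grad_ip \<Omega> (u t) (u t) \<le> Y" "(Lnorm \<Omega> 2 (time_deriv \<Omega> (T_max \<Omega> a b lam u0 u1) u t))\<^sup>2 \<le> 2 * (E0 + M * Y)"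
    if t: "0 \<le> t" "ereal t < T_max \<Omega> a b lam u0 u1" for t
  proof -
    let ?y = "grad_ip \<Omega> (u t) (u t)" and ?N = "Lnorm \<Omega> 2 (time_deriv \<Omega> (T_max \<Omega> a b lam u0 u1) u t)"
    note E = maximal_solution_energy[OF sol t, folded E0_def]
    have y0: "0 \<le> ?y" by (rule grad.nonneg)
    have J': "c / 4 * ?y\<^sup>2 - M * ?y \<le> J_fun \<Omega> a b lam (u t)" by (rule J[OF E(2)])
    have E': "c / 4 * ?y\<^sup>2 - M * ?y \<le> E0" using E(1) J' zero_le_power2[of ?N] by linarith
    show y: "?y \<le> Y"
    proof (rule ccontr)
      assume "\<not> ?y \<le> Y"
      then have y: "Y < ?y" by simp
      have "4 * (M + 1) / c \<le> ?y" using y by (simp add: Y_def)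
      then have "1 \<le> c / 4 * ?y - M" using c by (simp add: field_simps)
      then have "?y * 1 \<le> ?y * (c / 4 * ?y - M)" using y0 by (rule mult_left_mono)
      also have "\<dots> = c / 4 * ?y\<^sup>2 - M * ?y" by (simp add: power2_eq_square algebra_simps)
      finally have "?y \<le> E0" using E' by simp
      moreover have "0 \<le> 4 * (M + 1) / c" using c M by simp
      ultimately show False using y unfolding Y_def by linarith
    qed
    have "M * ?y \<le> M * Y" using y M by (rule mult_left_mono)
    moreover have "0 \<le> c / 4 * ?y\<^sup>2" using c by simp
    ultimately have "?N\<^sup>2 \<le> 2 * E0 + 2 * (M * Y)" using E(1) J' by linarith
    then show "?N\<^sup>2 \<le> 2 * (E0 + M * Y)" by (simp add: distrib_left)
  qed
  show thesis
  \<comment> \<open>The absolute value and the added 1 give a positive constant without any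
    information on the signs of the quantities under the roots.\<close>
  proof (rule that[of "\<bar>sqrt (2 * (E0 + M * Y)) + sqrt Y\<bar> + 1"])
    fix t assume "0 \<le> t" "ereal t < T_max \<Omega> a b lam u0 u1"
    from sol_size_le[OF bound(2,1)[OF this]]
    show "sol_size \<Omega> (T_max \<Omega> a b lam u0 u1) u t \<le> \<bar>sqrt (2 * (E0 + M * Y)) + sqrt Y\<bar> + 1" by linarith
  qed simp
qed

text \<open>At the critical value of \<open>a\<close> the two quartic terms of J have a nonnegative
  difference, and half of the coercive quadratic part remains.\<close>

lemma bound_H2:
  assumes ne: "\<Omega> \<noteq> {}" and b: "0 < b" and H: "hyp_H2 \<Omega> a b lam"
    and sol: "maximal_solution \<Omega> a b lam u0 u1 u"
  obtains K where "0 < K"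
    "\<And>t. 0 \<le> t \<Longrightarrow> ereal t < T_max \<Omega> a b lam u0 u1 \<Longrightarrow> sol_size \<Omega> (T_max \<Omega> a b lam u0 u1) u t \<le> K"
proof -
  have a: "a = 1 / Lambda_const \<Omega>" and lam: "lam < b * principal_eigenvalue \<Omega>"
    using H by (auto simp: hyp_H2_def)
  define d where "d = b - max lam 0 / principal_eigenvalue \<Omega>"
  note d = coercive[OF ne b lam, folded d_def]
  define E0 where "E0 = initial_energy \<Omega> a b lam u0 u1"
  have bound: "grad_ip \<Omega> (u t) (u t) \<le> 2 * E0 / d" "(Lnorm \<Omega> 2 (time_deriv \<Omega> (T_max \<Omega> a b lam u0 u1) u t))\<^sup>2 \<le> 2 * E0"
    if t: "0 \<le> t" "ereal t < T_max \<Omega> a b lam u0 u1" for t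
  proof -
    let ?y = "grad_ip \<Omega> (u t) (u t)" and ?N = "Lnorm \<Omega> 2 (time_deriv \<Omega> (T_max \<Omega> a b lam u0 u1) u t)"
    note E = maximal_solution_energy[OF sol t, folded E0_def]
    have "quartic (u t) \<le> a * ?y\<^sup>2"
      using Lambda_const_bound(2)[OF ne E(2)] Lambda_const_bound(1)[OF ne] by (simp add: a field_simps)
    then have J: "d / 2 * ?y \<le> J_fun \<Omega> a b lam (u t)"
      unfolding J_fun_eq using d(2)[OF E(2)] by simp
    have "0 \<le> d / 2 * ?y" using d(1) grad.nonneg[of "u t"] by simp
    then show "?N\<^sup>2 \<le> 2 * E0" using E(1) J by linarith
    have "d / 2 * ?y \<le> E0" using E(1) J zero_le_power2[of ?N] by linarith
    then show "?y \<le> 2 * E0 / d" using d(1) by (simp add: field_simps)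
  qed
  show thesis
  proof (rule that[of "\<bar>sqrt (2 * E0) + sqrt (2 * E0 / d)\<bar> + 1"])
    fix t assume "0 \<le> t" "ereal t < T_max \<Omega> a b lam u0 u1"
    from sol_size_le[OF bound(2,1)[OF this]]
    show "sol_size \<Omega> (T_max \<Omega> a b lam u0 u1) u t \<le> \<bar>sqrt (2 * E0) + sqrt (2 * E0 / d)\<bar> + 1" by linarith
  qed simp
qed

section \<open>The potential well, its invariance and its depth\<close>

lemma J_fun_I_fun:
  "J_fun \<Omega> a b lam f = 1 / 4 * I_fun \<Omega> a b lam f + 1 / 4 * (b * grad_ip \<Omega> f f - lam * L2_ip \<Omega> f f)"
  by (simp add: J_fun_eq I_fun_eq field_simps)

text \<open>An infimum is a lower bound only over a set bounded below; on \<open>N3\<close> the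
  functional I vanishes and J reduces to a quarter of the quadratic part, which is
  nonnegative.\<close>

lemma d3_le:
  assumes ne: "\<Omega> \<noteq> {}" and b: "0 < b" and lam: "lam < b * principal_eigenvalue \<Omega>"
    and f: "f \<in> N3 \<Omega> a b lam"
  shows "d3 \<Omega> a b lam \<le> J_fun \<Omega> a b lam f"
  unfolding d3_def
proof (rule cINF_lower[OF _ f])
  show "bdd_below (J_fun \<Omega> a b lam ` N3 \<Omega> a b lam)"
  proof (rule bdd_belowI2)
    fix g assume g: "g \<in> N3 \<Omega> a b lam"
    then have "g \<in> Sob1_0 \<Omega>" "I_fun \<Omega> a b lam g = 0" by (auto simp: N3_def)
    then show "0 \<le> J_fun \<Omega> a b lam g"
      using coercive[OF ne b lam] mult_nonneg_nonneg[OF less_imp_le[OF coercive(1)[OF ne b lam]] grad.nonneg[of g]]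
      by (fastforce simp: J_fun_I_fun)
  qed
qed

text \<open>The trajectory cannot leave the well: \<open>I\<close> would have to vanish first, and it can neither do so
  on \<open>N3\<close>, where \<open>J \<ge> d3 > E(0)\<close>, nor at the origin, near which \<open>I\<close> is nonnegative.\<close>

lemma stable_set_invariant:
  assumes ne: "\<Omega> \<noteq> {}" and b: "0 < b" and H: "hyp_H3 \<Omega> a b lam u0 u1"
    and sol: "maximal_solution \<Omega> a b lam u0 u1 u"
    and t: "0 \<le> t1" "ereal t1 < T_max \<Omega> a b lam u0 u1"
  shows "0 \<le> I_fun \<Omega> a b lam (u t1)"
proof (rule ccontr)
  let ?T = "T_max \<Omega> a b lam u0 u1"
  let ?\<phi> = "\<lambda>t. I_fun \<Omega> a b lam (u t)" and ?y = "\<lambda>t. grad_ip \<Omega> (u t) (u t)"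
  assume "\<not> 0 \<le> ?\<phi> t1"
  then have neg: "?\<phi> t1 < 0" by simp
  have a: "0 < a" and lam: "lam < b * principal_eigenvalue \<Omega>" and u0W: "u0 \<in> W3_plus \<Omega> a b lam"
    and E0: "initial_energy \<Omega> a b lam u0 u1 < d3 \<Omega> a b lam"
    using H by (auto simp: hyp_H3_def)
  have ks: "kirchhoff_solution \<Omega> a b lam u0 u1 ?T u" and u0S: "u0 \<in> Sob1_0 \<Omega>"
    using sol by (auto simp: maximal_solution_def)
  define d where "d = b - max lam 0 / principal_eigenvalue \<Omega>"
  note d = coercive[OF ne b lam, folded d_def]
  obtain C where C: "0 < C" "\<And>f. f \<in> Sob1_0 \<Omega> \<Longrightarrow> quartic f \<le> C * (grad_ip \<Omega> f f)\<^sup>2"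
    by (rule quartic_le) blast
  have t1I: "t1 \<in> time_interval ?T" using t by (simp add: time_interval_def)
  have sub: "{0..t1} \<subseteq> time_interval ?T" using time_interval_downward[OF t1I] by auto
  have uS: "u t \<in> Sob1_0 \<Omega>" if "t \<in> {0..t1}" for t using solution_continuous(3)[OF ks] sub that by blast
  have cont: "continuous_on {0..t1} ?\<phi>" "continuous_on {0..t1} ?y"
    using solution_continuous[OF ks] sub by (auto intro: continuous_on_subset)
  have start: "0 \<le> ?\<phi> 0"
  proof -
    \<comment> \<open>The stable set contains the a.e. zero functions separately, so the sign of I
      at such initial data needs its own argument.\<close>
    have z: "I_fun \<Omega> a b lam f = 0" if "f \<in> Sob1_0 \<Omega>" "ae_eq \<Omega> f (\<lambda>_. 0)" for f
    proof -
      have f0: "(\<lambda>x. 0 * f x) \<in> Sob1_0 \<Omega>" by (rule Sob1_0_scale[OF that(1)])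
      have "I_fun \<Omega> a b lam f = I_fun \<Omega> a b lam (\<lambda>x. 0 * f x)"
        by (rule functionals_cong_AE(3)[OF that(1) f0]) (use that(2) in simp)
      also have "\<dots> = 0"
        unfolding I_fun_eq using grad.B_scale[OF Sob1_0_Sob1[OF that(1)], of 0] by (simp add: L2_ip_def)
      finally show ?thesis .
    qed
    have "0 \<le> I_fun \<Omega> a b lam u0" using u0W z by (auto simp: W3_plus_def N3_plus_def)
    moreover have "I_fun \<Omega> a b lam (u 0) = I_fun \<Omega> a b lam u0"
      using ks uS[of 0] t(1) u0S by (intro functionals_cong_AE(3)) (auto simp: kirchhoff_solution_def)
    ultimately show ?thesis by simp
  qed
  \<comment> \<open>The latest time in the interval at which I is nonnegative; after it I stays
    negative up to \<open>t1\<close>.\<close>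
  define S where "S = {0..t1} \<inter> ?\<phi> -` {0..}"
  have "closed S" unfolding S_def by (rule continuous_closed_preimage[OF cont(1)]) auto
  then have "compact S" by (auto simp: compact_eq_bounded_closed S_def intro: bounded_subset[OF bounded_closed_interval])
  moreover have "0 \<in> S" using t(1) start by (simp add: S_def)
  ultimately obtain s where s: "s \<in> S" "\<And>t. t \<in> S \<Longrightarrow> t \<le> s"
    using compact_attains_sup[of S] by auto
  have s01: "0 \<le> s" "s < t1" "0 \<le> ?\<phi> s" using s(1) neg by (auto simp: S_def less_le)
  have after: "?\<phi> t < 0" if "s < t" "t \<le> t1" for t
    using s(2)[of t] that s01(1) by (force simp: S_def)
  have near: False if P: "\<forall>\<^sub>F t in at s within {0..t1}. 0 \<le> ?\<phi> t"
  proof -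
    obtain e where e: "0 < e" "\<And>t. t \<in> {0..t1} \<Longrightarrow> t \<noteq> s \<Longrightarrow> dist t s < e \<Longrightarrow> 0 \<le> ?\<phi> t"
      using P unfolding eventually_at by blast
    define t where "t = min t1 (s + e / 2)"
    have "s < t" "t \<le> t1" "dist t s < e" using e(1) s01 by (auto simp: t_def dist_real_def)
    then show False using e(2)[of t] after[of t] s01(1) by auto
  qed
  have sI: "s \<in> {0..t1}" using s01 by simp
  have "?\<phi> s = 0"
  proof (rule ccontr)
    assume "?\<phi> s \<noteq> 0"
    then have "0 < ?\<phi> s" using s01(3) by simp
    moreover have "(?\<phi> \<longlongrightarrow> ?\<phi> s) (at s within {0..t1})" using cont(1) sI by (simp add: continuous_on)
    ultimately have "\<forall>\<^sub>F t in at s within {0..t1}. 0 < ?\<phi> t" by (rule order_tendstoD(1)[rotated])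
    then show False by (intro near) (auto elim: eventually_mono)
  qed
  moreover have "J_fun \<Omega> a b lam (u s) < d3 \<Omega> a b lam"
  proof -
    have "ereal s < ?T" using sub sI by (auto simp: time_interval_def)
    from maximal_solution_energy(1)[OF sol s01(1) this] show ?thesis
      using E0 zero_le_power2[of "Lnorm \<Omega> 2 (time_deriv \<Omega> ?T u s)"] by linarith
  qed
  ultimately have "ae_eq \<Omega> (u s) (\<lambda>_. 0)"
    using d3_le[OF ne b lam, of "u s" a] uS[OF sI] by (force simp: N3_def)
  then have "?y s = grad_ip \<Omega> (\<lambda>x. 0 * u s x) (\<lambda>x. 0 * u s x)"
    by (intro functionals_cong_AE(1) uS[OF sI] Sob1_0_scale) simp
  then have ys: "?y s = 0" using grad.B_scale[OF Sob1_0_Sob1[OF uS[OF sI]], of 0] by simp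
  have "(?y \<longlongrightarrow> ?y s) (at s within {0..t1})" using cont(2) sI by (simp add: continuous_on)
  \<comment> \<open>Below the threshold \<open>d / C\<close> the quartic term is at most
    \<open>d\<close> times the squared gradient norm and is absorbed by the coercive quadratic
    part.\<close>
  then have "\<forall>\<^sub>F t in at s within {0..t1}. ?y t < d / C"
    by (rule order_tendstoD(2)) (use ys d(1) C(1) in simp)
  then have "\<forall>\<^sub>F t in at s within {0..t1}. 0 \<le> ?\<phi> t"
    using eventually_within_mem
  proof eventually_elim
    case (elim t)
    have y0: "0 \<le> ?y t" by (rule grad.nonneg)
    have "C * ?y t \<le> d" using elim(1) C(1) by (simp add: field_simps)
    then have "C * ?y t * ?y t \<le> d * ?y t" using y0 by (rule mult_right_mono)
    moreover have "quartic (u t) \<le> C * ?y t * ?y t"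
      using C(2)[OF uS[OF elim(2)]] by (simp add: power2_eq_square mult.assoc)
    moreover have "d * ?y t \<le> b * ?y t - lam * L2_ip \<Omega> (u t) (u t)" by (rule d(2)[OF uS[OF elim(2)]])
    moreover have "0 \<le> a * (?y t)\<^sup>2" using a by simp
    ultimately show ?case unfolding I_fun_eq by linarith
  qed
  then show False by (rule near)
qed

text \<open>With I nonnegative, J is at least a quarter of the coercive quadratic part, so kinetic
  energy and gradient share a budget below \<open>d3\<close>. The constant is kept explicit for the
  limit in \<open>lam\<close>.\<close>

lemma bound_H3:
  assumes ne: "\<Omega> \<noteq> {}" and b: "0 < b" and H: "hyp_H3 \<Omega> a b lam u0 u1"
    and sol: "maximal_solution \<Omega> a b lam u0 u1 u"
    and t: "0 \<le> t" "ereal t < T_max \<Omega> a b lam u0 u1"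
  shows "sol_size \<Omega> (T_max \<Omega> a b lam u0 u1) u t
    \<le> sqrt (2 * d3 \<Omega> a b lam) + sqrt (4 * d3 \<Omega> a b lam / (b - max lam 0 / principal_eigenvalue \<Omega>))"
proof (rule sol_size_le)
  let ?y = "grad_ip \<Omega> (u t) (u t)" and ?N = "Lnorm \<Omega> 2 (time_deriv \<Omega> (T_max \<Omega> a b lam u0 u1) u t)"
  have lam: "lam < b * principal_eigenvalue \<Omega>" and E0: "initial_energy \<Omega> a b lam u0 u1 < d3 \<Omega> a b lam"
    using H by (auto simp: hyp_H3_def)
  define d where "d = b - max lam 0 / principal_eigenvalue \<Omega>"
  note d = coercive[OF ne b lam, folded d_def]
  note E = maximal_solution_energy[OF sol t]
  have J: "d / 4 * ?y \<le> J_fun \<Omega> a b lam (u t)"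
    unfolding J_fun_I_fun using stable_set_invariant[OF ne b H sol t] d(2)[OF E(2)] by (simp add: field_simps)
  have "0 \<le> d / 4 * ?y" using d(1) grad.nonneg[of "u t"] by simp
  then show "?N\<^sup>2 \<le> 2 * d3 \<Omega> a b lam" using E(1) J E0 by linarith
  have "d / 4 * ?y \<le> d3 \<Omega> a b lam" using E(1) J E0 zero_le_power2[of ?N] by linarith
  then show "?y \<le> 4 * d3 \<Omega> a b lam / (b - max lam 0 / principal_eigenvalue \<Omega>)"
    unfolding d_def[symmetric] using d(1) by (simp add: field_simps)
qed

text \<open>The multiple \<open>s \<psi>\<close> lies on \<open>N3\<close> when \<open>s\<^sup>2 D = (b \<lambda>\<^sub>1 - lam) \<parallel>\<psi>\<parallel>\<^sub>2\<^sup>2\<close>, with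
  \<open>D = \<parallel>\<psi>\<parallel>\<^sub>4\<^sup>4 - a \<parallel>\<nabla>\<psi>\<parallel>\<^sub>2\<^sup>4\<close>.\<close>

lemma d3_upper_bound:
  assumes ne: "\<Omega> \<noteq> {}" and b: "0 < b" and lam: "lam < b * principal_eigenvalue \<Omega>"
    and \<psi>: "dirichlet_eigenfunction \<Omega> (principal_eigenvalue \<Omega>) \<psi>"
    and D: "D = (Lnorm \<Omega> 4 \<psi>) ^ 4 - a * (Lnorm \<Omega> 2 (wgrad \<Omega> \<psi>)) ^ 4" "0 < D"
  shows "d3 \<Omega> a b lam \<le> (b * principal_eigenvalue \<Omega> - lam)\<^sup>2 * ((L2.snorm \<Omega> \<psi>) ^ 4 / (4 * D))"
proof -
  let ?l = "principal_eigenvalue \<Omega>"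
  have \<psi>S: "\<psi> \<in> Sob1_0 \<Omega>" "\<not> ae_eq \<Omega> \<psi> (\<lambda>_. 0)" using \<psi> by (auto simp: dirichlet_eigenfunction_def)
  define L where "L = (L2.snorm \<Omega> \<psi>)\<^sup>2"
  have L: "0 < L" using eigenfunction_norms(2)[OF \<psi>] by (simp add: L_def)
  have g: "grad_ip \<Omega> \<psi> \<psi> = ?l * L" using eigenfunction_norms(1)[OF \<psi>] by (simp add: L_def grad.snorm_sq)
  have DQ: "D = quartic \<psi> - a * (grad_ip \<Omega> \<psi> \<psi>)\<^sup>2" by (simp add: D(1) Lnorm_4_power grad_snorm_4)
  define x where "x = b * ?l - lam"
  have x: "0 < x" using lam by (simp add: x_def)
  define s where "s = sqrt (x * L / D)"
  have s: "0 < s" "s\<^sup>2 = x * L / D" using x L D(2) by (simp_all add: s_def)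
  have sc: "grad_ip \<Omega> (\<lambda>x. s * \<psi> x) (\<lambda>x. s * \<psi> x) = s\<^sup>2 * grad_ip \<Omega> \<psi> \<psi>"
    "L2_ip \<Omega> (\<lambda>x. s * \<psi> x) (\<lambda>x. s * \<psi> x) = s\<^sup>2 * L"
    using grad.B_scale[OF Sob1_0_Sob1[OF \<psi>S(1)]] L2.B_scale[OF Sob1_L2[OF Sob1_0_Sob1[OF \<psi>S(1)]]]
    by (simp_all add: L_def L2.snorm_sq)
  have quad: "b * grad_ip \<Omega> (\<lambda>x. s * \<psi> x) (\<lambda>x. s * \<psi> x) - lam * L2_ip \<Omega> (\<lambda>x. s * \<psi> x) (\<lambda>x. s * \<psi> x) = s\<^sup>2 * (x * L)"
    unfolding sc g by (simp add: x_def algebra_simps)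
  have s4: "s ^ 4 = s\<^sup>2 * s\<^sup>2" by (simp flip: power_add)
  have "(grad_ip \<Omega> (\<lambda>x. s * \<psi> x) (\<lambda>x. s * \<psi> x))\<^sup>2 = s ^ 4 * (grad_ip \<Omega> \<psi> \<psi>)\<^sup>2"
    unfolding sc(1) by (simp add: power_mult_distrib flip: power_mult)
  then have "I_fun \<Omega> a b lam (\<lambda>x. s * \<psi> x)
      = a * (s ^ 4 * (grad_ip \<Omega> \<psi> \<psi>)\<^sup>2) + s\<^sup>2 * (x * L) - s ^ 4 * quartic \<psi>"
    unfolding I_fun_eq quartic_scale quad[symmetric] by simp
  also have "\<dots> = s\<^sup>2 * (x * L) - s ^ 4 * D" by (simp add: DQ algebra_simps)
  also have "s ^ 4 * D = s\<^sup>2 * (x * L)" unfolding s4 using D(2) by (simp add: s(2))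
  finally have I0: "I_fun \<Omega> a b lam (\<lambda>x. s * \<psi> x) = 0" by simp
  have "\<not> ae_eq \<Omega> (\<lambda>x. s * \<psi> x) (\<lambda>_. 0)"
    using \<psi>S(2) s(1) by (simp add: ae_eq_def)
  then have "(\<lambda>x. s * \<psi> x) \<in> N3 \<Omega> a b lam"
    using I0 Sob1_0_scale[OF \<psi>S(1)] by (simp add: N3_def)
  from d3_le[OF ne b lam this] have "d3 \<Omega> a b lam \<le> 1 / 4 * (s\<^sup>2 * (x * L))"
    unfolding J_fun_I_fun I0 quad by simp
  also have "\<dots> = x\<^sup>2 * ((L2.snorm \<Omega> \<psi>) ^ 4 / (4 * D))"
    unfolding s(2) using D(2) by (simp add: L_def power2_eq_square power4_eq_xxxx)
  finally show ?thesis by (simp add: x_def)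
qed

text \<open>Dividing the depth, at most \<open>c\<close> times the square of the gap
  \<open>b * ?l - lam\<close>, by the coercivity constant, the gap over \<open>?l\<close>, leaves
  one power of the gap under the root. \<open>hyp_H3\<close> on \<open>S\<close> forces the approach
  to be from below.\<close>

lemma sol_size_tendsto_0:
  assumes ne: "\<Omega> \<noteq> {}" and b: "0 < b"
    and \<psi>: "dirichlet_eigenfunction \<Omega> (principal_eigenvalue \<Omega>) \<psi>"
    and D: "0 < (Lnorm \<Omega> 4 \<psi>) ^ 4 - a * (Lnorm \<Omega> 2 (wgrad \<Omega> \<psi>)) ^ 4" and t: "0 \<le> t"
    and sol: "\<And>lam. lam \<in> S \<Longrightarrow> maximal_solution \<Omega> a b lam (u0 lam) (u1 lam) (u lam) \<and>
      hyp_H3 \<Omega> a b lam (u0 lam) (u1 lam) \<and> ereal t < T_max \<Omega> a b lam (u0 lam) (u1 lam)"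
  shows "((\<lambda>lam. sol_size \<Omega> (T_max \<Omega> a b lam (u0 lam) (u1 lam)) (u lam) t) \<longlongrightarrow> 0)
    (at (b * principal_eigenvalue \<Omega>) within S)"
proof -
  let ?l = "principal_eigenvalue \<Omega>"
  define c where "c = (L2.snorm \<Omega> \<psi>) ^ 4 / (4 * ((Lnorm \<Omega> 4 \<psi>) ^ 4 - a * (Lnorm \<Omega> 2 (wgrad \<Omega> \<psi>)) ^ 4))"
  have l: "0 < ?l" by (rule principal_eigenvalue_Rayleigh(2)[OF ne])
  have bl: "0 < b * ?l" using b l by simp
  have size0: "0 \<le> sol_size \<Omega> T w t" for T w
    by (simp add: sol_size_eq Lnorm_2_eq_snorm L2.snorm_nonneg grad.nonneg)
  show ?thesis
  proof (rule Lim_null_comparison)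
    \<comment> \<open>The limit point is positive, so \<open>lam\<close> is eventually positive and
      the maximum in the coercivity constant disappears.\<close>
    have "\<forall>\<^sub>F lam in at (b * ?l) within S. 0 < lam"
      using order_tendstoD(1)[OF tendsto_ident_at bl] .
    then show "\<forall>\<^sub>F lam in at (b * ?l) within S. norm (sol_size \<Omega> (T_max \<Omega> a b lam (u0 lam) (u1 lam)) (u lam) t)
      \<le> sqrt (2 * ((b * ?l - lam)\<^sup>2 * c)) + sqrt (4 * ((b * ?l - lam) * ?l * c))"
      using eventually_within_mem
    proof eventually_elim
      case (elim lam)
      have s: "maximal_solution \<Omega> a b lam (u0 lam) (u1 lam) (u lam)" "hyp_H3 \<Omega> a b lam (u0 lam) (u1 lam)"
        "ereal t < T_max \<Omega> a b lam (u0 lam) (u1 lam)" using sol[OF elim(2)] by auto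
      have lam: "lam < b * ?l" using s(2) by (simp add: hyp_H3_def)
      have d3: "d3 \<Omega> a b lam \<le> (b * ?l - lam)\<^sup>2 * c"
        unfolding c_def by (rule d3_upper_bound[OF ne b lam \<psi> refl D])
      have den: "b - max lam 0 / ?l = (b * ?l - lam) / ?l" using elim(1) l by (simp add: field_simps)
      have "4 * d3 \<Omega> a b lam / (b - max lam 0 / ?l) \<le> 4 * ((b * ?l - lam)\<^sup>2 * c) / (b - max lam 0 / ?l)"
        using d3 lam l unfolding den by (intro divide_right_mono mult_left_mono) auto
      also have "\<dots> = 4 * ((b * ?l - lam) * ?l * c)"
        unfolding den using lam l by (simp add: power2_eq_square)
      finally have "sqrt (2 * d3 \<Omega> a b lam) + sqrt (4 * d3 \<Omega> a b lam / (b - max lam 0 / ?l))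
          \<le> sqrt (2 * ((b * ?l - lam)\<^sup>2 * c)) + sqrt (4 * ((b * ?l - lam) * ?l * c))"
        using d3 by (intro add_mono real_sqrt_le_mono) auto
      with bound_H3[OF ne b s(2,1) t s(3)] size0 show ?case by simp
    qed
    have "((\<lambda>lam. sqrt (2 * ((b * ?l - lam)\<^sup>2 * c)) + sqrt (4 * ((b * ?l - lam) * ?l * c)))
        \<longlongrightarrow> sqrt (2 * ((b * ?l - b * ?l)\<^sup>2 * c)) + sqrt (4 * ((b * ?l - b * ?l) * ?l * c))) (at (b * ?l) within S)"
      by (intro tendsto_intros)
    then show "((\<lambda>lam. sqrt (2 * ((b * ?l - lam)\<^sup>2 * c)) + sqrt (4 * ((b * ?l - lam) * ?l * c))) \<longlongrightarrow> 0)
        (at (b * ?l) within S)" by simp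
  qed
qed

end

text \<open>On the empty set there are neither eigenfunctions nor functions of unit L^4 norm, so the
  infima behind the hypotheses are over empty sets; there the claim holds because all norms
  vanish.\<close>

lemma sol_size_empty: "sol_size {} T u t = 0"
  by (simp add: sol_size_def Lnorm_def)

theorem theorem2p4:
  fixes \<Omega> :: "(real^3) set" and a b :: real
  assumes "open \<Omega>" and "bounded \<Omega>" and "smooth_boundary \<Omega>" and "b > 0"
  shows
    "(\<forall>(lam::real) u0 u1 u.
        maximal_solution \<Omega> a b lam u0 u1 u \<and>
        (hyp_H1 \<Omega> a \<or> hyp_H2 \<Omega> a b lam \<or> hyp_H3 \<Omega> a b lam u0 u1) \<longrightarrow>
        (\<exists>K2>0. \<forall>t. 0 \<le> t \<and> ereal t < T_max \<Omega> a b lam u0 u1 \<longrightarrow>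
           sol_size \<Omega> (T_max \<Omega> a b lam u0 u1) u t \<le> K2))
     \<and>
     (\<forall>\<psi>1 (S::real set) (u0::real \<Rightarrow> real^3 \<Rightarrow> real) u1 u (t::real).
        positive_principal_eigenfunction \<Omega> \<psi>1 \<and>
        (Lnorm \<Omega> 4 \<psi>1) ^ 4 - a * (Lnorm \<Omega> 2 (wgrad \<Omega> \<psi>1)) ^ 4 > 0 \<and>
        0 \<le> t \<and>
        (\<forall>lam\<in>S. maximal_solution \<Omega> a b lam (u0 lam) (u1 lam) (u lam) \<and>
           hyp_H3 \<Omega> a b lam (u0 lam) (u1 lam) \<and>
           ereal t < T_max \<Omega> a b lam (u0 lam) (u1 lam)) \<longrightarrow>
        ((\<lambda>lam. sol_size \<Omega> (T_max \<Omega> a b lam (u0 lam) (u1 lam)) (u lam) t) \<longlongrightarrow> 0)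
          (at (b * principal_eigenvalue \<Omega>) within S))"
proof (cases "\<Omega> = {}")
  case True
  show ?thesis
  proof (intro conjI allI impI)
    fix lam u0 u1 u
    show "\<exists>K2>0. \<forall>t. 0 \<le> t \<and> ereal t < T_max \<Omega> a b lam u0 u1 \<longrightarrow>
        sol_size \<Omega> (T_max \<Omega> a b lam u0 u1) u t \<le> K2"
      unfolding True sol_size_empty by (intro exI[of _ 1]) simp
  qed (simp add: True sol_size_empty)
next
  case False
  interpret bounded_open_set3 \<Omega> by unfold_locales fact+
  show ?thesis
  proof (intro conjI allI impI, elim conjE disjE)
    fix lam u0 u1 u
    assume sol: "maximal_solution \<Omega> a b lam u0 u1 u"
    let ?T = "T_max \<Omega> a b lam u0 u1"
    let ?thesis = "\<exists>K2>0. \<forall>t. 0 \<le> t \<and> ereal t < ?T \<longrightarrow> sol_size \<Omega> ?T u t \<le> K2"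
    show ?thesis if "hyp_H1 \<Omega> a"
      by (rule bound_H1[OF False \<open>b > 0\<close> that sol]) blast
    show ?thesis if "hyp_H2 \<Omega> a b lam"
      by (rule bound_H2[OF False \<open>b > 0\<close> that sol]) blast
    show ?thesis if H3: "hyp_H3 \<Omega> a b lam u0 u1"
    proof -
      let ?K = "sqrt (2 * d3 \<Omega> a b lam) + sqrt (4 * d3 \<Omega> a b lam / (b - max lam 0 / principal_eigenvalue \<Omega>))"
      have "sol_size \<Omega> ?T u t \<le> \<bar>?K\<bar> + 1" if "0 \<le> t \<and> ereal t < ?T" for t
        using bound_H3[OF False \<open>b > 0\<close> H3 sol, of t] that by linarith
      then show ?thesis by (intro exI[of _ "\<bar>?K\<bar> + 1"]) auto
    qed
  next
    fix \<psi>1 S t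
    fix u0 u1 :: "real \<Rightarrow> real^3 \<Rightarrow> real" and u :: "real \<Rightarrow> real \<Rightarrow> real^3 \<Rightarrow> real"
    assume "positive_principal_eigenfunction \<Omega> \<psi>1 \<and>
        (Lnorm \<Omega> 4 \<psi>1) ^ 4 - a * (Lnorm \<Omega> 2 (wgrad \<Omega> \<psi>1)) ^ 4 > 0 \<and> 0 \<le> t \<and>
        (\<forall>lam\<in>S. maximal_solution \<Omega> a b lam (u0 lam) (u1 lam) (u lam) \<and>
           hyp_H3 \<Omega> a b lam (u0 lam) (u1 lam) \<and> ereal t < T_max \<Omega> a b lam (u0 lam) (u1 lam))"
    then show "((\<lambda>lam. sol_size \<Omega> (T_max \<Omega> a b lam (u0 lam) (u1 lam)) (u lam) t) \<longlongrightarrow> 0)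
          (at (b * principal_eigenvalue \<Omega>) within S)"
      by (intro sol_size_tendsto_0[OF False \<open>b > 0\<close>]) (auto simp: positive_principal_eigenfunction_def)
  qed
qed

end
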